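(* Let $d\ge1$ and $m\ge2d+1$. Any non-intertwining collection of $\binom{m-d-1}{d}$ elements of $\mathbf I^d_m$ is equal to $e(S)$ for a unique triangulation $S$ of the cyclic polytope $C(m,2d)$.
   Context: $C(m,2d)\subset\mathbb R^{2d}$ is the convex hull of $p_1,\dots,p_m$ with $p_t=(t,t^2,\dots,t^{2d})$. A triangulation of $C(m,2d)$ is a subdivision of it into $2d$-dimensional simplices (any two meeting in a common, possibly empty, face) whose vertices are vertices of $C(m,2d)$. A $d$-simplex in $C(m,2d)$ is the convex hull of $d+1$ vertices, recorded as the increasing $(d+1)$-tuple of their indices from $\{1,\dots,m\}$. Lower facets of $C(m,2d)$ are the facets dividing $C(m,2d)$ from the points below it with respect to the $2d$-th coordinate. For a triangulation $S$, $e(S)$ is the set of $d$-simplices in $C(m,2d)$ which appear as a face of some simplex in $S$ and which do not lie on any lower boundary facet of $C(m,2d)$. $\mathbf I^d_m=\{(i_0,\dots,i_d)\in\{1,\dots,m\}^{d+1}\mid i_x+2\le i_{x+1}\text{ for all }0\le x\le d-1\}$. For increasing $(d+1)$-tuples $X=(x_0,\dots,x_d)$, $Y=(y_0,\dots,y_d)$, $X$ intertwines $Y$ if $x_0<y_0<x_1<y_1<\cdots<x_d<y_d$. A collection of increasing $(d+1)$-tuples is non-intertwining if no pair of its elements intertwine (in either order). *)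

theory Defs
  imports "HOL-Analysis.Analysis"
begin

text \<open>
  The ambient space is \<open>real ^ 'n\<close> with a linearly ordered finite index type; its
  coordinates are numbered 1, 2, ..., CARD('n) in increasing order of the indices. The
  number of the coordinate \<open>i\<close> is therefore \<open>card {..i}\<close>.
\<close>

definition moment_point :: "nat \<Rightarrow> real ^ 'n::{finite,linorder}" where
  "moment_point t = (\<chi> i. real t ^ card {..i})"

definition cyclic_polytope :: "nat \<Rightarrow> (real ^ 'n::{finite,linorder}) set" where
  "cyclic_polytope m = convex hull (moment_point ` {1..m})"

text \<open>
  The library predicate \<open>triangulation\<close> only asks for a finite collection of simplices (of any
  dimension) any two of which meet in a common face, which may be empty; covering the polytope, being
  full-dimensional and using no new vertices are added here.
\<close>

definition triangulation_of_cyclic_polytope ::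
    "nat \<Rightarrow> (real ^ 'n::{finite,linorder}) set set \<Rightarrow> bool" where
  "triangulation_of_cyclic_polytope m S \<longleftrightarrow>
     triangulation S \<and>
     \<Union>S = cyclic_polytope m \<and>
     (\<forall>T\<in>S. int CARD('n) simplex T \<and>
        {v. v extreme_point_of T} \<subseteq> {v. v extreme_point_of cyclic_polytope m})"

text \<open>
  A facet separates the polytope from the points below it if moving straight down from any of
  its points, parallel to the axis of the last coordinate, by any distance leaves the polytope.
\<close>

definition lower_facet_of ::
    "(real ^ 'n::{finite,linorder}) set \<Rightarrow> (real ^ 'n::{finite,linorder}) set \<Rightarrow> bool" where
  "lower_facet_of F C \<longleftrightarrow>
     F facet_of C \<and> (\<forall>x\<in>F. \<forall>s>0. x - s *\<^sub>R axis (Max UNIV) 1 \<notin> C)"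

text \<open>Tuples \<open>(x\<^sub>0, ..., x\<^sub>d)\<close> are lists of length \<open>d + 1\<close>, entry \<open>x\<^sub>i\<close> being \<open>X ! i\<close>.\<close>

definition increasing_tuples :: "nat \<Rightarrow> nat \<Rightarrow> nat list set" where
  "increasing_tuples d m =
     {X. length X = d + 1 \<and> set X \<subseteq> {1..m} \<and> sorted_wrt (<) X}"

definition separated_tuples :: "nat \<Rightarrow> nat \<Rightarrow> nat list set" where
  "separated_tuples d m =
     {X. length X = d + 1 \<and> set X \<subseteq> {1..m} \<and> (\<forall>x<d. X ! x + 2 \<le> X ! (x + 1))}"

definition tuple_simplex :: "nat list \<Rightarrow> (real ^ 'n::{finite,linorder}) set" where
  "tuple_simplex X = convex hull (moment_point ` set X)"

text \<open>
  The set \<open>e(S)\<close> of a triangulation \<open>S\<close> of the cyclic polytope in dimension \<open>2d\<close>, each simplex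
  being recorded by its tuple of vertex labels. Only lower facets are excluded: simplices on
  upper facets do belong to it.
\<close>

definition e_simplices ::
    "nat \<Rightarrow> nat \<Rightarrow> (real ^ 'n::{finite,linorder}) set set \<Rightarrow> nat list set" where
  "e_simplices d m S =
     {X \<in> increasing_tuples d m.
        (\<exists>T\<in>S. tuple_simplex X face_of T) \<and>
        \<not> (\<exists>F::(real ^ 'n::{finite,linorder}) set. lower_facet_of F (cyclic_polytope m) \<and> tuple_simplex X \<subseteq> F)}"

definition intertwines :: "nat list \<Rightarrow> nat list \<Rightarrow> bool" where
  "intertwines X Y \<longleftrightarrow>
     length X = length Y \<and>
     (\<forall>i<length X. X ! i < Y ! i) \<and>
     (\<forall>i. i + 1 < length X \<longrightarrow> Y ! i < X ! (i + 1))"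

definition non_intertwining :: "nat list set \<Rightarrow> bool" where
  "non_intertwining A \<longleftrightarrow> (\<forall>X\<in>A. \<forall>Y\<in>A. \<not> intertwines X Y)"

end

theory Submission
  imports Defs
begin

text \<open>
  A point of the cyclic polytope is a mean of the points \<open>p\<^sub>t\<close> with nonnegative weights on the labels
  \<open>1, ..., m\<close>. Two weights represent the same point exactly if their moments of order at most \<open>2d\<close>
  agree, and moving a point straight down keeps the moments of order below \<open>2d\<close> and lowers the one
  of order \<open>2d\<close> (\<open>mpoint_shift_iff\<close>). All the geometry of the moment curve that is used below is a
  rule of signs for functions on the labels: if the moments of order below \<open>r\<close> vanish and the one of
  order \<open>r\<close> is negative, then there are \<open>r + 1\<close> increasing labels with values of alternating sign,
  the last one negative (\<open>sign_changes\<close>), and every increasing sequence of \<open>r + 1\<close> labels carries such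
  a function up to sign (\<open>circuit_exists\<close>). In particular, two simplices whose intersection is not
  spanned by their common vertices contain two intertwining \<open>d\<close>-simplices.

  This leaves one candidate for the triangulation. Call a set of labels a clique if all separated
  tuples in it belong to \<open>A\<close>, and a cell if moreover it has \<open>2d + 1\<close> elements. The simplices of a
  triangulation \<open>S\<close> with \<open>e(S) = A\<close> are cells; any two cells meet in a common face because \<open>A\<close> is
  non-intertwining; and a cell outside \<open>S\<close> would overlap a simplex of \<open>S\<close>. Everything else follows
  once the cells cover the polytope.

  The covering is proved by moving down along vertical lines. The highest point of a line is carried
  by a clique, because a tuple that contains both \<open>1\<close> and \<open>m\<close> intertwines with nothing and so belongs to
  every family of maximum size (\<open>top_weight_clique\<close>). One can move further down from a clique as soon as
  each clique \<open>E\<close> with a separated tuple lies in a cell whose even vertices are in \<open>E\<close>, since these are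
  the vertices that lose weight in the motion (\<open>extendable\<close>, \<open>covering_of_extendable\<close>).

  That property is proved by induction on \<open>m\<close>, by contracting the edge between the last two labels.
  The family \<open>A\<close> yields a family \<open>contraction\<close> on \<open>m - 1\<close> labels, in which \<open>m\<close> is identified with
  \<open>m - 1\<close>, and a family \<open>edge_link\<close> of \<open>d\<close>-tuples on \<open>m - 2\<close> labels. Their sizes add up to that of \<open>A\<close>,
  and Pascal's rule bounds the size of every non-intertwining family and shows that both parts are of
  maximum size if \<open>A\<close> is. A cell of the contraction that contains \<open>m - 1\<close> has to be lifted to a cell of
  \<open>A\<close> with \<open>m - 1\<close> or with \<open>m\<close>, depending on which side of the link it lies. The link covers a cyclic
  polytope of dimension \<open>2d - 2\<close>; one dimension higher it becomes a sheet that no such cell can cross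
  (\<open>not_both_sides\<close>): by continuity, a segment from one side to the other would meet the sheet, and the
  rule of signs would give an intertwining pair.
\<close>

section \<open>Sign changes and circuits\<close>

text \<open>
  Binomial coefficients take the place of powers because summation by parts then shifts the order of
  a moment by exactly one; the moments up to a given order carry the same information.
\<close>

definition bmoment :: "nat \<Rightarrow> nat \<Rightarrow> (nat \<Rightarrow> real) \<Rightarrow> real" where
  "bmoment m k c = (\<Sum>t=1..m. c t * real (t choose k))"

lemma bmoment_diff: "bmoment m k (\<lambda>t. a t - b t) = bmoment m k a - bmoment m k b"
  by (simp add: bmoment_def algebra_simps sum_subtractf)

lemma bmoment_add: "bmoment m k (\<lambda>t. a t + b t) = bmoment m k a + bmoment m k b"
  by (simp add: bmoment_def algebra_simps sum.distrib)

lemma bmoment_scale: "bmoment m k (\<lambda>t. s * a t) = s * bmoment m k a"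
  by (simp add: bmoment_def algebra_simps sum_distrib_left)

lemma bmoment_minus: "bmoment m k (\<lambda>t. - a t) = - bmoment m k a"
  by (simp add: bmoment_def sum_negf)

lemma bmoment_convex: "bmoment m k (\<lambda>t. (1 - s) * a t + s * b t) = (1 - s) * bmoment m k a + s * bmoment m k b"
  unfolding bmoment_add bmoment_scale ..

lemma sum_tail_choose:
  "(\<Sum>t=1..<s. real (t choose k)) = real (s choose Suc k) - (if k = 0 \<and> s > 0 then 1 else 0)"
proof (induction s)
  case (Suc s)
  then show ?case by (cases "s = 0"; cases k) auto
qed simp

lemma bmoment_tail_sums:
  "bmoment m k (\<lambda>t. \<Sum>s\<in>{t<..m}. c s) = bmoment m (Suc k) c - (if k = 0 then bmoment m 0 c else 0)"
proof -
  have "bmoment m k (\<lambda>t. \<Sum>s\<in>{t<..m}. c s) = (\<Sum>t=1..m. \<Sum>s\<in>{t<..m}. c s * real (t choose k))"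
    by (simp add: bmoment_def sum_distrib_right)
  also have "\<dots> = (\<Sum>t\<in>{1..m}. \<Sum>s\<in>{s\<in>{1..m}. t < s}. c s * real (t choose k))"
    by (intro sum.cong) auto
  also have "\<dots> = (\<Sum>s\<in>{1..m}. \<Sum>t\<in>{t\<in>{1..m}. t < s}. c s * real (t choose k))"
    by (rule sum.swap_restrict) auto
  also have "\<dots> = (\<Sum>s\<in>{1..m}. c s * (\<Sum>t\<in>{1..<s}. real (t choose k)))"
  proof (intro sum.cong refl)
    fix s assume "s \<in> {1..m}"
    then have "{t\<in>{1..m}. t < s} = {1..<s}" by auto
    then show "(\<Sum>t\<in>{t\<in>{1..m}. t < s}. c s * real (t choose k)) = c s * (\<Sum>t\<in>{1..<s}. real (t choose k))"
      by (simp add: sum_distrib_left)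
  qed
  also have "\<dots> = (\<Sum>s\<in>{1..m}. c s * real (s choose Suc k) - (if k = 0 then c s else 0))"
    by (intro sum.cong) (auto simp: sum_tail_choose algebra_simps simp del: One_nat_def)
  also have "\<dots> = bmoment m (Suc k) c - (if k = 0 then bmoment m 0 c else 0)"
    by (simp add: bmoment_def sum_subtractf)
  finally show ?thesis .
qed

lemma sum_neg_witness:
  fixes c :: "'a \<Rightarrow> real"
  assumes "\<sigma> * (\<Sum>s\<in>I. c s) < 0"
  obtains s where "s \<in> I" "\<sigma> * c s < 0"
proof -
  have "(\<Sum>s\<in>I. \<sigma> * c s) < 0" using assms by (simp add: sum_distrib_left)
  then have "\<exists>s\<in>I. \<sigma> * c s < 0" by (meson not_le sum_nonneg)
  then show ?thesis using that by blast
qed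

text \<open>
  A discrete form of Rolle's theorem. Passing to tail sums lowers the order of all moments by one, and
  between two values of opposite sign of the tail sums, as well as before the first and behind the
  last one, the function takes a value of the required sign.
\<close>

lemma sign_changes:
  assumes "\<And>k. k < r \<Longrightarrow> bmoment m k c = 0" and "bmoment m r c < 0"
  shows "\<exists>f::nat \<Rightarrow> nat. (\<forall>i<r. f i < f (Suc i)) \<and> (\<forall>i\<le>r. f i \<in> {1..m} \<and> (-1) ^ (r - i) * c (f i) < 0)"
  using assms
proof (induction r arbitrary: c)
  case 0
  then have "1 * (\<Sum>s\<in>{1..m}. c s) < 0" by (simp add: bmoment_def)
  then obtain s where "s \<in> {1..m}" "1 * c s < 0" by (rule sum_neg_witness)
  then show ?case by (intro exI[of _ "\<lambda>_. s"]) auto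
next
  case (Suc r)
  define C where "C t = (\<Sum>s\<in>{t<..m}. c s)" for t
  have c0: "bmoment m 0 c = 0" using Suc.prems by simp
  have C: "bmoment m k C = bmoment m (Suc k) c" for k
    using bmoment_tail_sums[of m k c] c0 by (simp add: C_def[abs_def])
  have "\<exists>g::nat \<Rightarrow> nat. (\<forall>i<r. g i < g (Suc i)) \<and> (\<forall>i\<le>r. g i \<in> {1..m} \<and> (-1) ^ (r - i) * C (g i) < 0)"
    by (rule Suc.IH) (use Suc.prems in \<open>auto simp: C\<close>)
  then obtain g where g: "\<And>i. i < r \<Longrightarrow> g i < g (Suc i)" "\<And>i. i \<le> r \<Longrightarrow> g i \<in> {1..m}"
    "\<And>i. i \<le> r \<Longrightarrow> (-1) ^ (r - i) * C (g i) < 0" by blast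
  have total: "(\<Sum>s\<in>{1..t}. c s) + C t = 0" if "t \<le> m" for t
  proof -
    have "(\<Sum>s\<in>{1..t}. c s) + C t = (\<Sum>s\<in>{1..t} \<union> {t<..m}. c s)"
      unfolding C_def by (rule sum.union_disjoint[symmetric]) auto
    also have "{1..t} \<union> {t<..m} = {1..m}" using that by auto
    finally show ?thesis using c0 by (simp add: bmoment_def)
  qed
  have step: "C (g i) - C (g (Suc i)) = (\<Sum>s\<in>{g i<..g (Suc i)}. c s)" if "i < r" for i
  proof -
    have "C (g i) = (\<Sum>s\<in>{g i<..g (Suc i)} \<union> {g (Suc i)<..m}. c s)"
      unfolding C_def using g(1)[of i] g(2)[of "Suc i"] that by (intro sum.cong) auto
    also have "\<dots> = (\<Sum>s\<in>{g i<..g (Suc i)}. c s) + C (g (Suc i))"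
      unfolding C_def by (rule sum.union_disjoint) auto
    finally show ?thesis by simp
  qed
  \<comment> \<open>Where the tail sums change sign, a value of the right sign lies in between.\<close>
  define P where "P j s \<longleftrightarrow> s \<in> {1..m} \<and> (-1) ^ (Suc r - j) * c s < 0 \<and>
      (0 < j \<longrightarrow> g (j - 1) < s) \<and> (j \<le> r \<longrightarrow> s \<le> g j)" for j s
  have ex: "\<exists>s. P j s" if j: "j \<le> Suc r" for j
  proof -
    consider "j = 0" | i where "j = Suc i" "i < r" | "j = Suc r"
      using j by (cases j) (auto simp: le_less)
    then show ?thesis
    proof cases
      case 1
      have "(-1) ^ Suc r * (\<Sum>s\<in>{1..g 0}. c s) < 0"
        using g(3)[of 0] total[of "g 0"] g(2)[of 0] by (simp add: eq_neg_iff_add_eq_0[symmetric])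
      then obtain s where "s \<in> {1..g 0}" "(-1) ^ Suc r * c s < 0" by (rule sum_neg_witness)
      then show ?thesis using 1 g(2)[of 0] by (intro exI[of _ s]) (auto simp: P_def)
    next
      case 2
      have "(-1) ^ (r - i) * (\<Sum>s\<in>{g i<..g (Suc i)}. c s)
          = (-1) ^ (r - i) * C (g i) + (-1) ^ (r - Suc i) * C (g (Suc i))"
        unfolding step[OF 2(2), symmetric] using 2(2) by (simp add: Suc_diff_Suc[symmetric] algebra_simps)
      also have "\<dots> < 0" using g(3)[of i] g(3)[of "Suc i"] 2(2) by simp
      finally obtain s where "s \<in> {g i<..g (Suc i)}" "(-1) ^ (r - i) * c s < 0" by (rule sum_neg_witness)
      then show ?thesis using 2 g(2)[of "Suc i"] by (intro exI[of _ s]) (auto simp: P_def)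
    next
      case 3
      have "1 * (\<Sum>s\<in>{g r<..m}. c s) < 0" using g(3)[of r] by (simp add: C_def)
      then obtain s where "s \<in> {g r<..m}" "1 * c s < 0" by (rule sum_neg_witness)
      then show ?thesis using 3 by (intro exI[of _ s]) (auto simp: P_def)
    qed
  qed
  then obtain f where f: "\<And>j. j \<le> Suc r \<Longrightarrow> P j (f j)" by metis
  have "f j < f (Suc j)" if "j < Suc r" for j
    using f[of j] f[of "Suc j"] that by (auto simp: P_def)
  then show ?case using f unfolding P_def by blast
qed

text \<open>
  At the last label \<open>u\<close> of the support, \<open>t choose u\<close> vanishes for all smaller \<open>t\<close>, so that the moment of
  order \<open>u\<close> is the value at \<open>u\<close>.
\<close>

lemma top_moment_nonzero:
  assumes "t \<in> {1..m}" "c t \<noteq> 0"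
  shows "\<exists>k. bmoment m k c \<noteq> 0"
proof -
  define T where "T = {s\<in>{1..m}. c s \<noteq> 0}"
  have T: "finite T" "t \<in> T" using assms by (auto simp: T_def)
  define u where "u = Max T"
  have "T \<noteq> {}" using T by auto
  then have u: "u \<in> T" "\<And>s. s \<in> T \<Longrightarrow> s \<le> u" unfolding u_def using T by auto
  have "bmoment m u c = (\<Sum>s\<in>{u}. c s * real (s choose u))"
    unfolding bmoment_def
  proof (rule sum.mono_neutral_right)
    show "\<forall>s\<in>{1..m} - {u}. c s * real (s choose u) = 0"
    proof
      fix s assume s: "s \<in> {1..m} - {u}"
      show "c s * real (s choose u) = 0"
      proof (cases "s \<in> T")
        case True
        then have "s < u" using u(2)[of s] s by auto
        then show ?thesis by simp
      next
        case False
        then show ?thesis using s by (auto simp: T_def)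
      qed
    qed
  qed (use u in \<open>auto simp: T_def\<close>)
  then show ?thesis using u(1) by (intro exI[of _ u]) (auto simp: T_def)
qed

text \<open>
  The first moment that does not vanish has order at least \<open>r + 1\<close>; the last \<open>r + 2\<close> labels of the
  sequence that it provides are taken.
\<close>

lemma sign_changes_nonzero:
  assumes "\<And>k. k \<le> r \<Longrightarrow> bmoment m k c = 0" and "t \<in> {1..m}" "c t \<noteq> 0"
  shows "\<exists>f::nat \<Rightarrow> nat. \<exists>\<sigma>::real. (\<sigma> = 1 \<or> \<sigma> = -1) \<and> (\<forall>i\<le>r. f i < f (Suc i)) \<and>
           (\<forall>i\<le>Suc r. f i \<in> {1..m} \<and> \<sigma> * (-1) ^ i * c (f i) > 0)"
proof -
  define K where "K = (LEAST k. bmoment m k c \<noteq> 0)"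
  have K: "bmoment m K c \<noteq> 0" using top_moment_nonzero[of t m c] assms(2,3) unfolding K_def by (metis (mono_tags, lifting) LeastI_ex)
  have below: "bmoment m k c = 0" if "k < K" for k using not_less_Least[of k] that unfolding K_def by blast
  have rK: "r < K" using K assms(1)[of K] by (meson not_le)
  define \<tau> :: real where "\<tau> = - sgn (bmoment m K c)"
  have \<tau>: "\<tau> = 1 \<or> \<tau> = -1" using K by (auto simp: \<tau>_def sgn_if)
  have "\<exists>f::nat \<Rightarrow> nat. (\<forall>i<K. f i < f (Suc i)) \<and> (\<forall>i\<le>K. f i \<in> {1..m} \<and> (-1) ^ (K - i) * (\<tau> * c (f i)) < 0)"
  proof (rule sign_changes)
    show "bmoment m k (\<lambda>t. \<tau> * c t) = 0" if "k < K" for k using below[OF that] by (simp add: bmoment_scale)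
    show "bmoment m K (\<lambda>t. \<tau> * c t) < 0" using K unfolding bmoment_scale by (auto simp: \<tau>_def sgn_if)
  qed
  then obtain g where g: "\<And>i. i < K \<Longrightarrow> g i < g (Suc i)" "\<And>i. i \<le> K \<Longrightarrow> g i \<in> {1..m}"
    "\<And>i. i \<le> K \<Longrightarrow> (-1) ^ (K - i) * (\<tau> * c (g i)) < 0" by blast
  define j where "j = K - Suc r"
  define \<sigma> where "\<sigma> = - \<tau> * (-1) ^ Suc r"
  have "\<sigma> = 1 \<or> \<sigma> = -1" using \<tau> by (cases "even r") (auto simp: \<sigma>_def)
  moreover have "g (i + j) < g (Suc i + j)" if "i \<le> r" for i
    using g(1)[of "i + j"] that rK by (simp add: j_def)
  moreover have "g (i + j) \<in> {1..m}" "\<sigma> * (-1) ^ i * c (g (i + j)) > 0" if "i \<le> Suc r" for i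
  proof -
    have le: "i + j \<le> K" using that rK by (simp add: j_def)
    show "g (i + j) \<in> {1..m}" using g(2)[OF le] .
    have e: "K - (i + j) = Suc r - i" using that rK by (simp add: j_def)
    have "(-1) ^ Suc r * (-1) ^ i = ((-1)::real) ^ (Suc r - i)"
      using that by (simp add: power_add[symmetric] minus_one_power_iff)
    then have "\<sigma> * (-1) ^ i * c (g (i + j)) = - ((-1) ^ (K - (i + j)) * (\<tau> * c (g (i + j))))"
      unfolding \<sigma>_def e by (metis (no_types, lifting) mult.assoc mult.commute mult_minus_left)
    then show "\<sigma> * (-1) ^ i * c (g (i + j)) > 0" using g(3)[OF le] by linarith
  qed
  ultimately show ?thesis by (intro exI[of _ "\<lambda>i. g (i + j)"] exI[of _ \<sigma>]) auto
qed

lemma strict_chain: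
  fixes f :: "nat \<Rightarrow> nat"
  assumes "\<And>i. i < r \<Longrightarrow> f i < f (Suc i)"
  shows "i < j \<Longrightarrow> j \<le> r \<Longrightarrow> f i < f j"
proof (induction j)
  case (Suc j)
  then show ?case using assms[of j] by (cases "i = j") auto
qed simp

lemma strict_chain_inj:
  fixes f :: "nat \<Rightarrow> nat"
  assumes "\<And>i. i < r \<Longrightarrow> f i < f (Suc i)"
  shows "inj_on f {..r}"
proof (rule linorder_inj_onI)
  fix i j assume "i < j" "i \<in> {..r}" "j \<in> {..r}"
  then show "f i \<noteq> f j" using strict_chain[where r = r and f = f, OF _ \<open>i < j\<close>] assms by (metis atMost_iff less_irrefl)
qed auto

text \<open>
  These are the divided differences on the points \<open>f 0 < ... < f r\<close>. Given the ones without the first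
  and without the last point, their difference has the right signs and one more vanishing moment; its
  leading moment is positive by the rule of signs, since only \<open>r + 1\<close> points are available.
\<close>

lemma circuit_exists:
  fixes f :: "nat \<Rightarrow> nat"
  assumes "\<And>i. i < r \<Longrightarrow> f i < f (Suc i)" and "\<And>i. i \<le> r \<Longrightarrow> f i \<in> {1..m}"
  shows "\<exists>c. (\<forall>t. t \<notin> f ` {..r} \<longrightarrow> c t = 0) \<and> (\<forall>i\<le>r. (-1) ^ (r - i) * c (f i) > 0) \<and>
             (\<forall>k<r. bmoment m k c = 0) \<and> bmoment m r c = 1"
  using assms
proof (induction r arbitrary: f)
  case 0
  have "bmoment m 0 (\<lambda>t. if t = f 0 then 1 else 0) = 1" using 0 by (simp add: bmoment_def)
  then show ?case by (intro exI[of _ "\<lambda>t. if t = f 0 then 1 else 0"]) auto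
next
  case (Suc r)
  obtain a where a: "\<And>t. t \<notin> f ` {..r} \<Longrightarrow> a t = 0" "\<And>i. i \<le> r \<Longrightarrow> (-1) ^ (r - i) * a (f i) > 0"
    "\<And>k. k < r \<Longrightarrow> bmoment m k a = 0" "bmoment m r a = 1"
    using Suc.IH[of f] Suc.prems by (metis le_SucI less_SucI)
  obtain b where b: "\<And>t. t \<notin> (\<lambda>i. f (Suc i)) ` {..r} \<Longrightarrow> b t = 0"
    "\<And>i. i \<le> r \<Longrightarrow> (-1) ^ (r - i) * b (f (Suc i)) > 0"
    "\<And>k. k < r \<Longrightarrow> bmoment m k b = 0" "bmoment m r b = 1"
    using Suc.IH[of "\<lambda>i. f (Suc i)"] Suc.prems by (metis Suc_le_mono Suc_less_eq)
  have lt: "f i < f j" if "i < j" "j \<le> Suc r" for i j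
    by (rule strict_chain[where r = "Suc r"]) (use that Suc.prems(1) in auto)
  have inj: "inj_on f {..Suc r}" by (rule strict_chain_inj) (rule Suc.prems(1))
  \<comment> \<open>The moments of order \<open>r\<close> of both circuits are 1 and cancel.\<close>
  define c where "c t = b t - a t" for t
  have c0: "c t = 0" if "t \<notin> f ` {..Suc r}" for t
  proof -
    have "f ` {..r} \<subseteq> f ` {..Suc r}" "(\<lambda>i. f (Suc i)) ` {..r} \<subseteq> f ` {..Suc r}" by auto
    then show ?thesis using that a(1) b(1) unfolding c_def by (metis diff_0_right subsetD)
  qed
  have mom: "bmoment m k c = 0" if "k < Suc r" for k
    using that a(3)[of k] b(3)[of k] a(4) b(4) unfolding c_def bmoment_diff by (cases "k = r") auto
  have sgn: "(-1) ^ (Suc r - i) * c (f i) > 0" if i: "i \<le> Suc r" for i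
  proof -
    have 1: "(-1) ^ (Suc r - i) * - a (f i) \<ge> 0 \<and> (i \<le> r \<longrightarrow> (-1) ^ (Suc r - i) * - a (f i) > 0)"
    proof (cases "i \<le> r")
      case True
      then show ?thesis using a(2)[of i] by (simp add: Suc_diff_le)
    next
      case False
      have "f i \<notin> f ` {..r}"
      proof
        assume "f i \<in> f ` {..r}"
        then obtain x where "x \<le> r" "f i = f x" by blast
        moreover have "f x < f i" by (rule lt) (use \<open>x \<le> r\<close> i False in linarith)+
        ultimately show False by linarith
      qed
      then show ?thesis using a(1) False by simp
    qed
    have 2: "(-1) ^ (Suc r - i) * b (f i) \<ge> 0 \<and> (0 < i \<longrightarrow> (-1) ^ (Suc r - i) * b (f i) > 0)"
    proof (cases i)
      case 0
      have "f 0 \<notin> (\<lambda>i. f (Suc i)) ` {..r}"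
      proof
        assume "f 0 \<in> (\<lambda>i. f (Suc i)) ` {..r}"
        then obtain x where "x \<le> r" "f 0 = f (Suc x)" by blast
        then show False using lt[of 0 "Suc x"] by simp
      qed
      then show ?thesis using b(1) 0 by simp
    next
      case (Suc j)
      then show ?thesis using b(2)[of j] i by simp
    qed
    show ?thesis using 1 2 i unfolding c_def right_diff_distrib by (cases "i = 0") auto
  qed
  have card: "card (f ` {..Suc r}) = Suc (Suc r)" using inj by (simp add: card_image)
  have supp: "t \<in> f ` {..Suc r}" if "\<sigma> * c t \<noteq> 0" for t \<sigma> using that c0[of t] by auto
  have pos: "bmoment m (Suc r) c > 0"
  proof (rule ccontr)
    assume "\<not> ?thesis"
    then consider "bmoment m (Suc r) c = 0" | "bmoment m (Suc r) c < 0" by linarith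
    then show False
    proof cases
      case 1
      have "\<exists>g::nat \<Rightarrow> nat. \<exists>\<sigma>::real. (\<sigma> = 1 \<or> \<sigma> = -1) \<and> (\<forall>i\<le>Suc r. g i < g (Suc i)) \<and>
           (\<forall>i\<le>Suc (Suc r). g i \<in> {1..m} \<and> \<sigma> * (-1) ^ i * c (g i) > 0)"
      proof (rule sign_changes_nonzero[where t = "f 0"])
        show "bmoment m k c = 0" if "k \<le> Suc r" for k
          using mom[of k] 1 that by (cases "k = Suc r") auto
        show "f 0 \<in> {1..m}" using Suc.prems(2)[of 0] by simp
        show "c (f 0) \<noteq> 0" using sgn[of 0] by auto
      qed
      then obtain g \<sigma> where g: "\<And>i. i \<le> Suc r \<Longrightarrow> g i < g (Suc i)"
        "\<And>i. i \<le> Suc (Suc r) \<Longrightarrow> \<sigma> * (-1) ^ i * c (g i) > 0" by blast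
      have "inj_on g {..Suc (Suc r)}" by (rule strict_chain_inj) (use g(1) in auto)
      then have "card (g ` {..Suc (Suc r)}) = Suc (Suc (Suc r))" by (simp add: card_image)
      moreover have "g ` {..Suc (Suc r)} \<subseteq> f ` {..Suc r}"
      proof (rule image_subsetI)
        fix i assume "i \<in> {..Suc (Suc r)}"
        then have "\<sigma> * (-1) ^ i * c (g i) \<noteq> 0" using g(2)[of i] by auto
        then show "g i \<in> f ` {..Suc r}" by (rule supp)
      qed
      ultimately show False using card card_mono[of "f ` {..Suc r}" "g ` {..Suc (Suc r)}"] by simp
    next
      case 2
      then obtain g where g: "\<And>i. i < Suc r \<Longrightarrow> g i < g (Suc i)"
        "\<And>i. i \<le> Suc r \<Longrightarrow> (-1) ^ (Suc r - i) * c (g i) < 0" using sign_changes[of "Suc r" m c] mom by blast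
      have "inj_on g {..Suc r}" by (rule strict_chain_inj) (use g(1) in auto)
      then have cg: "card (g ` {..Suc r}) = Suc (Suc r)" by (simp add: card_image)
      have "g ` {..Suc r} \<subseteq> f ` {..Suc r}"
      proof (rule image_subsetI)
        fix i assume "i \<in> {..Suc r}"
        then have "(-1) ^ (Suc r - i) * c (g i) \<noteq> 0" using g(2)[of i] by auto
        then show "g i \<in> f ` {..Suc r}" by (rule supp)
      qed
      then have eq: "g ` {..Suc r} = f ` {..Suc r}" using cg card by (intro card_subset_eq) auto
      have g_lt: "g i < g j" if "i < j" "j \<le> Suc r" for i j
        by (rule strict_chain[where r = "Suc r"]) (use that g(1) in auto)
      have ub: "f i \<le> f (Suc r)" "g i \<le> g (Suc r)" if "i \<le> Suc r" for i
        using lt[of i "Suc r"] g_lt[of i "Suc r"] that by (cases "i = Suc r"; simp)+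
      have "g (Suc r) \<in> f ` {..Suc r}" "f (Suc r) \<in> g ` {..Suc r}" using eq by auto
      then obtain i j where "i \<le> Suc r" "g (Suc r) = f i" "j \<le> Suc r" "f (Suc r) = g j" by auto
      then have "g (Suc r) = f (Suc r)" using ub(1)[of i] ub(2)[of j] by simp
      then show False using g(2)[of "Suc r"] sgn[of "Suc r"] by simp
    qed
  qed
  define M where "M = bmoment m (Suc r) c"
  have M: "M > 0" "M = bmoment m (Suc r) c" using pos by (auto simp: M_def)
  have "(-1) ^ (Suc r - i) * ((1 / M) * c (f i)) > 0" if "i \<le> Suc r" for i
    using sgn[OF that] M(1) by (simp add: zero_less_divide_iff)
  moreover have "bmoment m k (\<lambda>t. (1 / M) * c t) = 0" if "k < Suc r" for k
    unfolding bmoment_scale mom[OF that] by simp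
  moreover have "bmoment m (Suc r) (\<lambda>t. (1 / M) * c t) = 1"
    unfolding bmoment_scale M(2)[symmetric] using M(1) by simp
  ultimately show ?case using c0 by (intro exI[of _ "\<lambda>t. (1 / M) * c t"]) auto
qed

section \<open>Weights, interlaced and intertwining tuples\<close>

definition weights :: "nat set \<Rightarrow> (nat \<Rightarrow> real) set" where
  "weights E = {a. (\<forall>t. 0 \<le> a t) \<and> (\<forall>t. t \<notin> E \<longrightarrow> a t = 0)}"

text \<open>
  The alternating pattern on an odd number of labels, as \<open>intertwines\<close> is the one on an even number.
  The labels in \<open>X\<close> are the even vertices of the simplex on \<open>X\<close> and \<open>Y\<close>.
\<close>

definition interlaced :: "nat list \<Rightarrow> nat list \<Rightarrow> bool" where
  "interlaced X Y \<longleftrightarrow> length X = Suc (length Y) \<and> (\<forall>i<length Y. X ! i < Y ! i \<and> Y ! i < X ! Suc i)"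

lemma weights_pos_imp_mem: "a \<in> weights E \<Longrightarrow> 0 < a t \<Longrightarrow> t \<in> E"
  by (force simp: weights_def)

lemma weights_nonneg: "a \<in> weights E \<Longrightarrow> 0 \<le> a t"
  by (simp add: weights_def)

lemma weights_zero: "a \<in> weights E \<Longrightarrow> t \<notin> E \<Longrightarrow> a t = 0"
  by (simp add: weights_def)

lemma weights_mono: "E \<subseteq> F \<Longrightarrow> weights E \<subseteq> weights F"
  by (auto simp: weights_def)

lemma weights_convex:
  assumes "u \<in> weights E" "v \<in> weights E" "s \<in> {0..1}"
  shows "(\<lambda>t. (1 - s) * u t + s * v t) \<in> weights E"
  using assms by (auto simp: weights_def)

lemma weights_neq_witness:
  assumes "a \<in> weights E" "b \<in> weights F" "E \<subseteq> {1..m}" "F \<subseteq> {1..m}" "a \<noteq> b"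
  obtains t where "t \<in> {1..m}" "a t - b t \<noteq> 0"
proof -
  obtain t where "a t \<noteq> b t" using assms(5) by (auto simp: fun_eq_iff)
  moreover then have "t \<in> E \<or> t \<in> F" using assms(1,2) weights_zero by metis
  ultimately show ?thesis using that[of t] assms(3,4) by auto
qed

lemma interlaced_chain:
  assumes "\<And>i. i < 2 * d \<Longrightarrow> f i < f (Suc i)"
  shows "interlaced (map (\<lambda>i. f (2 * i)) [0..<Suc d]) (map (\<lambda>i. f (2 * i + 1)) [0..<d])"
proof -
  have "f (2 * i) < f (Suc (2 * i)) \<and> f (Suc (2 * i)) < f (2 * Suc i)" if "i < d" for i
    using assms[of "2 * i"] assms[of "Suc (2 * i)"] that by simp
  then show ?thesis unfolding interlaced_def by (auto simp: nth_append simp del: upt_Suc)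
qed

lemma intertwines_chain:
  assumes "\<And>i. i < 2 * d + 1 \<Longrightarrow> f i < f (Suc i)"
  shows "intertwines (map (\<lambda>i. f (2 * i)) [0..<Suc d]) (map (\<lambda>i. f (2 * i + 1)) [0..<Suc d])"
proof -
  have "f (2 * i) < f (Suc (2 * i))" if "i < Suc d" for i
    using assms[of "2 * i"] that by simp
  moreover have "f (Suc (2 * i)) < f (2 * Suc i)" if "i < d" for i
    using assms[of "Suc (2 * i)"] that by simp
  ultimately show ?thesis unfolding intertwines_def by (auto simp del: upt_Suc)
qed

text \<open>
  Lowering the last moment while keeping the others takes weight away from the even vertices of some
  alternating sequence, so these carry weight before.
\<close>

lemma interlaced_sign_changes:
  assumes ab: "a \<in> weights E" "b \<in> weights F"
    and eq: "\<And>k. k < 2 * d \<Longrightarrow> bmoment m k a = bmoment m k b"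
    and lt: "bmoment m (2 * d) a < bmoment m (2 * d) b"
  shows "\<exists>X Y. interlaced X Y \<and> length Y = d \<and> set X \<subseteq> F \<and> set Y \<subseteq> E"
proof -
  have "\<exists>f::nat \<Rightarrow> nat. (\<forall>i<2*d. f i < f (Suc i)) \<and>
      (\<forall>i\<le>2*d. f i \<in> {1..m} \<and> (-1) ^ (2 * d - i) * (a (f i) - b (f i)) < 0)"
    by (rule sign_changes) (use eq lt in \<open>auto simp: bmoment_diff\<close>)
  then obtain f where f: "\<And>i. i < 2 * d \<Longrightarrow> f i < f (Suc i)"
    "\<And>i. i \<le> 2 * d \<Longrightarrow> (-1) ^ (2 * d - i) * (a (f i) - b (f i)) < 0" by blast
  have "f (2 * i) \<in> F" if "i \<le> d" for i
  proof -
    have "a (f (2 * i)) - b (f (2 * i)) < 0" using f(2)[of "2 * i"] that by (simp add: minus_one_power_iff)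
    then have "0 < b (f (2 * i))" using weights_nonneg[OF ab(1), of "f (2 * i)"] by simp
    then show ?thesis by (rule weights_pos_imp_mem[OF ab(2)])
  qed
  moreover have "f (2 * i + 1) \<in> E" if "i < d" for i
  proof -
    have "a (f (2 * i + 1)) - b (f (2 * i + 1)) > 0" using f(2)[of "2 * i + 1"] that by (simp add: minus_one_power_iff)
    then have "0 < a (f (2 * i + 1))" using weights_nonneg[OF ab(2), of "f (2 * i + 1)"] by simp
    then show ?thesis by (rule weights_pos_imp_mem[OF ab(1)])
  qed
  ultimately show ?thesis using interlaced_chain[of d f] f(1)
    by (intro exI conjI) (assumption | force)+
qed

lemma alternating_supports:
  fixes \<sigma> :: real
  assumes ab: "a \<in> weights E" "b \<in> weights F" and \<sigma>: "\<sigma> = 1 \<or> \<sigma> = -1"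
    and sgn: "\<And>i. i \<le> r \<Longrightarrow> \<sigma> * (-1) ^ i * (a (f i) - b (f i)) > 0"
  obtains "\<And>i. i \<le> r \<Longrightarrow> even i \<Longrightarrow> f i \<in> E" "\<And>i. i \<le> r \<Longrightarrow> odd i \<Longrightarrow> f i \<in> F"
        | "\<And>i. i \<le> r \<Longrightarrow> even i \<Longrightarrow> f i \<in> F" "\<And>i. i \<le> r \<Longrightarrow> odd i \<Longrightarrow> f i \<in> E"
proof -
  have E: "f i \<in> E" if "a (f i) - b (f i) > 0" for i
    by (rule weights_pos_imp_mem[OF ab(1)]) (use that weights_nonneg[OF ab(2), of "f i"] in linarith)
  have F: "f i \<in> F" if "a (f i) - b (f i) < 0" for i
    by (rule weights_pos_imp_mem[OF ab(2)]) (use that weights_nonneg[OF ab(1), of "f i"] in linarith)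
  show ?thesis
  proof (cases "\<sigma> = 1")
    case True
    then have "a (f i) - b (f i) > 0" if "i \<le> r" "even i" for i using sgn[of i] that by simp
    moreover have "a (f i) - b (f i) < 0" if "i \<le> r" "odd i" for i using sgn[of i] that True by simp
    ultimately show ?thesis using E F that(1) by blast
  next
    case False
    then have "\<sigma> = -1" using \<sigma> by simp
    then have "a (f i) - b (f i) < 0" if "i \<le> r" "even i" for i using sgn[of i] that by simp
    moreover have "a (f i) - b (f i) > 0" if "i \<le> r" "odd i" for i using sgn[of i] that \<open>\<sigma> = -1\<close> by simp
    ultimately show ?thesis using E F that(2) by blast
  qed
qed

lemma chain_of_equal_moments:
  assumes "a \<in> weights E" "b \<in> weights F" "E \<subseteq> {1..m}" "F \<subseteq> {1..m}" "a \<noteq> b"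
    and eq: "\<And>k. k \<le> r \<Longrightarrow> bmoment m k a = bmoment m k b"
  obtains f :: "nat \<Rightarrow> nat" and \<sigma> :: real where "\<And>i. i \<le> r \<Longrightarrow> f i < f (Suc i)" "\<sigma> = 1 \<or> \<sigma> = -1"
    "\<And>i. i \<le> Suc r \<Longrightarrow> \<sigma> * (-1) ^ i * (a (f i) - b (f i)) > 0"
proof -
  obtain t where t: "t \<in> {1..m}" "a t - b t \<noteq> 0" by (rule weights_neq_witness[OF assms(1-5)])
  have "\<exists>f::nat \<Rightarrow> nat. \<exists>\<sigma>::real. (\<sigma> = 1 \<or> \<sigma> = -1) \<and> (\<forall>i\<le>r. f i < f (Suc i)) \<and>
      (\<forall>i\<le>Suc r. f i \<in> {1..m} \<and> \<sigma> * (-1) ^ i * (a (f i) - b (f i)) > 0)"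
    by (rule sign_changes_nonzero[where t = t and c = "\<lambda>t. a t - b t"])
      (use eq t in \<open>auto simp: bmoment_diff\<close>)
  then show ?thesis using that by blast
qed

text \<open>
  In the geometry of dimension \<open>2d\<close>: a point with two different representations lies on two
  intertwining \<open>d\<close>-simplices.
\<close>

lemma intertwines_of_equal_moments:
  assumes ab: "a \<in> weights E" "b \<in> weights F" "E \<subseteq> {1..m}" "F \<subseteq> {1..m}" "a \<noteq> b"
    and eq: "\<And>k. k \<le> 2 * d \<Longrightarrow> bmoment m k a = bmoment m k b"
  shows "\<exists>X Y. length X = Suc d \<and> intertwines X Y \<and> (set X \<subseteq> E \<and> set Y \<subseteq> F \<or> set X \<subseteq> F \<and> set Y \<subseteq> E)"
proof -
  obtain f \<sigma> where f: "\<And>i. i \<le> 2 * d \<Longrightarrow> f i < f (Suc i)" "\<sigma> = 1 \<or> \<sigma> = -1"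
    "\<And>i. i \<le> Suc (2 * d) \<Longrightarrow> \<sigma> * (-1) ^ i * (a (f i) - b (f i)) > 0"
    using chain_of_equal_moments[OF ab eq] by blast
  define X where "X = map (\<lambda>i. f (2 * i)) [0..<Suc d]"
  define Y where "Y = map (\<lambda>i. f (2 * i + 1)) [0..<Suc d]"
  have XY: "intertwines X Y" "length X = Suc d"
    using intertwines_chain[of d f] f(1) by (auto simp: X_def Y_def)
  show ?thesis
  proof (rule alternating_supports[OF ab(1,2) f(2,3)])
    assume "\<And>i. i \<le> Suc (2 * d) \<Longrightarrow> even i \<Longrightarrow> f i \<in> E" "\<And>i. i \<le> Suc (2 * d) \<Longrightarrow> odd i \<Longrightarrow> f i \<in> F"
    then have "set X \<subseteq> E" "set Y \<subseteq> F" by (auto simp: X_def Y_def)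
    then show ?thesis using XY by blast
  next
    assume "\<And>i. i \<le> Suc (2 * d) \<Longrightarrow> even i \<Longrightarrow> f i \<in> F" "\<And>i. i \<le> Suc (2 * d) \<Longrightarrow> odd i \<Longrightarrow> f i \<in> E"
    then have "set X \<subseteq> F" "set Y \<subseteq> E" by (auto simp: X_def Y_def)
    then show ?thesis using XY by blast
  qed auto
qed

text \<open>
  The same in the odd dimension \<open>2d + 1\<close>, where the circuits have \<open>2d + 3\<close> points.
\<close>

lemma interlaced_of_equal_moments:
  assumes ab: "a \<in> weights E" "b \<in> weights F" "E \<subseteq> {1..m}" "F \<subseteq> {1..m}" "a \<noteq> b"
    and eq: "\<And>k. k \<le> Suc (2 * d) \<Longrightarrow> bmoment m k a = bmoment m k b"
  shows "\<exists>X Y. length Y = Suc d \<and> interlaced X Y \<and> (set X \<subseteq> E \<and> set Y \<subseteq> F \<or> set X \<subseteq> F \<and> set Y \<subseteq> E)"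
proof -
  obtain f \<sigma> where f: "\<And>i. i \<le> Suc (2 * d) \<Longrightarrow> f i < f (Suc i)" "\<sigma> = 1 \<or> \<sigma> = -1"
    "\<And>i. i \<le> Suc (Suc (2 * d)) \<Longrightarrow> \<sigma> * (-1) ^ i * (a (f i) - b (f i)) > 0"
    using chain_of_equal_moments[OF ab eq] by blast
  define X where "X = map (\<lambda>i. f (2 * i)) [0..<Suc (Suc d)]"
  define Y where "Y = map (\<lambda>i. f (2 * i + 1)) [0..<Suc d]"
  have XY: "interlaced X Y" "length Y = Suc d"
    using interlaced_chain[of "Suc d" f] f(1) by (auto simp: X_def Y_def)
  show ?thesis
  proof (rule alternating_supports[OF ab(1,2) f(2,3)])
    assume "\<And>i. i \<le> Suc (Suc (2 * d)) \<Longrightarrow> even i \<Longrightarrow> f i \<in> E" "\<And>i. i \<le> Suc (Suc (2 * d)) \<Longrightarrow> odd i \<Longrightarrow> f i \<in> F"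
    then have "set X \<subseteq> E" "set Y \<subseteq> F" by (auto simp: X_def Y_def)
    then show ?thesis using XY by blast
  next
    assume "\<And>i. i \<le> Suc (Suc (2 * d)) \<Longrightarrow> even i \<Longrightarrow> f i \<in> F" "\<And>i. i \<le> Suc (Suc (2 * d)) \<Longrightarrow> odd i \<Longrightarrow> f i \<in> E"
    then have "set X \<subseteq> F" "set Y \<subseteq> E" by (auto simp: X_def Y_def)
    then show ?thesis using XY by blast
  qed auto
qed

definition interleave :: "nat list \<Rightarrow> nat list \<Rightarrow> nat \<Rightarrow> nat" where
  "interleave X Y i = (if even i then X ! (i div 2) else Y ! (i div 2))"

lemma interlaced_interleave_less:
  assumes "interlaced X Y" "i < 2 * length Y"
  shows "interleave X Y i < interleave X Y (Suc i)"
proof (cases "even i")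
  case True
  then have "i div 2 < length Y" using assms(2) by presburger
  then show ?thesis using True assms(1) by (simp add: interleave_def interlaced_def)
next
  case False
  then have "i div 2 < length Y" "Suc i div 2 = Suc (i div 2)" using assms(2) by presburger+
  then show ?thesis using False assms(1) by (simp add: interleave_def interlaced_def)
qed

lemma interlaced_interleave_image:
  assumes "interlaced X Y"
  shows "interleave X Y ` {..2 * length Y} = set X \<union> set Y"
proof
  have X: "length X = Suc (length Y)" using assms by (simp add: interlaced_def)
  show "interleave X Y ` {..2 * length Y} \<subseteq> set X \<union> set Y"
  proof (rule image_subsetI)
    fix i assume "i \<in> {..2 * length Y}"
    then have i: "i \<le> 2 * length Y" by simp
    show "interleave X Y i \<in> set X \<union> set Y"
    proof (cases "even i")
      case True
      then have "i div 2 < length X" using i X by presburger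
      then show ?thesis using True by (simp add: interleave_def)
    next
      case False
      then have "i div 2 < length Y" using i by presburger
      then show ?thesis using False by (simp add: interleave_def)
    qed
  qed
  show "set X \<union> set Y \<subseteq> interleave X Y ` {..2 * length Y}"
  proof
    fix t assume "t \<in> set X \<union> set Y"
    then consider i where "i < length X" "t = X ! i" | i where "i < length Y" "t = Y ! i"
      by (auto simp: in_set_conv_nth)
    then show "t \<in> interleave X Y ` {..2 * length Y}"
    proof cases
      case 1
      then have "t = interleave X Y (2 * i)" "2 * i \<in> {..2 * length Y}" using X by (simp_all add: interleave_def)
      then show ?thesis by (rule image_eqI)
    next
      case 2
      then have "t = interleave X Y (2 * i + 1)" "2 * i + 1 \<in> {..2 * length Y}" by (simp_all add: interleave_def)
      then show ?thesis by (rule image_eqI)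
    qed
  qed
qed

lemma card_interlaced:
  assumes "interlaced X Y"
  shows "card (set X \<union> set Y) = 2 * length Y + 1"
proof -
  have "inj_on (interleave X Y) {..2 * length Y}"
    by (rule strict_chain_inj) (rule interlaced_interleave_less[OF assms])
  then show ?thesis unfolding interlaced_interleave_image[OF assms, symmetric] by (simp add: card_image)
qed

text \<open>
  Subtracting a multiple of \<open>c\<close> moves a point straight down: even vertices lose weight and odd ones gain.
\<close>

lemma interlaced_circuit:
  assumes il: "interlaced X Y" "length Y = d" and sub: "set X \<union> set Y \<subseteq> {1..m}"
  shows "\<exists>c. (\<forall>t\<in>set X. c t > 0) \<and> (\<forall>t\<in>set Y. c t < 0) \<and> (\<forall>t. t \<notin> set X \<union> set Y \<longrightarrow> c t = 0) \<and>
    (\<forall>k<2 * d. bmoment m k c = 0) \<and> bmoment m (2 * d) c = 1"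
proof -
  have X: "length X = Suc d" using il by (simp add: interlaced_def)
  note image = interlaced_interleave_image[OF il(1), unfolded il(2)]
  have "\<exists>c. (\<forall>t. t \<notin> interleave X Y ` {..2*d} \<longrightarrow> c t = 0) \<and> (\<forall>i\<le>2*d. (-1) ^ (2*d - i) * c (interleave X Y i) > 0) \<and>
             (\<forall>k<2*d. bmoment m k c = 0) \<and> bmoment m (2*d) c = 1"
  proof (rule circuit_exists)
    show "interleave X Y i < interleave X Y (Suc i)" if "i < 2 * d" for i
      by (rule interlaced_interleave_less[OF il(1)]) (use that il(2) in simp)
    show "interleave X Y i \<in> {1..m}" if "i \<le> 2 * d" for i
      using that image sub by blast
  qed
  then obtain c where c: "\<And>t. t \<notin> interleave X Y ` {..2*d} \<Longrightarrow> c t = 0"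
    "\<And>i. i \<le> 2*d \<Longrightarrow> (-1) ^ (2*d - i) * c (interleave X Y i) > 0"
    "\<And>k. k < 2 * d \<Longrightarrow> bmoment m k c = 0" "bmoment m (2 * d) c = 1" by blast
  show ?thesis
  proof (intro exI[of _ c] conjI ballI allI impI)
    show "c t > 0" if t: "t \<in> set X" for t
    proof -
      obtain i where i: "i < Suc d" "t = X ! i" using t X by (metis in_set_conv_nth)
      then show ?thesis using c(2)[of "2 * i"] by (simp add: interleave_def minus_one_power_iff)
    qed
    show "c t < 0" if t: "t \<in> set Y" for t
    proof -
      obtain i where i: "i < d" "t = Y ! i" using t il(2) by (metis in_set_conv_nth)
      then show ?thesis using c(2)[of "2 * i + 1"] by (simp add: interleave_def minus_one_power_iff)
    qed
    show "c t = 0" if "t \<notin> set X \<union> set Y" for t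
      by (rule c(1)) (use image that in simp)
  qed (use c in auto)
qed

text \<open>
  The two simplices cross in dimension \<open>2d\<close>; one dimension higher, \<open>Y\<close> passes above \<open>X\<close>.
\<close>

lemma intertwines_circuit:
  assumes il: "intertwines X Y" "length X = Suc d" and sub: "set X \<union> set Y \<subseteq> {1..m}"
  shows "\<exists>c. (\<forall>t\<in>set Y. c t > 0) \<and> (\<forall>t\<in>set X. c t < 0) \<and> (\<forall>t. t \<notin> set X \<union> set Y \<longrightarrow> c t = 0) \<and>
    (\<forall>k\<le>2 * d. bmoment m k c = 0) \<and> bmoment m (Suc (2 * d)) c = 1"
proof -
  have Y: "length Y = Suc d" using il by (simp add: intertwines_def)
  have mem: "interleave X Y i \<in> set X \<union> set Y" if "i \<le> Suc (2 * d)" for i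
  proof -
    have "i div 2 < Suc d" using that by presburger
    then show ?thesis using Y il(2) by (simp add: interleave_def)
  qed
  have "\<exists>c. (\<forall>t. t \<notin> interleave X Y ` {..Suc (2*d)} \<longrightarrow> c t = 0) \<and> (\<forall>i\<le>Suc (2*d). (-1) ^ (Suc (2*d) - i) * c (interleave X Y i) > 0) \<and>
             (\<forall>k<Suc (2*d). bmoment m k c = 0) \<and> bmoment m (Suc (2*d)) c = 1"
  proof (rule circuit_exists)
    fix i assume i: "i < Suc (2 * d)"
    show "interleave X Y i < interleave X Y (Suc i)"
    proof (cases "even i")
      case True
      then have "i div 2 < Suc d" using i by presburger
      then show ?thesis using True il by (simp add: interleave_def intertwines_def)
    next
      case False
      then have "i div 2 < d" "Suc i div 2 = Suc (i div 2)" using i by presburger+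
      then show ?thesis using False il by (simp add: interleave_def intertwines_def)
    qed
  qed (use mem sub in blast)
  then obtain c where c: "\<And>t. t \<notin> interleave X Y ` {..Suc (2*d)} \<Longrightarrow> c t = 0"
    "\<And>i. i \<le> Suc (2*d) \<Longrightarrow> (-1) ^ (Suc (2*d) - i) * c (interleave X Y i) > 0"
    "\<And>k. k < Suc (2 * d) \<Longrightarrow> bmoment m k c = 0" "bmoment m (Suc (2 * d)) c = 1" by blast
  show ?thesis
  proof (intro exI[of _ c] conjI ballI allI impI)
    show "c t < 0" if t: "t \<in> set X" for t
    proof -
      obtain i where i: "i < Suc d" "t = X ! i" using t il(2) by (metis in_set_conv_nth)
      then show ?thesis using c(2)[of "2 * i"] by (simp add: interleave_def minus_one_power_iff Suc_diff_le)
    qed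
    show "c t > 0" if t: "t \<in> set Y" for t
    proof -
      obtain i where i: "i < Suc d" "t = Y ! i" using t Y by (metis in_set_conv_nth)
      then show ?thesis using c(2)[of "2 * i + 1"] by (simp add: interleave_def minus_one_power_iff)
    qed
    show "c t = 0" if "t \<notin> set X \<union> set Y" for t
      by (rule c(1)) (use mem that in blast)
  qed (use c in \<open>auto simp: less_Suc_eq_le\<close>)
qed

lemma continuous_bmoment [continuous_intros]: "continuous_on S (bmoment m k)"
proof -
  have "continuous_on UNIV (\<lambda>c::nat \<Rightarrow> real. c t)" for t by simp
  then have "continuous_on UNIV (bmoment m k)"
    unfolding bmoment_def[abs_def] by (intro continuous_intros) auto
  then show ?thesis using continuous_on_subset by blast
qed

text \<open>
  Bounding the total mass confines the weights to a product of compact intervals.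
\<close>

lemma compact_weights:
  assumes "E \<subseteq> {1..m}"
  shows "compact {a \<in> weights E. bmoment m 0 a \<le> M}"
proof -
  define Q where "Q = (\<Pi>\<^sub>E t\<in>UNIV. if t \<in> E then {0..M} else {0::real})"
  have "compactin (product_topology (\<lambda>t. euclidean) UNIV) Q"
    unfolding Q_def compactin_PiE by auto
  then have Q: "compact Q" by (simp add: euclidean_product_topology)
  have "{a \<in> weights E. bmoment m 0 a \<le> M} = Q \<inter> bmoment m 0 -` {..M}"
  proof (intro set_eqI iffI)
    fix a assume "a \<in> {a \<in> weights E. bmoment m 0 a \<le> M}"
    then have a: "a \<in> weights E" "bmoment m 0 a \<le> M" by auto
    have "a t \<le> M" if "t \<in> E" for t
    proof -
      have "a t \<le> (\<Sum>s=1..m. a s)"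
        using that assms weights_nonneg[OF a(1)] by (intro member_le_sum) auto
      then show ?thesis using a(2) by (simp add: bmoment_def)
    qed
    then show "a \<in> Q \<inter> bmoment m 0 -` {..M}" using a by (auto simp: Q_def weights_def PiE_iff)
  next
    fix a assume "a \<in> Q \<inter> bmoment m 0 -` {..M}"
    then show "a \<in> {a \<in> weights E. bmoment m 0 a \<le> M}"
      by (auto simp: Q_def weights_def PiE_iff split: if_splits)
  qed
  moreover have "closed (bmoment m 0 -` {..M})"
    by (rule closed_vimage) (auto intro: continuous_intros)
  ultimately show ?thesis using Q by (simp add: compact_Int_closed)
qed

section \<open>Separated tuples\<close>

abbreviation sep :: "nat \<Rightarrow> nat \<Rightarrow> nat list set" where "sep \<equiv> separated_tuples"

lemma sep_length: "X \<in> sep d m \<Longrightarrow> length X = Suc d"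
  by (simp add: separated_tuples_def)

lemma sep_subset: "X \<in> sep d m \<Longrightarrow> set X \<subseteq> {1..m}"
  by (simp add: separated_tuples_def)

lemma sep_gap: "X \<in> sep d m \<Longrightarrow> i < d \<Longrightarrow> X ! i + 2 \<le> X ! Suc i"
  by (simp add: separated_tuples_def)

lemma sepI:
  assumes "length X = Suc d" "set X \<subseteq> {1..m}" "\<And>i. i < d \<Longrightarrow> X ! i + 2 \<le> X ! Suc i"
  shows "X \<in> sep d m"
  using assms by (simp add: separated_tuples_def)

lemma sep_less:
  assumes "X \<in> sep d m" "i < j" "j \<le> d"
  shows "X ! i < X ! j"
  by (rule strict_chain[where r = d and f = "\<lambda>i. X ! i"])
    (use assms sep_gap[OF assms(1)] in \<open>auto simp: Suc_le_eq dest: Suc_lessD\<close>)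

lemma sep_ne: "X \<in> sep d m \<Longrightarrow> X \<noteq> []"
  using sep_length by force

lemma last_eq_nth: "length X = Suc d \<Longrightarrow> last X = X ! d"
  by (metis diff_Suc_1 last_conv_nth length_0_conv nat.distinct(1))

lemma sep_le_last:
  assumes "X \<in> sep d m" "t \<in> set X"
  shows "t \<le> last X"
proof -
  obtain i where "i < Suc d" "t = X ! i"
    using assms sep_length[OF assms(1)] by (metis in_set_conv_nth)
  then show ?thesis using sep_less[OF assms(1), of i d] last_eq_nth[OF sep_length[OF assms(1)]]
    by (cases "i = d") auto
qed

lemma sep_last: "X \<in> sep d m \<Longrightarrow> last X \<in> {1..m}"
  using sep_subset sep_ne by (metis last_in_set subsetD)

lemma sep_nth_mem:
  assumes "X \<in> sep d m" "i \<le> d"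
  shows "X ! i \<in> {1..m}"
proof -
  have "X ! i \<in> set X" using assms sep_length[OF assms(1)] by (intro nth_mem) simp
  then show ?thesis using sep_subset[OF assms(1)] by blast
qed

lemma sep_sorted: "X \<in> sep d m \<Longrightarrow> sorted_wrt (<) X"
  using sep_less sep_length by (simp add: sorted_wrt_iff_nth_less)

lemma sep_increasing: "X \<in> sep d m \<Longrightarrow> X \<in> increasing_tuples d m"
  using sep_sorted sep_length sep_subset by (simp add: increasing_tuples_def)

text \<open>
  Both tuples have \<open>d + 1\<close> distinct entries.
\<close>

lemma increasing_set_inj:
  assumes "X \<in> increasing_tuples d m" "Y \<in> increasing_tuples d m" "set X \<subseteq> set Y"
  shows "X = Y"
proof -
  have s: "sorted_wrt (<) X" "sorted_wrt (<) Y" "length X = length Y"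
    using assms(1,2) by (simp_all add: increasing_tuples_def)
  have "card (set X) = card (set Y)" using s by (simp add: distinct_card strict_sorted_iff)
  then have "set X = set Y" using assms(3) by (intro card_subset_eq) simp_all
  then show ?thesis using s(1,2) by (intro strict_sorted_equal) simp_all
qed

lemma sep_change_bound:
  assumes "X \<in> sep d m" "last X \<le> n"
  shows "X \<in> sep d n"
  using assms sep_le_last[OF assms(1)] sep_subset[OF assms(1)] by (fastforce simp: separated_tuples_def)

lemma sep_mono: "X \<in> sep d m \<Longrightarrow> m \<le> n \<Longrightarrow> X \<in> sep d n"
  by (auto simp: separated_tuples_def)

lemma sep_snoc: "x @ [a] \<in> sep (Suc d) m \<longleftrightarrow> x \<in> sep d m \<and> a \<le> m \<and> last x + 2 \<le> a"
proof (cases "length x = Suc d")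
  case True
  then have l: "last x = x ! d" by (rule last_eq_nth)
  show ?thesis
  proof
    assume x: "x @ [a] \<in> sep (Suc d) m"
    have g: "x ! i + 2 \<le> x ! Suc i" if "i < d" for i
      using sep_gap[OF x, of i] that True by (simp add: nth_append)
    have "last x + 2 \<le> a" using sep_gap[OF x, of d] True l by (simp add: nth_append)
    then show "x \<in> sep d m \<and> a \<le> m \<and> last x + 2 \<le> a"
      using sep_subset[OF x] True g by (auto intro!: sepI)
  next
    assume x: "x \<in> sep d m \<and> a \<le> m \<and> last x + 2 \<le> a"
    have "(x @ [a]) ! i + 2 \<le> (x @ [a]) ! Suc i" if "i < Suc d" for i
      using that x True l sep_gap[of x d m i] by (cases "i = d") (auto simp: nth_append)
    then show "x @ [a] \<in> sep (Suc d) m"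
      using x True sep_subset[of x d m] by (intro sepI) auto
  qed
qed (auto dest: sep_length)

lemma sep_Suc_cases:
  assumes "X \<in> sep (Suc d) m"
  obtains x a where "X = x @ [a]" "x \<in> sep d m" "a \<le> m" "last x + 2 \<le> a"
  using assms sep_ne[OF assms] sep_snoc by (metis append_butlast_last_id)

lemma sep_tl: "X \<in> sep (Suc d) m \<Longrightarrow> tl X \<in> sep d m"
  using sep_length[of X "Suc d" m] sep_subset[of X "Suc d" m] sep_gap[of X "Suc d" m]
  by (intro sepI) (auto simp: nth_tl dest: list.set_sel(2)[rotated])

lemma finite_sep: "finite (sep d m)"
  by (rule finite_subset[OF _ finite_lists_length_eq[of "{1..m}" "Suc d"]])
    (auto simp: separated_tuples_def)

lemma sep_zeroE:
  assumes "X \<in> sep 0 m"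
  obtains a where "X = [a]" "a \<in> {1..m}"
proof -
  obtain a where a: "X = [a]" using sep_length[OF assms] by (auto simp: length_Suc_conv)
  have "a \<in> {1..m}" using sep_subset[OF assms] unfolding a by simp
  then show ?thesis by (rule that[OF a])
qed

lemma sep_nth_ge: "X \<in> sep d m \<Longrightarrow> i \<le> d \<Longrightarrow> 2 * i + 1 \<le> X ! i"
proof (induction i)
  case 0
  then have "X ! 0 \<in> set X" by (intro nth_mem) (simp add: sep_length)
  then have "X ! 0 \<in> {1..m}" using sep_subset[OF 0(1)] by blast
  then show ?case by simp
next
  case (Suc i)
  then show ?case using sep_gap[of X d m i] by simp
qed

lemma sep_empty:
  assumes "m \<le> 2 * d"
  shows "sep d m = {}"
proof -
  have False if "X \<in> sep d m" for X
    using sep_nth_ge[of X d m d] sep_last[OF that] last_eq_nth[OF sep_length[OF that]] that assms by simp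
  then show ?thesis by blast
qed

lemma intertwines_snoc:
  assumes "length x = Suc d" "length y = Suc d"
  shows "intertwines (x @ [a]) (y @ [b]) \<longleftrightarrow> intertwines x y \<and> last y < a \<and> a < b"
proof -
  have l: "last y = y ! d" using assms by (simp add: last_eq_nth)
  have 1: "(\<forall>i<Suc (Suc d). (x @ [a]) ! i < (y @ [b]) ! i) \<longleftrightarrow> (\<forall>i<Suc d. x ! i < y ! i) \<and> a < b"
    unfolding All_less_Suc[of "Suc d"] using assms by (simp add: nth_append) blast
  have "(\<forall>i. i + 1 < Suc (Suc d) \<longrightarrow> (y @ [b]) ! i < (x @ [a]) ! (i + 1)) \<longleftrightarrow>
      (\<forall>i<Suc d. (y @ [b]) ! i < (x @ [a]) ! Suc i)" by simp
  also have "\<dots> \<longleftrightarrow> last y < a \<and> (\<forall>i<d. y ! i < x ! Suc i)"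
    unfolding All_less_Suc using assms by (simp add: nth_append l)
  finally show ?thesis unfolding intertwines_def using 1 assms by simp blast
qed

lemma interlaced_snoc:
  assumes "length x = Suc d" "length y = Suc d"
  shows "interlaced (x @ [a]) y \<longleftrightarrow> intertwines x y \<and> last y < a"
proof -
  have l: "last y = y ! d" using assms by (simp add: last_eq_nth)
  have 1: "(\<forall>i<Suc d. (x @ [a]) ! i < y ! i) \<longleftrightarrow> (\<forall>i<Suc d. x ! i < y ! i)"
    using assms by (simp add: nth_append)
  have 2: "(\<forall>i<Suc d. y ! i < (x @ [a]) ! Suc i) \<longleftrightarrow> last y < a \<and> (\<forall>i<d. y ! i < x ! Suc i)"
    unfolding All_less_Suc using assms by (simp add: nth_append l)
  show ?thesis unfolding interlaced_def intertwines_def using 1 2 assms by simp blast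
qed

lemma intertwines_last_less: "intertwines X Y \<Longrightarrow> length X = Suc d \<Longrightarrow> last X < last Y"
  using last_eq_nth[of X d] last_eq_nth[of Y d] by (simp add: intertwines_def)

lemma intertwines_sep:
  assumes "intertwines X Y" "length X = Suc d"
  shows "set X \<subseteq> {1..m} \<Longrightarrow> X \<in> sep d m" "set Y \<subseteq> {1..m} \<Longrightarrow> Y \<in> sep d m"
proof -
  have between: "X ! i < Y ! i" "Y ! i < X ! Suc i" "X ! Suc i < Y ! Suc i" if "i < d" for i
    using assms that by (auto simp: intertwines_def)
  then have "X ! i + 2 \<le> X ! Suc i" "Y ! i + 2 \<le> Y ! Suc i" if "i < d" for i
    using between[OF that] by linarith+
  then show "set X \<subseteq> {1..m} \<Longrightarrow> X \<in> sep d m" "set Y \<subseteq> {1..m} \<Longrightarrow> Y \<in> sep d m"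
    using assms by (auto intro!: sepI simp: intertwines_def)
qed

lemma interlaced_sep:
  assumes "interlaced X Y" "length Y = d" "set X \<subseteq> {1..m}"
  shows "X \<in> sep d m"
proof -
  have between: "X ! i < Y ! i" "Y ! i < X ! Suc i" if "i < d" for i
    using assms that by (auto simp: interlaced_def)
  then have "X ! i + 2 \<le> X ! Suc i" if "i < d" for i
    using between[OF that] by linarith
  then show ?thesis using assms by (auto intro!: sepI simp: interlaced_def)
qed

lemma interlaced_inner_sep:
  assumes "interlaced X Y" "length Y = Suc d" "set Y \<subseteq> {1..m}"
  shows "Y \<in> sep d m"
proof (rule sepI)
  fix i assume i: "i < d"
  have "Y ! i < X ! Suc i" "X ! Suc i < Y ! Suc i" using assms(1,2) i by (auto simp: interlaced_def)
  then show "Y ! i + 2 \<le> Y ! Suc i" by linarith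
qed (use assms in auto)

lemma interlaced_append:
  assumes "interlaced X Y" "last X < a" "a < b"
  shows "interlaced (X @ [b]) (Y @ [a])"
proof -
  have l: "last X = X ! length Y" "length X = Suc (length Y)"
    using assms(1) last_eq_nth[of X "length Y"] by (auto simp: interlaced_def)
  have "(X @ [b]) ! i < (Y @ [a]) ! i \<and> (Y @ [a]) ! i < (X @ [b]) ! Suc i" if "i < Suc (length Y)" for i
  proof (cases "i = length Y")
    case True
    then show ?thesis using l assms by (simp add: nth_append)
  next
    case False
    then have "i < length Y" using that by simp
    then show ?thesis using l assms(1) by (simp add: nth_append interlaced_def)
  qed
  then show ?thesis using l by (simp add: interlaced_def)
qed

lemma interlaced_less_last:
  assumes "interlaced X Y" "X \<in> sep d m" "t \<in> set Y"
  shows "t < last X"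
proof -
  obtain i where i: "i < length Y" "t = Y ! i" using assms(3) by (metis in_set_conv_nth)
  then have "t < X ! Suc i" "Suc i < length X" using assms(1) by (auto simp: interlaced_def)
  then show ?thesis using sep_le_last[OF assms(2), of "X ! Suc i"] by fastforce
qed

lemma interlaced_intertwines:
  assumes "interlaced X Y" "length Y = Suc d" "last X < b"
  shows "intertwines X (Y @ [b])"
proof -
  have len: "length X = Suc (Suc d)" using assms by (simp add: interlaced_def)
  then have X: "X = butlast X @ [last X]" by (metis append_butlast_last_id length_0_conv nat.distinct(1))
  have len': "length (butlast X) = Suc d" using len by simp
  have "interlaced (butlast X @ [last X]) Y" using assms(1) X by simp
  then have "intertwines (butlast X @ [last X]) (Y @ [b])"
    unfolding interlaced_snoc[OF len' assms(2)] intertwines_snoc[OF len' assms(2)] using assms(3) by simp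
  then show ?thesis using X by simp
qed

lemma intertwines_irrefl: "X \<noteq> [] \<Longrightarrow> \<not> intertwines X X"
  by (auto simp: intertwines_def)

lemma non_intertwiningD: "non_intertwining A \<Longrightarrow> X \<in> A \<Longrightarrow> Y \<in> A \<Longrightarrow> intertwines X Y \<Longrightarrow> False"
  by (auto simp: non_intertwining_def)

section \<open>Contracting the edge between the last two labels\<close>

text \<open>
  The label \<open>n + 2\<close> is renamed to \<open>n + 1\<close>. A tuple that ends in \<open>n, n + 2\<close> would lose its separatedness
  and is dropped.
\<close>

definition contraction :: "nat \<Rightarrow> nat list set \<Rightarrow> nat list set" where
  "contraction n A = {X \<in> A. last X \<le> Suc n} \<union> {x @ [Suc n] | x. x @ [Suc (Suc n)] \<in> A \<and> last x < n}"

text \<open>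
  The simplices that are joined to both \<open>n + 1\<close> and \<open>n + 2\<close>. If \<open>x\<close> ends in \<open>n\<close>, its extension by \<open>n + 1\<close> is
  not separated, hence lies on a lower facet and is a simplex of every triangulation.
\<close>

definition edge_link :: "nat \<Rightarrow> nat \<Rightarrow> nat list set \<Rightarrow> nat list set" where
  "edge_link d n A = {x \<in> sep d n. x @ [Suc (Suc n)] \<in> A \<and> (last x = n \<or> x @ [Suc n] \<in> A)}"

lemma edge_link_sep: "edge_link d n A \<subseteq> sep d n"
  by (auto simp: edge_link_def)

context
  fixes n d :: nat and A :: "nat list set"
  assumes A: "A \<subseteq> sep (Suc d) (Suc (Suc n))"
begin

lemma contraction_sep: "contraction n A \<subseteq> sep (Suc d) (Suc n)"
proof
  fix X assume "X \<in> contraction n A"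
  then consider "X \<in> A" "last X \<le> Suc n" | x where "X = x @ [Suc n]" "x @ [Suc (Suc n)] \<in> A" "last x < n"
    by (auto simp: contraction_def)
  then show "X \<in> sep (Suc d) (Suc n)"
  proof cases
    case 1
    show ?thesis by (rule sep_change_bound[of X "Suc d" "Suc (Suc n)"]) (use 1 A in auto)
  next
    case 2
    then have "x \<in> sep d (Suc (Suc n))" using A sep_snoc[of x "Suc (Suc n)" d "Suc (Suc n)"] by blast
    then have "x \<in> sep d (Suc n)" by (rule sep_change_bound) (use 2(3) in auto)
    then show ?thesis using 2 by (simp add: sep_snoc)
  qed
qed

lemma mem_A_snoc: "x @ [a] \<in> A \<Longrightarrow> length x = Suc d \<and> x \<in> sep d n \<and> last x + 2 \<le> a \<and> a \<le> Suc (Suc n)"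
proof -
  assume "x @ [a] \<in> A"
  then have x: "x \<in> sep d (Suc (Suc n))" "a \<le> Suc (Suc n)" "last x + 2 \<le> a" using A sep_snoc[of x a d "Suc (Suc n)"] by blast+
  then have "x \<in> sep d n" using x sep_change_bound[of x d "Suc (Suc n)" n] by simp
  then show ?thesis using x sep_length by simp
qed

text \<open>
  A tuple that is smaller than a renamed one is also smaller than the original, whose last entry is
  even larger.
\<close>

lemma contraction_non_intertwining:
  assumes nonint: "non_intertwining A"
  shows "non_intertwining (contraction n A)"
  unfolding non_intertwining_def
proof (intro ballI notI)
  fix X Y assume XY: "X \<in> contraction n A" "Y \<in> contraction n A" "intertwines X Y"
  have len: "length X = Suc (Suc d)" "length Y = Suc (Suc d)"
    using XY contraction_sep sep_length by blast+
  have lt: "last X < last Y" "last Y \<le> Suc n"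
    using intertwines_last_less[OF XY(3) len(1)] sep_last[of Y] XY(2) contraction_sep by auto
  then have "X \<in> A" using XY(1) by (auto simp: contraction_def)
  have "\<exists>Y'\<in>A. intertwines X Y'"
  proof (cases "Y \<in> A")
    case False
    then obtain y where y: "Y = y @ [Suc n]" "y @ [Suc (Suc n)] \<in> A"
      using XY(2) by (auto simp: contraction_def)
    have X: "X = butlast X @ [last X]" using len(1) by (metis append_butlast_last_id length_0_conv nat.distinct(1))
    have "length (butlast X) = Suc d" "length y = Suc d" using len y by auto
    then have "intertwines X (y @ [Suc (Suc n)])"
      using XY(3) y(1) intertwines_snoc by (metis X less_SucI)
    then show ?thesis using y(2) by blast
  qed (use XY in blast)
  then show False using \<open>X \<in> A\<close> nonint non_intertwiningD by blast
qed

text \<open>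
  If \<open>x\<close> intertwines \<open>y\<close>, so do their extensions by \<open>n + 1\<close> and \<open>n + 2\<close>.
\<close>

lemma edge_link_non_intertwining:
  assumes nonint: "non_intertwining A"
  shows "non_intertwining (edge_link d n A)"
  unfolding non_intertwining_def
proof (intro ballI notI)
  fix x y assume xy: "x \<in> edge_link d n A" "y \<in> edge_link d n A" "intertwines x y"
  have s: "x \<in> sep d n" "y \<in> sep d n" using xy edge_link_sep by blast+
  have len: "length x = Suc d" "length y = Suc d" using s sep_length by blast+
  have "last x < last y" "last y \<le> n" using intertwines_last_less[OF xy(3) len(1)] sep_last[OF s(2)] by auto
  then have "x @ [Suc n] \<in> A" "intertwines (x @ [Suc n]) (y @ [Suc (Suc n)])"
    using xy by (auto simp: edge_link_def intertwines_snoc[OF len])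
  then show False using xy(2) nonint non_intertwiningD by (auto simp: edge_link_def)
qed

text \<open>
  Renaming identifies \<open>x @ [n + 1]\<close> with \<open>x @ [n + 2]\<close> and drops the tuples that end in \<open>n, n + 2\<close>: it
  loses exactly one element of \<open>A\<close> for each element of the edge link.
\<close>

lemma card_contraction_edge_link: "card A = card (contraction n A) + card (edge_link d n A)"
proof -
  define A1 where "A1 = {X \<in> A. last X \<le> Suc n}"
  define T where "T = {x. x @ [Suc (Suc n)] \<in> A}"
  define T' where "T' = {x \<in> T. last x < n \<and> x @ [Suc n] \<notin> A}"
  have fin: "finite A" using A finite_sep finite_subset by blast
  have "A \<subseteq> A1 \<union> (\<lambda>x. x @ [Suc (Suc n)]) ` T"
  proof
    fix X assume X: "X \<in> A"
    then have "X \<in> sep (Suc d) (Suc (Suc n))" using A by blast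
    then obtain x a where x: "X = x @ [a]" "a \<le> Suc (Suc n)" by (rule sep_Suc_cases)
    then show "X \<in> A1 \<union> (\<lambda>x. x @ [Suc (Suc n)]) ` T"
      using X by (cases "a = Suc (Suc n)") (auto simp: A1_def T_def)
  qed
  then have A_eq: "A = A1 \<union> (\<lambda>x. x @ [Suc (Suc n)]) ` T" by (auto simp: A1_def T_def)
  have inj: "inj_on (\<lambda>x. x @ [a]) S" for a :: nat and S by (auto simp: inj_on_def)
  have T: "T = T' \<union> edge_link d n A"
  proof (intro set_eqI iffI)
    fix x assume "x \<in> T"
    then show "x \<in> T' \<union> edge_link d n A" using mem_A_snoc[of x "Suc (Suc n)"]
      by (auto simp: T_def T'_def edge_link_def)
  qed (auto simp: T_def T'_def edge_link_def)
  have finT: "finite T"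
    using fin finite_subset[of "(\<lambda>x. x @ [Suc (Suc n)]) ` T" A] finite_imageD[OF _ inj] A_eq by blast
  have disj: "T' \<inter> edge_link d n A = {}" by (auto simp: T'_def edge_link_def)
  have "card A = card A1 + card ((\<lambda>x. x @ [Suc (Suc n)]) ` T)"
    by (subst A_eq, rule card_Un_disjoint) (use fin finT in \<open>auto simp: A1_def\<close>)
  also have "card ((\<lambda>x. x @ [Suc (Suc n)]) ` T) = card T' + card (edge_link d n A)"
    using finT disj by (subst card_image[OF inj], subst T, intro card_Un_disjoint) (auto simp: T'_def edge_link_def T_def)
  finally have card: "card A = card A1 + (card T' + card (edge_link d n A))" .
  have "card A1 + card T' = card (A1 \<union> (\<lambda>x. x @ [Suc n]) ` T')"
  proof (subst card_Un_disjoint)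
    show "finite ((\<lambda>x. x @ [Suc n]) ` T')" using finT by (auto simp: T'_def)
    show "A1 \<inter> (\<lambda>x. x @ [Suc n]) ` T' = {}" by (auto simp: A1_def T'_def)
  qed (use fin in \<open>auto simp: A1_def card_image inj\<close>)
  also have "A1 \<union> (\<lambda>x. x @ [Suc n]) ` T' = contraction n A"
    by (auto simp: A1_def T'_def T_def contraction_def)
  finally have "card A1 + card T' = card (contraction n A)" .
  then show ?thesis using card by simp
qed

end

text \<open>
  Induction along the contraction: the bounds for the two parts add up by Pascal's rule.
\<close>

lemma card_non_intertwining_le:
  assumes "A \<subseteq> sep d m" "non_intertwining A"
  shows "card A \<le> (m - d - 1) choose d"
  using assms
proof (induction m arbitrary: d A rule: less_induct)
  case (less m)
  show ?case
  proof (cases d)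
    case 0
    have "X = Y" if "X \<in> A" "Y \<in> A" for X Y
    proof -
      have "length X = 1" "length Y = 1" using that less.prems(1) 0 sep_length by fastforce+
      then obtain a b where "X = [a]" "Y = [b]" by (metis One_nat_def length_0_conv length_Suc_conv)
      then show ?thesis using that non_intertwiningD[OF less.prems(2), of X Y] non_intertwiningD[OF less.prems(2), of Y X]
        by (cases a b rule: linorder_cases) (auto simp: intertwines_def)
    qed
    then have "card A \<le> 1" using card_le_Suc0_iff_eq[of A] finite_subset[OF less.prems(1) finite_sep] by auto
    then show ?thesis using 0 by simp
  next
    case (Suc e)
    show ?thesis
    proof (cases "m \<le> 2 * d")
      case True
      then show ?thesis using sep_empty less.prems(1) by (metis card.empty le0 subset_empty)
    next
      case False
      define n where "n = m - 2"
      have n: "m = Suc (Suc n)" "n > 2 * e" using False Suc by (auto simp: n_def)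
      have A: "A \<subseteq> sep (Suc e) (Suc (Suc n))" using less.prems(1) n Suc by simp
      have "card (contraction n A) \<le> (Suc n - d - 1) choose d"
        by (rule less.IH) (use n Suc contraction_sep[OF A] contraction_non_intertwining[OF A less.prems(2)] in auto)
      moreover have "card (edge_link e n A) \<le> (n - e - 1) choose e"
        by (rule less.IH) (use n edge_link_sep edge_link_non_intertwining[OF A less.prems(2)] in auto)
      moreover have "(m - d - 1) choose d = ((Suc n - d - 1) choose d) + ((n - e - 1) choose e)"
      proof -
        have "m - d - 1 = Suc (n - e - 1)" "Suc n - d - 1 = n - e - 1" using n Suc by auto
        then show ?thesis using Suc by simp
      qed
      ultimately show ?thesis using card_contraction_edge_link[OF A] by simp
    qed
  qed
qed

definition maximum_family :: "nat \<Rightarrow> nat \<Rightarrow> nat list set \<Rightarrow> bool" where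
  "maximum_family d m A \<longleftrightarrow> A \<subseteq> sep d m \<and> non_intertwining A \<and> card A = (m - d - 1) choose d"

lemma maximum_family_contains:
  assumes A: "maximum_family d m A" and X: "X \<in> sep d m"
    and "\<And>Y. Y \<in> A \<Longrightarrow> \<not> intertwines X Y \<and> \<not> intertwines Y X"
  shows "X \<in> A"
proof (rule ccontr)
  assume "X \<notin> A"
  have fin: "finite A" using A finite_sep finite_subset by (auto simp: maximum_family_def)
  have "non_intertwining (insert X A)"
    using assms intertwines_irrefl[OF sep_ne[OF X]] by (auto simp: non_intertwining_def maximum_family_def)
  then have "card (insert X A) \<le> (m - d - 1) choose d"
    using A X by (intro card_non_intertwining_le) (auto simp: maximum_family_def)
  then show False using A fin \<open>X \<notin> A\<close> by (simp add: maximum_family_def)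
qed

text \<open>
  The two bounds add up to the size of \<open>A\<close>, so both are attained.
\<close>

lemma maximum_family_contract:
  assumes A: "maximum_family (Suc d) (Suc (Suc n)) A" and n: "2 * d < n"
  shows "maximum_family (Suc d) (Suc n) (contraction n A)" "maximum_family d n (edge_link d n A)"
proof -
  have s: "A \<subseteq> sep (Suc d) (Suc (Suc n))" and ni: "non_intertwining A" using A by (auto simp: maximum_family_def)
  have "card (contraction n A) \<le> (Suc n - Suc d - 1) choose Suc d"
    by (intro card_non_intertwining_le contraction_sep[OF s] contraction_non_intertwining[OF s ni])
  moreover have "card (edge_link d n A) \<le> (n - d - 1) choose d"
    by (intro card_non_intertwining_le edge_link_sep edge_link_non_intertwining[OF s ni])
  moreover have "(Suc (Suc n) - Suc d - 1) choose Suc d = ((Suc n - Suc d - 1) choose Suc d) + ((n - d - 1) choose d)"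
  proof -
    have "Suc (Suc n) - Suc d - 1 = Suc (n - d - 1)" "Suc n - Suc d - 1 = n - d - 1" using n by auto
    then show ?thesis by simp
  qed
  moreover note card_contraction_edge_link[OF s]
  ultimately have "card (contraction n A) = (Suc n - Suc d - 1) choose Suc d"
    "card (edge_link d n A) = (n - d - 1) choose d" using A by (auto simp: maximum_family_def)
  then show "maximum_family (Suc d) (Suc n) (contraction n A)" "maximum_family d n (edge_link d n A)"
    using contraction_sep[OF s] contraction_non_intertwining[OF s ni] edge_link_sep
      edge_link_non_intertwining[OF s ni] by (auto simp: maximum_family_def)
qed

section \<open>Cliques and coverings\<close>

text \<open>
  A candidate for a simplex of the triangulation. Only separated tuples are tested, because the other
  \<open>d\<close>-simplices lie on lower facets.
\<close>

definition clique :: "nat \<Rightarrow> nat \<Rightarrow> nat list set \<Rightarrow> nat set \<Rightarrow> bool" where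
  "clique d m A E \<longleftrightarrow> E \<subseteq> {1..m} \<and> (\<forall>X \<in> sep d m. set X \<subseteq> E \<longrightarrow> X \<in> A)"

text \<open>
  From a point in the relative interior of the simplex on \<open>E\<close> one can move straight down inside the
  simplex on \<open>X\<close> and \<open>Y\<close>: only the weights on \<open>X\<close>, which are positive there, decrease. A clique without
  separated tuples lies on a lower facet, where no such motion exists.
\<close>

definition extendable :: "nat \<Rightarrow> nat \<Rightarrow> nat list set \<Rightarrow> bool" where
  "extendable d m A \<longleftrightarrow> (\<forall>E Z. clique d m A E \<longrightarrow> Z \<in> sep d m \<longrightarrow> set Z \<subseteq> E \<longrightarrow>
     (\<exists>X Y. interlaced X Y \<and> length Y = d \<and> set X \<subseteq> E \<and> E \<subseteq> set X \<union> set Y \<and> clique d m A (set X \<union> set Y)))"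

text \<open>
  Weights are not normalised here: up to a factor, each point of the polytope lies in the simplex on
  some clique.
\<close>

definition covering :: "nat \<Rightarrow> nat \<Rightarrow> nat list set \<Rightarrow> bool" where
  "covering d m A \<longleftrightarrow> (\<forall>w \<in> weights {1..m}. \<exists>E v. clique d m A E \<and> v \<in> weights E \<and>
     (\<forall>k\<le>2 * d. bmoment m k v = bmoment m k w))"

lemma cliqueD: "clique d m A E \<Longrightarrow> X \<in> sep d m \<Longrightarrow> set X \<subseteq> E \<Longrightarrow> X \<in> A"
  by (simp add: clique_def)

lemma clique_bound: "clique d m A E \<Longrightarrow> E \<subseteq> {1..m}"
  by (simp add: clique_def)

lemma clique_subset: "clique d m A E \<Longrightarrow> F \<subseteq> E \<Longrightarrow> clique d m A F"
  unfolding clique_def by blast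

text \<open>
  A tuple in \<open>A\<close> is the only separated tuple on its own labels.
\<close>

lemma clique_of_member:
  assumes "X \<in> A" "X \<in> sep d m"
  shows "clique d m A (set X)"
  unfolding clique_def
proof (intro conjI ballI impI)
  fix Z assume Z: "Z \<in> sep d m" "set Z \<subseteq> set X"
  have "Z = X" by (rule increasing_set_inj[OF sep_increasing[OF Z(1)] sep_increasing[OF assms(2)] Z(2)])
  then show "Z \<in> A" using assms(1) by simp
qed (rule sep_subset[OF assms(2)])

lemma finite_cliques: "finite {E. clique d m A E}"
  by (rule finite_subset[of _ "Pow {1..m}"]) (auto simp: clique_def)

lemma extendableE:
  assumes "extendable d m A" "clique d m A E" "Z \<in> sep d m" "set Z \<subseteq> E"
  obtains X Y where "interlaced X Y" "length Y = d" "set X \<subseteq> E" "E \<subseteq> set X \<union> set Y"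
    "clique d m A (set X \<union> set Y)"
  using assms unfolding extendable_def by blast

lemma small_step:
  fixes c v :: "nat \<Rightarrow> real"
  assumes "finite S" "\<And>t. t \<in> S \<Longrightarrow> 0 < v t" "0 < \<delta>"
  shows "\<exists>\<epsilon>>0. \<epsilon> \<le> \<delta> \<and> (\<forall>t\<in>S. \<epsilon> * c t \<le> v t)"
  using assms
proof (induction S rule: finite_induct)
  case empty
  then show ?case by auto
next
  case (insert t S)
  then obtain \<epsilon> where e: "\<epsilon> > 0" "\<epsilon> \<le> \<delta>" "\<And>s. s \<in> S \<Longrightarrow> \<epsilon> * c s \<le> v s" by auto
  define \<eta> where "\<eta> = min \<epsilon> (if c t > 0 then v t / c t else \<epsilon>)"
  have \<eta>: "\<eta> > 0" "\<eta> \<le> \<epsilon>" using e insert.prems(1)[of t] by (auto simp: \<eta>_def)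
  have "\<eta> * c s \<le> v s" if "s \<in> S" for s
  proof (cases "c s > 0")
    case True
    then have "\<eta> * c s \<le> \<epsilon> * c s" using \<eta> by simp
    then show ?thesis using e(3)[OF that] by simp
  next
    case False
    then have "\<eta> * c s \<le> 0" using \<eta> by (simp add: mult_nonneg_nonpos)
    then show ?thesis using insert.prems(1)[of s] that by simp
  qed
  moreover have "\<eta> * c t \<le> v t"
  proof (cases "c t > 0")
    case True
    then have "\<eta> \<le> v t / c t" by (simp add: \<eta>_def)
    then show ?thesis using True by (simp add: field_simps)
  next
    case False
    then have "\<eta> * c t \<le> 0" using \<eta> by (simp add: mult_nonneg_nonpos)
    then show ?thesis using insert.prems(1)[of t] by simp
  qed
  ultimately show ?case using \<eta> e by (intro exI[of _ \<eta>]) auto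
qed

lemma move_along:
  assumes v: "v \<in> weights E" and pos: "\<forall>t\<in>S. 0 < v t" and fin: "finite S"
    and c: "\<forall>t. t \<notin> S \<longrightarrow> 0 \<le> c t" "\<forall>t. t \<notin> F \<longrightarrow> c t = 0" and EF: "E \<subseteq> F" and \<delta>: "0 < \<delta>"
  shows "\<exists>\<epsilon>>0. \<epsilon> \<le> \<delta> \<and> (\<lambda>t. v t + \<epsilon> * c t) \<in> weights F"
proof -
  obtain \<epsilon> where e: "\<epsilon> > 0" "\<epsilon> \<le> \<delta>" "\<forall>t\<in>S. \<epsilon> * - c t \<le> v t"
    using small_step[OF fin, of v \<delta> "\<lambda>t. - c t"] pos \<delta> by blast
  have "0 \<le> v t + \<epsilon> * c t" for t
  proof (cases "t \<in> S")
    case True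
    then have "\<epsilon> * - c t \<le> v t" using e(3) by blast
    then show ?thesis by simp
  next
    case False
    then show ?thesis using c(1) e(1) weights_nonneg[OF v, of t] by (simp add: add_nonneg_nonneg)
  qed
  moreover have "v t + \<epsilon> * c t = 0" if "t \<notin> F" for t
  proof -
    have "v t = 0" by (rule weights_zero[OF v]) (use that EF in blast)
    then show ?thesis using that c(2) by simp
  qed
  ultimately have "(\<lambda>t. v t + \<epsilon> * c t) \<in> weights F" by (simp add: weights_def)
  then show ?thesis using e(1,2) by (intro exI[of _ \<epsilon>] conjI)
qed

lemma weights_support: "v \<in> weights E \<Longrightarrow> v \<in> weights {t. v t \<noteq> 0}"
  by (auto simp: weights_def)

lemma compact_clique_weights:
  "compact {v \<in> (\<Union>E\<in>{E. clique d m A E}. weights E). bmoment m 0 v \<le> M}"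
proof -
  have "{v \<in> (\<Union>E\<in>{E. clique d m A E}. weights E). bmoment m 0 v \<le> M} =
      (\<Union>E\<in>{E. clique d m A E}. {v \<in> weights E. bmoment m 0 v \<le> M})" by blast
  also have "compact \<dots>"
    using compact_weights clique_bound by (intro compact_UN finite_cliques) blast
  finally show ?thesis .
qed

lemma closed_moments: "closed {v. \<forall>k<r. bmoment m k v = \<mu> k}"
proof -
  have "{v. \<forall>k<r. bmoment m k v = \<mu> k} = (\<Inter>k\<in>{..<r}. bmoment m k -` {\<mu> k})" by auto
  moreover have "closed (bmoment m k -` {\<mu> k})" for k
    by (rule closed_vimage) (auto intro: continuous_intros)
  ultimately show ?thesis by (simp add: closed_INT)
qed

lemma closed_moment_ge: "closed {v. bmoment m r v \<ge> \<mu>}"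
proof -
  have "{v. bmoment m r v \<ge> \<mu>} = bmoment m r -` {\<mu>..}" by auto
  moreover have "closed (bmoment m r -` {\<mu>..})"
    by (rule closed_vimage) (auto intro: continuous_intros)
  ultimately show ?thesis by simp
qed

lemma bmoment_attains_max:
  assumes "compact K" "w \<in> K"
  shows "\<exists>u\<in>K. \<forall>x\<in>K. bmoment m r x \<le> bmoment m r u"
proof -
  have ne: "K \<noteq> {}" using assms(2) by blast
  show ?thesis using continuous_attains_sup[OF assms(1) ne continuous_bmoment[of K m r]] by blast
qed

lemma bmoment_attains_min:
  assumes "compact K" "w \<in> K"
  shows "\<exists>u\<in>K. \<forall>x\<in>K. bmoment m r u \<le> bmoment m r x"
proof -
  have ne: "K \<noteq> {}" using assms(2) by blast
  show ?thesis using continuous_attains_inf[OF assms(1) ne continuous_bmoment[of K m r]] by blast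
qed

lemma covering_dim_zero:
  assumes "maximum_family 0 m A"
  shows "covering 0 m A"
proof -
  have A: "card A = 1" "A \<subseteq> sep 0 m" using assms by (auto simp: maximum_family_def)
  obtain X where X: "A = {X}" using A(1) by (rule card_1_singletonE)
  then have "X \<in> sep 0 m" using A(2) by simp
  then obtain a where a: "X = [a]" and am: "a \<in> {1..m}" by (rule sep_zeroE)
  have "Y \<in> A" if Y: "Y \<in> sep 0 m" "set Y \<subseteq> {a}" for Y
  proof -
    obtain b where "Y = [b]" using Y(1) by (rule sep_zeroE)
    then show ?thesis using Y(2) X a by simp
  qed
  then have "clique 0 m A {a}" unfolding clique_def using am by simp
  note cl = this
  have "\<exists>E v. clique 0 m A E \<and> v \<in> weights E \<and> (\<forall>k\<le>2 * 0. bmoment m k v = bmoment m k w)"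
    if "w \<in> weights {1..m}" for w
  proof -
    define v where "v = (\<lambda>t. if t = a then bmoment m 0 w else 0)"
    have "bmoment m 0 w \<ge> 0" unfolding bmoment_def using weights_nonneg[OF that] by (intro sum_nonneg) simp
    then have "v \<in> weights {a}" by (simp add: v_def weights_def)
    moreover have "bmoment m 0 v = bmoment m 0 w" using am by (simp add: bmoment_def v_def)
    ultimately show ?thesis using cl by (intro exI[of _ "{a}"] exI[of _ v]) simp
  qed
  then show ?thesis unfolding covering_def by blast
qed

lemma raise_along_interlaced:
  assumes v: "v \<in> weights {1..m}" and il: "interlaced X Y" "length Y = d" "set X \<union> set Y \<subseteq> {1..m}"
    and pos: "\<forall>t\<in>set Y. 0 < v t"
  shows "\<exists>v'\<in>weights {1..m}. (\<forall>k<2 * d. bmoment m k v' = bmoment m k v) \<and>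
    bmoment m (2 * d) v < bmoment m (2 * d) v'"
proof -
  obtain c where c: "\<forall>t\<in>set X. 0 < c t" "\<forall>t\<in>set Y. c t < 0"
    "\<forall>t. t \<notin> set X \<union> set Y \<longrightarrow> c t = 0" "\<forall>k<2 * d. bmoment m k c = 0" "bmoment m (2 * d) c = 1"
    using interlaced_circuit[OF il] by (elim exE conjE) (rule that; assumption)
  have c_nonneg: "\<forall>t. t \<notin> set Y \<longrightarrow> 0 \<le> c t" using c(1,3) by (metis Un_iff less_eq_real_def)
  have c_zero: "\<forall>t. t \<notin> {1..m} \<longrightarrow> c t = 0" using c(3) il(3) by blast
  obtain \<epsilon> where e: "0 < \<epsilon>" "\<epsilon> \<le> 1" "(\<lambda>t. v t + \<epsilon> * c t) \<in> weights {1..m}"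
    using move_along[where S = "set Y" and c = c, OF v pos finite_set c_nonneg c_zero order.refl zero_less_one]
    by (elim exE conjE) (rule that; assumption)
  show ?thesis
  proof (intro bexI[OF _ e(3)] conjI allI impI)
    show "bmoment m k (\<lambda>t. v t + \<epsilon> * c t) = bmoment m k v" if "k < 2 * d" for k
      unfolding bmoment_add bmoment_scale using c(4) that by simp
    show "bmoment m (2 * d) v < bmoment m (2 * d) (\<lambda>t. v t + \<epsilon> * c t)"
      unfolding bmoment_add bmoment_scale c(5) using e(1) by simp
  qed
qed

lemma lower_along_interlaced:
  assumes v: "v \<in> weights E" "E \<subseteq> F" and il: "interlaced X Y" "length Y = d"
    and F: "set X \<union> set Y \<subseteq> F" "F \<subseteq> {1..m}"
    and pos: "\<forall>t\<in>set X. 0 < v t" and \<delta>: "0 < \<delta>"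
  shows "\<exists>v'\<in>weights F. (\<forall>k<2 * d. bmoment m k v' = bmoment m k v) \<and>
    bmoment m (2 * d) v' < bmoment m (2 * d) v \<and> bmoment m (2 * d) v \<le> bmoment m (2 * d) v' + \<delta>"
proof -
  obtain c where c: "\<forall>t\<in>set X. 0 < c t" "\<forall>t\<in>set Y. c t < 0"
    "\<forall>t. t \<notin> set X \<union> set Y \<longrightarrow> c t = 0" "\<forall>k<2 * d. bmoment m k c = 0" "bmoment m (2 * d) c = 1"
    using interlaced_circuit[OF il order.trans[OF F]] by (elim exE conjE) (rule that; assumption)
  have c_nonneg: "\<forall>t. t \<notin> set X \<longrightarrow> 0 \<le> - c t"
    using c(2,3) by (metis Un_iff less_eq_real_def neg_0_le_iff_le)
  have c_zero: "\<forall>t. t \<notin> F \<longrightarrow> - c t = 0" using c(3) F(1) by (metis neg_equal_0_iff_equal subsetD)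
  obtain \<epsilon> where e: "0 < \<epsilon>" "\<epsilon> \<le> \<delta>" "(\<lambda>t. v t + \<epsilon> * - c t) \<in> weights F"
    using move_along[where S = "set X" and c = "\<lambda>t. - c t", OF v(1) pos finite_set c_nonneg c_zero v(2) \<delta>]
    by (elim exE conjE) (rule that; assumption)
  show ?thesis
  proof (intro bexI[OF _ e(3)] conjI allI impI)
    show "bmoment m k (\<lambda>t. v t + \<epsilon> * - c t) = bmoment m k v" if "k < 2 * d" for k
      unfolding bmoment_add bmoment_scale bmoment_minus using c(4) that by simp
    show "bmoment m (2 * d) (\<lambda>t. v t + \<epsilon> * - c t) < bmoment m (2 * d) v"
      "bmoment m (2 * d) v \<le> bmoment m (2 * d) (\<lambda>t. v t + \<epsilon> * - c t) + \<delta>"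
      unfolding bmoment_add bmoment_scale bmoment_minus c(5) using e(1,2) by simp_all
  qed
qed

text \<open>
  If a separated tuple does not start at \<open>1\<close>, its first \<open>d\<close> entries can be interlaced from outside, so
  that a point with weight on them can be moved up.
\<close>

lemma room_below:
  assumes X: "X \<in> sep d m" and ne: "X ! 0 \<noteq> 1"
  shows "interlaced (1 # map Suc (butlast X)) (butlast X)" "set (1 # map Suc (butlast X)) \<union> set (butlast X) \<subseteq> {1..m}"
proof -
  note mem = sep_nth_mem[OF X] and len = sep_length[OF X]
  show "interlaced (1 # map Suc (butlast X)) (butlast X)"
    unfolding interlaced_def
  proof (intro conjI allI impI)
    fix i assume "i < length (butlast X)"
    then have i: "i < d" using len by simp
    then show "(1 # map Suc (butlast X)) ! i < butlast X ! i"
    proof (cases i)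
      case 0
      then show ?thesis using ne mem[of 0] i len by (simp add: nth_butlast)
    next
      case (Suc j)
      then show ?thesis using i len sep_gap[OF X, of j] by (simp add: nth_butlast)
    qed
    show "butlast X ! i < (1 # map Suc (butlast X)) ! Suc i" using i len by simp
  qed simp
  have "Suc (X ! i) \<in> {1..m} \<and> X ! i \<in> {1..m}" if "i < d" for i
    using sep_gap[OF X that] mem[of "Suc i"] mem[of i] that by simp
  then have "\<forall>t\<in>set (butlast X). Suc t \<in> {1..m} \<and> t \<in> {1..m}"
    using len by (auto simp: in_set_conv_nth nth_butlast)
  moreover have "1 \<in> {1..m}" using mem[of 0] by auto
  ultimately show "set (1 # map Suc (butlast X)) \<union> set (butlast X) \<subseteq> {1..m}" by auto
qed

text \<open>
  The mirror image of \<open>room_below\<close>.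
\<close>

lemma room_above:
  assumes X: "X \<in> sep d m" and ne: "last X \<noteq> m"
  shows "interlaced (map (\<lambda>t. t - 1) (tl X) @ [m]) (tl X)" "set (map (\<lambda>t. t - 1) (tl X) @ [m]) \<union> set (tl X) \<subseteq> {1..m}"
proof -
  note mem = sep_nth_mem[OF X] and len = sep_length[OF X]
  define Z where "Z = map (\<lambda>t. t - 1) (tl X) @ [m]"
  have Z: "Z ! i = (if i < d then X ! Suc i - 1 else m)" if "i \<le> d" for i
    using that len by (auto simp: Z_def nth_append nth_tl)
  have "interlaced Z (tl X)"
    unfolding interlaced_def
  proof (intro conjI allI impI)
    show "length Z = Suc (length (tl X))" by (simp add: Z_def)
    fix i assume "i < length (tl X)"
    then have i: "i < d" using len by simp
    then show "Z ! i < tl X ! i" using Z[of i] sep_gap[OF X i] len by (simp add: nth_tl)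
    show "tl X ! i < Z ! Suc i"
    proof (cases "Suc i < d")
      case True
      then show ?thesis using Z[of "Suc i"] sep_gap[OF X, of "Suc i"] len by (simp add: nth_tl)
    next
      case False
      then have "Suc i = d" using i by simp
      moreover have "X ! d < m" using ne last_eq_nth[OF len] mem[of d] by simp
      ultimately show ?thesis using Z[of "Suc i"] i len by (simp add: nth_tl)
    qed
  qed
  then show "interlaced (map (\<lambda>t. t - 1) (tl X) @ [m]) (tl X)" by (simp only: Z_def)
  have "X ! Suc i - 1 \<in> {1..m} \<and> X ! Suc i \<in> {1..m}" if "i < d" for i
    using sep_gap[OF X that] mem[of "Suc i"] mem[of i] that by auto
  then have "\<forall>t\<in>set (tl X). t - 1 \<in> {1..m} \<and> t \<in> {1..m}"
    using len by (auto simp: in_set_conv_nth nth_tl)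
  moreover have "m \<in> {1..m}" using mem[of 0] by auto
  ultimately show "set (map (\<lambda>t. t - 1) (tl X) @ [m]) \<union> set (tl X) \<subseteq> {1..m}" by auto
qed

text \<open>
  No tuple starts below \<open>1\<close> or ends above \<open>m\<close>, so that nothing intertwines with \<open>X\<close>.
\<close>

lemma maximum_family_end_to_end:
  assumes A: "maximum_family d m A" and X: "X \<in> sep d m" "X ! 0 = 1" "last X = m"
  shows "X \<in> A"
proof (rule maximum_family_contains[OF A X(1)])
  fix Y assume "Y \<in> A"
  then have Y: "Y \<in> sep d m" using A by (auto simp: maximum_family_def)
  have "Y ! d \<in> {1..m}" "Y ! 0 \<in> {1..m}" using sep_nth_mem[OF Y] by blast+
  then show "\<not> intertwines X Y \<and> \<not> intertwines Y X"
    using X last_eq_nth[OF sep_length[OF X(1)]] sep_length[OF X(1)] sep_length[OF Y]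
    by (auto simp: intertwines_def)
qed

text \<open>
  A separated tuple in the support of a weight that cannot be moved up has no room at either end.
\<close>

lemma top_weight_clique:
  assumes A: "maximum_family d m A" and v: "v \<in> weights {1..m}"
    and top: "\<And>v'. v' \<in> weights {1..m} \<Longrightarrow> (\<And>k. k < 2 * d \<Longrightarrow> bmoment m k v' = bmoment m k v) \<Longrightarrow>
      bmoment m (2 * d) v' \<le> bmoment m (2 * d) v"
  shows "clique d m A {t. v t \<noteq> 0}"
proof -
  have no_room: False if il: "interlaced Z Y" "length Y = d" "set Z \<union> set Y \<subseteq> {1..m}" "set Y \<subseteq> {t. v t \<noteq> 0}" for Z Y
  proof -
    have pos: "\<forall>t\<in>set Y. 0 < v t" using il(4) weights_nonneg[OF v] by (auto simp: less_le)
    obtain v' where "v' \<in> weights {1..m}" "\<And>k. k < 2 * d \<Longrightarrow> bmoment m k v' = bmoment m k v"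
      "bmoment m (2 * d) v < bmoment m (2 * d) v'"
      using raise_along_interlaced[OF v il(1-3) pos] by blast
    then show False using top[of v'] by simp
  qed
  have "X \<in> A" if X: "X \<in> sep d m" "set X \<subseteq> {t. v t \<noteq> 0}" for X
  proof -
    have "set (butlast X) \<subseteq> {t. v t \<noteq> 0}" "set (tl X) \<subseteq> {t. v t \<noteq> 0}"
      using X(2) in_set_butlastD[of _ X] list.set_sel(2)[OF sep_ne[OF X(1)]] by blast+
    moreover have "length (butlast X) = d" "length (tl X) = d" using sep_length[OF X(1)] by simp_all
    ultimately have "X ! 0 = 1" "last X = m"
      using no_room[OF room_below(1)[OF X(1)] _ room_below(2)[OF X(1)]]
        no_room[OF room_above(1)[OF X(1)] _ room_above(2)[OF X(1)]] by blast+
    then show ?thesis by (rule maximum_family_end_to_end[OF A X(1)])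
  qed
  moreover have "{t. v t \<noteq> 0} \<subseteq> {1..m}" using weights_zero[OF v] by blast
  ultimately show ?thesis unfolding clique_def by blast
qed

text \<open>
  On the vertical line through \<open>w\<close>, the points that lie above \<open>w\<close> and are carried by cliques form a
  compact set, which contains the top point of the line. Its lowest point is \<open>w\<close> itself, as otherwise
  one could move further down through a cell.
\<close>

lemma covering_of_extendable:
  assumes A: "maximum_family d m A" and ext: "extendable d m A"
  shows "covering d m A"
proof (cases "d = 0")
  case True
  then show ?thesis using covering_dim_zero A by simp
next
  case False
  have "\<exists>E v. clique d m A E \<and> v \<in> weights E \<and> (\<forall>k\<le>2 * d. bmoment m k v = bmoment m k w)"
    if w: "w \<in> weights {1..m}" for w
  proof -
    define M where "M = bmoment m 0 w"
    define L where "L = {v. \<forall>k<2*d. bmoment m k v = bmoment m k w}"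
    have L_mass: "bmoment m 0 v \<le> M" if "v \<in> L" for v
      using that False by (simp add: L_def M_def)
    have wL: "w \<in> L" by (simp add: L_def)
    \<comment> \<open>The top point of the vertical line.\<close>
    have "compact ({v \<in> weights {1..m}. bmoment m 0 v \<le> M} \<inter> L)"
      unfolding L_def by (intro compact_Int_closed compact_weights closed_moments order.refl)
    moreover have "w \<in> {v \<in> weights {1..m}. bmoment m 0 v \<le> M} \<inter> L" using w wL L_mass by simp
    ultimately have "\<exists>u\<in>{v \<in> weights {1..m}. bmoment m 0 v \<le> M} \<inter> L.
        \<forall>x\<in>{v \<in> weights {1..m}. bmoment m 0 v \<le> M} \<inter> L. bmoment m (2 * d) x \<le> bmoment m (2 * d) u"
      by (rule bmoment_attains_max)
    then obtain v0 where v0: "v0 \<in> {v \<in> weights {1..m}. bmoment m 0 v \<le> M} \<inter> L"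
      and v0_max: "\<And>v. v \<in> {v \<in> weights {1..m}. bmoment m 0 v \<le> M} \<inter> L \<Longrightarrow> bmoment m (2 * d) v \<le> bmoment m (2 * d) v0"
      by blast
    have v0w: "v0 \<in> weights {1..m}" "v0 \<in> L" using v0 by auto
    have "clique d m A {t. v0 t \<noteq> 0}"
    proof (rule top_weight_clique[OF A v0w(1)])
      fix v assume v: "v \<in> weights {1..m}" "\<And>k. k < 2 * d \<Longrightarrow> bmoment m k v = bmoment m k v0"
      then have "v \<in> L" using v0w(2) by (simp add: L_def)
      then show "bmoment m (2 * d) v \<le> bmoment m (2 * d) v0" using v(1) L_mass by (intro v0_max) simp
    qed
    then have v0U: "v0 \<in> (\<Union>E\<in>{E. clique d m A E}. weights E)" using weights_support[OF v0w(1)] by blast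
    \<comment> \<open>The part of the line above \<open>w\<close> that is carried by cliques.\<close>
    define K where "K = {v \<in> (\<Union>E\<in>{E. clique d m A E}. weights E). bmoment m 0 v \<le> M} \<inter>
        (L \<inter> {v. bmoment m (2 * d) v \<ge> bmoment m (2 * d) w})"
    have K: "v \<in> K \<longleftrightarrow> (\<exists>E. clique d m A E \<and> v \<in> weights E) \<and> v \<in> L \<and> bmoment m (2 * d) w \<le> bmoment m (2 * d) v" for v
      unfolding K_def using L_mass[of v] by blast
    have "compact K"
      unfolding K_def L_def
      by (intro compact_Int_closed compact_clique_weights closed_Int closed_moments closed_moment_ge)
    moreover have "v0 \<in> K"
      unfolding K using v0U v0w(2) v0_max[of w] w wL L_mass by blast
    ultimately have "\<exists>u\<in>K. \<forall>x\<in>K. bmoment m (2 * d) u \<le> bmoment m (2 * d) x"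
      by (rule bmoment_attains_min)
    then obtain v1 where v1: "v1 \<in> K"
      and v1_min: "\<And>v. v \<in> K \<Longrightarrow> bmoment m (2 * d) v1 \<le> bmoment m (2 * d) v"
      by blast
    obtain F where F: "clique d m A F" "v1 \<in> weights F" and v1L: "v1 \<in> L"
      and ge: "bmoment m (2 * d) w \<le> bmoment m (2 * d) v1" using v1 unfolding K by blast
    define E where "E = {t. v1 t \<noteq> 0}"
    have E: "E \<subseteq> F" using weights_zero[OF F(2)] unfolding E_def by blast
    have v1E: "v1 \<in> weights E" unfolding E_def by (rule weights_support[OF F(2)])
    have clE: "clique d m A E" by (rule clique_subset[OF F(1) E])
    have same: "bmoment m k v1 = bmoment m k w" if "k < 2 * d" for k using v1L that by (simp add: L_def)
    have eq: "bmoment m (2 * d) v1 = bmoment m (2 * d) w"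
    proof (rule ccontr)
      assume "bmoment m (2 * d) v1 \<noteq> bmoment m (2 * d) w"
      then have gap: "bmoment m (2 * d) w < bmoment m (2 * d) v1" using ge by simp
      obtain Z W where Z: "interlaced Z W" "length W = d" "set Z \<subseteq> E"
        using interlaced_sign_changes[OF w v1E same[symmetric] gap] by blast
      have Zsep: "Z \<in> sep d m" by (rule interlaced_sep[OF Z(1,2)]) (use Z(3) clique_bound[OF clE] in blast)
      obtain X Y where XY: "interlaced X Y" "length Y = d" "set X \<subseteq> E" "E \<subseteq> set X \<union> set Y"
        "clique d m A (set X \<union> set Y)" by (rule extendableE[OF ext clE Zsep Z(3)]) blast
      have pos: "\<forall>t\<in>set X. 0 < v1 t" using XY(3) weights_nonneg[OF v1E] by (auto simp: E_def less_le)
      obtain v2 where v2: "v2 \<in> weights (set X \<union> set Y)" "\<And>k. k < 2 * d \<Longrightarrow> bmoment m k v2 = bmoment m k v1"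
        "bmoment m (2 * d) v2 < bmoment m (2 * d) v1"
        "bmoment m (2 * d) v1 \<le> bmoment m (2 * d) v2 + (bmoment m (2 * d) v1 - bmoment m (2 * d) w)"
        using lower_along_interlaced[OF v1E XY(4) XY(1,2) order.refl clique_bound[OF XY(5)] pos
              diff_gt_0_iff_gt[THEN iffD2, OF gap]] by blast
      have "v2 \<in> L" unfolding L_def using v2(2) same by simp
      moreover have "bmoment m (2 * d) w \<le> bmoment m (2 * d) v2" using v2(4) by simp
      ultimately have "v2 \<in> K" unfolding K using XY(5) v2(1) by blast
      then have "bmoment m (2 * d) v1 \<le> bmoment m (2 * d) v2" by (rule v1_min)
      then show False using v2(3) by simp
    qed
    have "bmoment m k v1 = bmoment m k w" if "k \<le> 2 * d" for k
      using same[of k] eq that by (cases "k = 2 * d") simp_all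
    then show ?thesis using clE v1E by blast
  qed
  then show ?thesis unfolding covering_def by blast
qed

section \<open>The two sides of the edge link\<close>

lemma link_sep: "x \<in> edge_link d n A \<Longrightarrow> x \<in> sep d n"
  by (simp add: edge_link_def)

lemma link_upper: "x \<in> edge_link d n A \<Longrightarrow> x @ [Suc (Suc n)] \<in> A"
  by (simp add: edge_link_def)

lemma link_lower: "x \<in> edge_link d n A \<Longrightarrow> last x < n \<Longrightarrow> x @ [Suc n] \<in> A"
  by (auto simp: edge_link_def)

lemma contraction_low: "X \<in> contraction n A \<Longrightarrow> last X \<le> n \<Longrightarrow> X \<in> A"
  by (auto simp: contraction_def)

lemma contraction_snoc: "x @ [Suc n] \<in> contraction n A \<Longrightarrow> x @ [Suc n] \<in> A \<or> x @ [Suc (Suc n)] \<in> A"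
  by (auto simp: contraction_def)

text \<open>
  The last label of a cell is an even vertex; removing it leaves an intertwining pair.
\<close>

lemma interlaced_top_label:
  assumes il: "interlaced X Y" "length Y = Suc d" "set X \<union> set Y \<subseteq> {1..Suc n}" "Suc n \<in> set X \<union> set Y"
  shows "\<exists>x. X = x @ [Suc n] \<and> x \<in> sep d n \<and> last x < n \<and> intertwines x Y \<and> set x \<union> set Y \<subseteq> {1..n} \<and>
    set X \<union> set Y = insert (Suc n) (set x \<union> set Y)"
proof -
  have X: "X \<in> sep (Suc d) (Suc n)" by (rule interlaced_sep[OF il(1,2)]) (use il(3) in blast)
  have Yl: "t < last X" if "t \<in> set Y" for t by (rule interlaced_less_last[OF il(1) X that])
  have "Suc n \<le> last X" using il(4) sep_le_last[OF X] Yl by (meson UnE less_imp_le)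
  then have l: "last X = Suc n" using sep_last[OF X] by simp
  obtain x b where xb: "X = x @ [b]" "x \<in> sep d (Suc n)" "b \<le> Suc n" "last x + 2 \<le> b"
    using X by (rule sep_Suc_cases)
  have b: "b = Suc n" using l xb(1) by simp
  have x: "x \<in> sep d n" using xb(2) by (rule sep_change_bound) (use xb b in simp)
  have "intertwines x Y" using il(1) unfolding xb(1) interlaced_snoc[OF sep_length[OF x] il(2)] by simp
  moreover have "set Y \<subseteq> {1..n}"
  proof
    fix t assume t: "t \<in> set Y"
    then have "t < Suc n" "t \<in> {1..Suc n}" using Yl[OF t] l il(3) by auto
    then show "t \<in> {1..n}" by simp
  qed
  ultimately show ?thesis using xb b x sep_subset[OF x] by (intro exI[of _ x]) auto
qed

lemma clique_contraction:
  assumes E: "clique (Suc d) (Suc (Suc n)) A E" "Suc (Suc n) \<notin> E"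
  shows "clique (Suc d) (Suc n) (contraction n A) E"
  unfolding clique_def
proof (intro conjI ballI impI)
  show "E \<subseteq> {1..Suc n}" using E by (auto simp: clique_def le_Suc_eq)
  fix X assume X: "X \<in> sep (Suc d) (Suc n)" "set X \<subseteq> E"
  have "X \<in> A" by (rule cliqueD[OF E(1) sep_mono[OF X(1)] X(2)]) simp
  then show "X \<in> contraction n A" using sep_last[OF X(1)] by (simp add: contraction_def)
qed

context
  fixes n d :: nat and A :: "nat list set"
  assumes max: "maximum_family (Suc d) (Suc (Suc n)) A" and n: "2 * d < n"
begin

private abbreviation (input) "D \<equiv> edge_link d n A"

lemma family_sep: "A \<subseteq> sep (Suc d) (Suc (Suc n))"
  and family_non_intertwining: "non_intertwining A"
  using max by (auto simp: maximum_family_def)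

lemma link_maximum: "maximum_family d n D"
  by (rule maximum_family_contract(2)[OF max n])

lemma family_no_intertwine: "X \<in> A \<Longrightarrow> Y \<in> A \<Longrightarrow> \<not> intertwines X Y"
  using family_non_intertwining non_intertwiningD by blast

text \<open>
  Two intertwining tuples still intertwine after the smaller one is prolonged by \<open>n + 1\<close> and the larger
  one by \<open>n + 2\<close>. Hence a tuple that \<open>A\<close> prolongs by \<open>n + 1\<close> is nowhere below the link, and one that \<open>A\<close>
  prolongs by \<open>n + 2\<close> is nowhere above it (\<open>below_link\<close>). Since the link is of maximum size,
  this determines how \<open>A\<close> prolongs the tuples that the contraction prolongs (\<open>snoc_lower_mem\<close>,
  \<open>snoc_upper_mem\<close>).
\<close>

lemma above_link:
  assumes x: "x \<in> sep d n" "x @ [Suc n] \<in> A" and y: "y \<in> D"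
  shows "\<not> intertwines x y"
proof
  assume i: "intertwines x y"
  have "last y < Suc n" using sep_last[OF link_sep[OF y]] by simp
  then have "intertwines (x @ [Suc n]) (y @ [Suc (Suc n)])"
    using i intertwines_snoc[OF sep_length[OF x(1)] sep_length[OF link_sep[OF y]]] by simp
  then show False using family_no_intertwine[OF x(2) link_upper[OF y]] by contradiction
qed

lemma below_link:
  assumes x: "x \<in> sep d n" "x @ [Suc (Suc n)] \<in> A" and y: "y \<in> D"
  shows "\<not> intertwines y x"
proof
  assume i: "intertwines y x"
  have ly: "length y = Suc d" by (rule sep_length[OF link_sep[OF y]])
  have "last y < last x" by (rule intertwines_last_less[OF i ly])
  moreover have "last x \<le> n" using sep_last[OF x(1)] by simp
  ultimately have lt: "last y < n" "last x < Suc n" by simp_all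
  then have "intertwines (y @ [Suc n]) (x @ [Suc (Suc n)])"
    using i intertwines_snoc[OF ly sep_length[OF x(1)]] by simp
  then show False using family_no_intertwine[OF link_lower[OF y lt(1)] x(2)] by contradiction
qed

lemma mem_link:
  assumes "x \<in> sep d n" "\<And>y. y \<in> D \<Longrightarrow> \<not> intertwines x y \<and> \<not> intertwines y x"
  shows "x \<in> D"
  by (rule maximum_family_contains[OF link_maximum assms])

lemma snoc_lower_mem:
  assumes x: "x \<in> sep d n" "x @ [Suc n] \<in> contraction n A" "last x < n"
    and no: "\<And>y. y \<in> D \<Longrightarrow> \<not> intertwines x y"
  shows "x @ [Suc n] \<in> A"
proof (rule ccontr)
  assume "x @ [Suc n] \<notin> A"
  then have "x @ [Suc (Suc n)] \<in> A" using contraction_snoc[OF x(2)] by simp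
  then have "x \<in> D" using no below_link[OF x(1)] mem_link[OF x(1)] by blast
  then show False using link_lower x(3) \<open>x @ [Suc n] \<notin> A\<close> by blast
qed

lemma snoc_upper_mem:
  assumes x: "x \<in> sep d n" "last x = n \<or> x @ [Suc n] \<in> contraction n A"
    and no: "\<And>y. y \<in> D \<Longrightarrow> \<not> intertwines y x"
  shows "x @ [Suc (Suc n)] \<in> A"
proof (rule ccontr)
  assume a: "x @ [Suc (Suc n)] \<notin> A"
  have "\<not> intertwines x y" if y: "y \<in> D" for y
  proof (cases "last x = n")
    case True
    show ?thesis
    proof
      assume "intertwines x y"
      then have "last x < last y" using sep_length[OF x(1)] by (rule intertwines_last_less)
      then show False using True sep_last[OF link_sep[OF y]] by simp
    qed
  next
    case False
    then have "x @ [Suc n] \<in> A" using x(2) a contraction_snoc by blast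
    then show ?thesis using above_link[OF x(1) _ y] by blast
  qed
  then have "x \<in> D" using no mem_link[OF x(1)] by blast
  then show False using link_upper a by blast
qed

text \<open>
  All sub-tuples of \<open>w\<close> with \<open>d + 1\<close> entries can be prolonged by \<open>n + 2\<close>, and those that do not end in \<open>n\<close>
  also by \<open>n + 1\<close>. An element of \<open>A\<close> that intertwined with \<open>w\<close> would intertwine with one of these
  prolongations, so that \<open>w\<close> belongs to \<open>A\<close> by maximality.
\<close>

lemma link_clique_sep_mem:
  assumes E: "clique d n D E" and w: "w \<in> sep (Suc d) n" "set w \<subseteq> E"
  shows "w \<in> A"
proof (rule maximum_family_contains[OF max])
  show "w \<in> sep (Suc d) (Suc (Suc n))" using w(1) by (rule sep_mono) simp
  obtain x a where xa: "w = x @ [a]" "x \<in> sep d n" "a \<le> n" "last x + 2 \<le> a"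
    using w(1) by (rule sep_Suc_cases)
  have xD: "x \<in> D" by (rule cliqueD[OF E xa(2)]) (use w(2) xa(1) in simp)
  have "set (tl w) \<subseteq> E" using w(2) list.set_sel(2)[OF sep_ne[OF w(1)]] by blast
  then have tD: "tl w \<in> D" by (rule cliqueD[OF E sep_tl[OF w(1)]])
  have lx: "length x = Suc d" by (rule sep_length[OF xa(2)])
  have lt: "length (tl w) = Suc d" using sep_length[OF w(1)] by simp
  have lw: "last (tl w) = a" using xa(1) lx by (cases x) auto
  fix v assume v: "v \<in> A"
  then have vs: "v \<in> sep (Suc d) (Suc (Suc n))" using family_sep by blast
  then obtain u b where ub: "v = u @ [b]" "u \<in> sep d (Suc (Suc n))" "b \<le> Suc (Suc n)" "last u + 2 \<le> b"
    by (rule sep_Suc_cases)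
  have lu: "length u = Suc d" by (rule sep_length[OF ub(2)])
  have "\<not> intertwines v w"
  proof
    assume "intertwines v w"
    then have "intertwines u x" "last x < b" "b < a"
      using ub(1) xa(1) intertwines_snoc[OF lu lx] by auto
    then have "intertwines v (x @ [Suc (Suc n)])"
      using ub(1) xa(3) intertwines_snoc[OF lu lx] by auto
    then show False using family_no_intertwine[OF v link_upper[OF xD]] by contradiction
  qed
  moreover have "\<not> intertwines w v"
  proof
    assume i: "intertwines w v"
    then have i': "intertwines x u" "last u < a" "a < b"
      using ub(1) xa(1) intertwines_snoc[OF lx lu] by auto
    have u: "u \<in> sep d n" using ub(2) by (rule sep_change_bound) (use i' xa in simp)
    show False
    proof (cases "b = Suc (Suc n)")
      case True
      \<comment> \<open>The tail of \<open>w\<close> may end in \<open>n\<close>, but its initial part does not and is joined to \<open>n + 1\<close>.\<close>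
      then show False using below_link[OF u _ xD] i'(1) v ub(1) by blast
    next
      case False
      have "intertwines u (tl w)"
        unfolding intertwines_def
      proof (intro conjI allI impI)
        show "length u = length (tl w)" using lu lt by simp
        show "u ! i < tl w ! i" if "i < length u" for i
        proof -
          have "u ! i < w ! Suc i"
          proof (cases "i = d")
            case True
            have "w ! Suc d = a" using xa(1) lx by (simp add: nth_append)
            then show ?thesis using i'(2) True last_eq_nth[OF lu] by simp
          next
            case False
            then have "i + 1 < length x" using that lu lx by simp
            then have "u ! i < x ! (i + 1)" using i'(1) by (auto simp: intertwines_def)
            then show ?thesis using xa(1) \<open>i + 1 < length x\<close> by (simp add: nth_append)
          qed
          then show ?thesis using that lu lt by (simp add: nth_tl)
        qed
        show "tl w ! i < u ! (i + 1)" if "i + 1 < length u" for i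
        proof -
          have "x ! Suc i < u ! Suc i" using i'(1) that lu lx by (auto simp: intertwines_def)
          then show ?thesis using that xa(1) lu lx lt by (simp add: nth_tl nth_append)
        qed
      qed
      then have "intertwines v (tl w @ [Suc (Suc n)])"
        using ub(1,3) False i' lw intertwines_snoc[OF lu lt] by auto
      then show False using family_no_intertwine[OF v link_upper[OF tD]] by contradiction
    qed
  qed
  ultimately show "\<not> intertwines w v \<and> \<not> intertwines v w" by blast
qed

lemma link_clique_join:
  assumes E: "clique d n D E"
  shows "clique (Suc d) (Suc (Suc n)) A (E \<union> {Suc n, Suc (Suc n)})"
  unfolding clique_def
proof (intro conjI ballI impI)
  show "E \<union> {Suc n, Suc (Suc n)} \<subseteq> {1..Suc (Suc n)}" using clique_bound[OF E] by auto
  fix X assume X: "X \<in> sep (Suc d) (Suc (Suc n))" "set X \<subseteq> E \<union> {Suc n, Suc (Suc n)}"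
  obtain x a where xa: "X = x @ [a]" "x \<in> sep d (Suc (Suc n))" "a \<le> Suc (Suc n)" "last x + 2 \<le> a"
    using X(1) by (rule sep_Suc_cases)
  have x: "x \<in> sep d n" using xa(2) by (rule sep_change_bound) (use xa in simp)
  have xE: "set x \<subseteq> E"
  proof
    fix t assume t: "t \<in> set x"
    then have "t \<le> n" using sep_subset[OF x] by auto
    then show "t \<in> E" using t X(2) xa(1) by auto
  qed
  have xD: "x \<in> D" by (rule cliqueD[OF E x xE])
  consider "a = Suc (Suc n)" | "a = Suc n" | "a \<le> n" using xa(3) by linarith
  then show "X \<in> A"
  proof cases
    case 1
    then show ?thesis using link_upper[OF xD] xa(1) by simp
  next
    case 2
    then show ?thesis using link_lower[OF xD] xa(1,4) by simp
  next
    case 3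
    have "X \<in> sep (Suc d) n" using X(1) by (rule sep_change_bound) (use 3 xa in simp)
    moreover have "set X \<subseteq> E" using 3 xa(1) X(2) xE by auto
    ultimately show ?thesis by (rule link_clique_sep_mem[OF E])
  qed
qed

text \<open>
  The sheet over the polytope of the link is closed and lies above one end of the segment from \<open>u0\<close> to
  \<open>u1\<close> and below the other. The parameters where the sheet is above and those where it is below form
  closed sets that cover the unit interval, hence have a common element.
\<close>

lemma segment_crosses_link:
  assumes cov: "covering d n D"
    and u0: "u0 \<in> weights E0" "E0 \<subseteq> {1..n}" and u1: "u1 \<in> weights E1" "E1 \<subseteq> {1..n}"
    and z0: "clique d n D F0" "z0 \<in> weights F0" "\<forall>k\<le>2 * d. bmoment n k z0 = bmoment n k u0"
      "bmoment n (Suc (2 * d)) z0 \<le> bmoment n (Suc (2 * d)) u0"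
    and z1: "clique d n D F1" "z1 \<in> weights F1" "\<forall>k\<le>2 * d. bmoment n k z1 = bmoment n k u1"
      "bmoment n (Suc (2 * d)) z1 \<ge> bmoment n (Suc (2 * d)) u1"
  shows "\<exists>s\<in>{0..1}. \<exists>E v. clique d n D E \<and> v \<in> weights E \<and>
    (\<forall>k\<le>Suc (2 * d). bmoment n k v = bmoment n k (\<lambda>t. (1 - s) * u0 t + s * u1 t))"
proof -
  let ?u = "\<lambda>s t. (1 - s) * u0 t + s * u1 t"
  define U where "U k s = (1 - s) * bmoment n k u0 + s * bmoment n k u1" for k s
  have U: "bmoment n k (?u s) = U k s" for k s
    unfolding U_def by (rule bmoment_convex)
  have U_cont: "continuous_on S (\<lambda>p. U k (fst p))" for S :: "(real \<times> (nat \<Rightarrow> real)) set" and k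
    unfolding U_def by (intro continuous_intros)
  have V_cont: "continuous_on S (\<lambda>p. bmoment n k (snd p))" for S :: "(real \<times> (nat \<Rightarrow> real)) set" and k
    by (rule continuous_on_compose2[OF continuous_bmoment[of UNIV]]) (auto intro: continuous_intros)
  define M where "M = bmoment n 0 u0 + bmoment n 0 u1"
  have mass: "0 \<le> bmoment n 0 u0" "0 \<le> bmoment n 0 u1"
    unfolding bmoment_def using weights_nonneg[OF u0(1)] weights_nonneg[OF u1(1)] by (auto intro!: sum_nonneg)
  have M: "U 0 s \<le> M" if "s \<in> {0..1}" for s
  proof -
    have "(1 - s) * bmoment n 0 u0 \<le> bmoment n 0 u0" "s * bmoment n 0 u1 \<le> bmoment n 0 u1"
      using that mass by (auto intro!: mult_left_le_one_le)
    then show ?thesis by (simp add: U_def M_def)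
  qed
  define K where "K = {v \<in> (\<Union>E\<in>{E. clique d n D E}. weights E). bmoment n 0 v \<le> M}"
  have K: "compact K" unfolding K_def by (rule compact_clique_weights)
  define P where "P = {p. \<forall>k<Suc (2 * d). bmoment n k (snd p) = U k (fst p)}"
  have P_closed: "closed P"
  proof -
    have "P = (\<Inter>k\<in>{..<Suc (2 * d)}. {p. bmoment n k (snd p) = U k (fst p)})" by (auto simp: P_def)
    moreover have "closed {p. bmoment n k (snd p) = U k (fst p)}" for k
      by (intro closed_Collect_eq V_cont U_cont)
    ultimately show ?thesis by (simp add: closed_INT)
  qed
  define up where "up = fst ` (({0..1} \<times> K) \<inter> (P \<inter> {p. U (Suc (2 * d)) (fst p) \<le> bmoment n (Suc (2 * d)) (snd p)}))"
  define down where "down = fst ` (({0..1} \<times> K) \<inter> (P \<inter> {p. bmoment n (Suc (2 * d)) (snd p) \<le> U (Suc (2 * d)) (fst p)}))"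
  have "compact up"
    unfolding up_def
    by (intro compact_continuous_image continuous_on_fst continuous_on_id compact_Int_closed compact_Times
        compact_Icc K closed_Int P_closed closed_Collect_le V_cont U_cont)
  then have up_closed: "closed up" by (rule compact_imp_closed)
  have "compact down"
    unfolding down_def
    by (intro compact_continuous_image continuous_on_fst continuous_on_id compact_Int_closed compact_Times
        compact_Icc K closed_Int P_closed closed_Collect_le V_cont U_cont)
  then have down_closed: "closed down" by (rule compact_imp_closed)
  have mem: "(s, v) \<in> ({0..1} \<times> K) \<inter> P"
    if "s \<in> {0..1}" "clique d n D E" "v \<in> weights E" "\<forall>k\<le>2 * d. bmoment n k v = U k s" for s E v
  proof -
    have "bmoment n 0 v \<le> M" using that(4) M[OF that(1)] by simp
    then have "v \<in> K" unfolding K_def using that(2,3) by blast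
    then show ?thesis using that(1,4) by (simp add: P_def less_Suc_eq_le)
  qed
  have cover: "{0..1} \<subseteq> up \<union> down"
  proof
    fix s :: real assume s: "s \<in> {0..1}"
    have "?u s \<in> weights {1..n}"
      using u0 u1 weights_mono s by (intro weights_convex) blast+
    then obtain E v where v: "clique d n D E" "v \<in> weights E" "\<forall>k\<le>2 * d. bmoment n k v = bmoment n k (?u s)"
      using cov unfolding covering_def by blast
    have "(s, v) \<in> ({0..1} \<times> K) \<inter> P" by (rule mem[OF s v(1,2)]) (use v(3) U in simp)
    then show "s \<in> up \<union> down"
      unfolding up_def down_def
      by (cases "U (Suc (2 * d)) s \<le> bmoment n (Suc (2 * d)) v") (force simp: image_iff)+
  qed
  have "(0, z0) \<in> ({0..1} \<times> K) \<inter> P" by (rule mem[OF _ z0(1,2)]) (use z0(3) in \<open>simp_all add: U_def\<close>)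
  then have "0 \<in> down" unfolding down_def using z0(4) by (force simp: image_iff U_def)
  moreover have "(1, z1) \<in> ({0..1} \<times> K) \<inter> P" by (rule mem[OF _ z1(1,2)]) (use z1(3) in \<open>simp_all add: U_def\<close>)
  then have "1 \<in> up" unfolding up_def using z1(4) by (force simp: image_iff U_def)
  moreover have "connected {0..1::real}" by simp
  ultimately have "up \<inter> down \<inter> {0..1} \<noteq> {}"
    using cover up_closed down_closed unfolding connected_closed by (metis Int_iff atLeastAtMost_iff empty_iff order.refl zero_le_one)
  then obtain s where s: "s \<in> {0..1}" "s \<in> up" "s \<in> down" by blast
  obtain v where v: "v \<in> K" "(s, v) \<in> P" "U (Suc (2 * d)) s \<le> bmoment n (Suc (2 * d)) v"
    using s(2) by (auto simp: up_def)
  obtain w where w: "w \<in> K" "(s, w) \<in> P" "bmoment n (Suc (2 * d)) w \<le> U (Suc (2 * d)) s"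
    using s(3) by (auto simp: down_def)
  obtain E where E: "clique d n D E" "v \<in> weights E" using v(1) by (auto simp: K_def)
  obtain F where F: "clique d n D F" "w \<in> weights F" using w(1) by (auto simp: K_def)
  \<comment> \<open>The simplices of \<open>D\<close> do not cross, so the two representations agree.\<close>
  have "v = w"
  proof (rule ccontr)
    assume ne: "v \<noteq> w"
    have eq: "bmoment n k v = bmoment n k w" if "k \<le> 2 * d" for k using v(2) w(2) that by (simp add: P_def)
    obtain X Y where XY: "length X = Suc d" "intertwines X Y"
      "set X \<subseteq> E \<and> set Y \<subseteq> F \<or> set X \<subseteq> F \<and> set Y \<subseteq> E"
      using intertwines_of_equal_moments[OF E(2) F(2) clique_bound[OF E(1)] clique_bound[OF F(1)] ne eq] by blast
    have sub: "set X \<subseteq> {1..n}" "set Y \<subseteq> {1..n}"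
      using XY(3) clique_bound[OF E(1)] clique_bound[OF F(1)] by blast+
    have "X \<in> D" "Y \<in> D"
      using XY(3) cliqueD[OF E(1)] cliqueD[OF F(1)] intertwines_sep(1)[OF XY(2,1) sub(1)]
        intertwines_sep(2)[OF XY(2,1) sub(2)] by blast+
    then show False using link_maximum XY(2) non_intertwiningD unfolding maximum_family_def by blast
  qed
  then have "bmoment n k v = bmoment n k (?u s)" if "k \<le> Suc (2 * d)" for k
    using v(2,3) w(3) that U by (cases "k = Suc (2 * d)") (auto simp: P_def)
  then show ?thesis using s(1) E by blast
qed

text \<open>
  If \<open>x\<close> passed above the link and \<open>x'\<close> below it, the segment between the two crossing points would meet
  the link in a point of the simplex on \<open>G\<close>. Either this point has two representations, and the resulting
  alternating sequence of \<open>2d + 3\<close> labels, prolonged by \<open>n + 1\<close> or \<open>n + 2\<close>, contradicts that \<open>A\<close> is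
  non-intertwining; or all vertices of \<open>x\<close> or all those of \<open>x'\<close> belong to a clique of the link, so that \<open>x\<close>
  or \<open>x'\<close> is itself in the link.
\<close>

lemma not_both_sides:
  assumes cov: "covering d n D"
    and G: "G \<subseteq> {1..n}" "clique (Suc d) (Suc n) (contraction n A) (insert (Suc n) G)"
    and x: "x \<in> sep d n" "set x \<subseteq> G" "y \<in> D" "intertwines y x"
    and x': "x' \<in> sep d n" "set x' \<subseteq> G" "y' \<in> D" "intertwines x' y'"
  shows False
proof -
  have no: "\<not> intertwines a b" if "a \<in> D" "b \<in> D" for a b
    using that link_maximum non_intertwiningD unfolding maximum_family_def by blast
  have len: "length y = Suc d" "length x' = Suc d"
    using sep_length[OF link_sep[OF x(3)]] sep_length[OF x'(1)] by simp_all
  have sub: "set y \<union> set x \<subseteq> {1..n}" "set x' \<union> set y' \<subseteq> {1..n}"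
    using sep_subset[OF x(1)] sep_subset[OF x'(1)] sep_subset[OF link_sep[OF x(3)]] sep_subset[OF link_sep[OF x'(3)]] by blast+
  obtain c where c: "\<forall>t\<in>set x. c t > 0" "\<forall>t\<in>set y. c t < 0" "\<forall>t. t \<notin> set y \<union> set x \<longrightarrow> c t = 0"
    "\<forall>k\<le>2 * d. bmoment n k c = 0" "bmoment n (Suc (2 * d)) c = 1"
    using intertwines_circuit[OF x(4) len(1) sub(1)] by (elim exE conjE) (rule that; assumption)
  obtain c' where c': "\<forall>t\<in>set y'. c' t > 0" "\<forall>t\<in>set x'. c' t < 0" "\<forall>t. t \<notin> set x' \<union> set y' \<longrightarrow> c' t = 0"
    "\<forall>k\<le>2 * d. bmoment n k c' = 0" "bmoment n (Suc (2 * d)) c' = 1"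
    using intertwines_circuit[OF x'(4) len(2) sub(2)] by (elim exE conjE) (rule that; assumption)
  \<comment> \<open>Positive and negative parts of the circuits represent the crossing points on \<open>x\<close>, \<open>y\<close> and \<open>x'\<close>, \<open>y'\<close>.\<close>
  define u0 z0 where "u0 = (\<lambda>t. max (c t) 0)" and "z0 = (\<lambda>t. max (- c t) 0)"
  define u1 z1 where "u1 = (\<lambda>t. max (- c' t) 0)" and "z1 = (\<lambda>t. max (c' t) 0)"
  have u0: "u0 \<in> weights (set x)"
    unfolding weights_def u0_def using c(2,3) by (auto simp: max_def) (metis Un_iff less_le_not_le linorder_not_le)
  have z0: "z0 \<in> weights (set y)"
    unfolding weights_def z0_def using c(1,3) by (auto simp: max_def) (metis Un_iff less_le_not_le linorder_not_le)
  have u1: "u1 \<in> weights (set x')"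
    unfolding weights_def u1_def using c'(1,3) by (auto simp: max_def) (metis Un_iff less_le_not_le linorder_not_le)
  have z1: "z1 \<in> weights (set y')"
    unfolding weights_def z1_def using c'(2,3) by (auto simp: max_def) (metis Un_iff less_le_not_le linorder_not_le)
  have "c = (\<lambda>t. u0 t - z0 t)" "c' = (\<lambda>t. z1 t - u1 t)" by (auto simp: u0_def z0_def u1_def z1_def)
  then have diff: "bmoment n k u0 - bmoment n k z0 = bmoment n k c" "bmoment n k z1 - bmoment n k u1 = bmoment n k c'" for k
    by (simp_all only: bmoment_diff)
  have "\<exists>s\<in>{0..1}. \<exists>E v. clique d n D E \<and> v \<in> weights E \<and>
    (\<forall>k\<le>Suc (2 * d). bmoment n k v = bmoment n k (\<lambda>t. (1 - s) * u0 t + s * u1 t))"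
  proof (rule segment_crosses_link[OF cov u0 sep_subset[OF x(1)] u1 sep_subset[OF x'(1)]
        clique_of_member[OF x(3) link_sep[OF x(3)]] z0 _ _ clique_of_member[OF x'(3) link_sep[OF x'(3)]] z1])
    show "\<forall>k\<le>2 * d. bmoment n k z0 = bmoment n k u0" using c(4) by (simp add: diff(1)[symmetric])
    show "\<forall>k\<le>2 * d. bmoment n k z1 = bmoment n k u1" using c'(4) by (simp add: diff(2)[symmetric])
    show "bmoment n (Suc (2 * d)) z0 \<le> bmoment n (Suc (2 * d)) u0" using diff(1)[of "Suc (2 * d)"] c(5) by simp
    show "bmoment n (Suc (2 * d)) u1 \<le> bmoment n (Suc (2 * d)) z1" using diff(2)[of "Suc (2 * d)"] c'(5) by simp
  qed
  then obtain s E v where s: "s \<in> {0..1}" and E: "clique d n D E" "v \<in> weights E"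
    and eq: "\<forall>k\<le>Suc (2 * d). bmoment n k v = bmoment n k (\<lambda>t. (1 - s) * u0 t + s * u1 t)" by blast
  define u where "u = (\<lambda>t. (1 - s) * u0 t + s * u1 t)"
  have uG: "u \<in> weights G"
    unfolding u_def using u0 u1 x(2) x'(2) weights_mono s by (intro weights_convex) blast+
  have "v \<noteq> u"
  proof
    assume "v = u"
    then have uE: "t \<in> E" if "0 < u t" for t using weights_pos_imp_mem[OF E(2)] that by blast
    show False
    proof (cases "s = 1")
      case True
      have "set x' \<subseteq> E"
      proof
        fix t assume "t \<in> set x'"
        then show "t \<in> E" using c'(2) True by (intro uE) (simp add: u_def u1_def)
      qed
      then have "x' \<in> D" by (rule cliqueD[OF E(1) x'(1)])
      then show False using no x'(3,4) by blast
    next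
      case False
      have "set x \<subseteq> E"
      proof
        fix t assume t: "t \<in> set x"
        have "0 < (1 - s) * u0 t" using t c(1) False s by (simp add: u0_def)
        moreover have "0 \<le> s * u1 t" using s weights_nonneg[OF u1] by simp
        ultimately show "t \<in> E" by (intro uE) (simp add: u_def)
      qed
      then have "x \<in> D" by (rule cliqueD[OF E(1) x(1)])
      then show False using no x(3,4) by blast
    qed
  qed
  moreover have "bmoment n k v = bmoment n k u" if "k \<le> Suc (2 * d)" for k using eq that by (simp add: u_def)
  ultimately obtain X Y where XY: "length Y = Suc d" "interlaced X Y"
    "set X \<subseteq> E \<and> set Y \<subseteq> G \<or> set X \<subseteq> G \<and> set Y \<subseteq> E"
    using interlaced_of_equal_moments[OF E(2) uG clique_bound[OF E(1)] G(1)] by blast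
  have subXY: "set X \<subseteq> {1..n}" "set Y \<subseteq> {1..n}" using XY(3) clique_bound[OF E(1)] G(1) by blast+
  have X: "X \<in> sep (Suc d) n" by (rule interlaced_sep[OF XY(2,1) subXY(1)])
  have Y: "Y \<in> sep d n" by (rule interlaced_inner_sep[OF XY(2,1) subXY(2)])
  have last_X: "last X \<le> n" using sep_last[OF X] by simp
  have tw: "intertwines X (Y @ [b])" if "n < b" for b
    by (rule interlaced_intertwines[OF XY(2,1)]) (use last_X that in simp)
  from XY(3) show False
  proof
    assume sets: "set X \<subseteq> E \<and> set Y \<subseteq> G"
    have XA: "X \<in> A" by (rule link_clique_sep_mem[OF E(1) X]) (use sets in blast)
    have "last Y \<in> set Y" using sep_ne[OF Y] by simp
    then have "last Y < last X" by (rule interlaced_less_last[OF XY(2) X])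
    then have "Y @ [Suc n] \<in> sep (Suc d) (Suc n)"
      using last_X sep_mono[OF Y] unfolding sep_snoc by simp
    then have "Y @ [Suc n] \<in> contraction n A" by (rule cliqueD[OF G(2)]) (use sets in auto)
    then obtain b where "n < b" "Y @ [b] \<in> A" using contraction_snoc by (metis lessI less_SucI)
    then show False using family_no_intertwine[OF XA] tw by blast
  next
    assume sets: "set X \<subseteq> G \<and> set Y \<subseteq> E"
    have "X \<in> contraction n A"
      by (rule cliqueD[OF G(2) sep_mono[OF X]]) (use sets in auto)
    then have XA: "X \<in> A" using last_X by (rule contraction_low)
    have "Y \<in> D" by (rule cliqueD[OF E(1) Y]) (use sets in blast)
    then show False using family_no_intertwine[OF XA link_upper] tw[of "Suc (Suc n)"] by simp
  qed
qed

section \<open>Extending cliques to cells\<close>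

text \<open>
  A cell of the contraction above the link keeps its vertex \<open>n + 1\<close>; below the link the vertex becomes
  \<open>n + 2\<close> (\<open>clique_add_upper\<close>).
\<close>

lemma clique_add_lower:
  assumes cl: "clique (Suc d) (Suc n) (contraction n A) (insert (Suc n) G)" and G: "G \<subseteq> {1..n}"
    and above: "\<And>x y. x \<in> sep d n \<Longrightarrow> set x \<subseteq> G \<Longrightarrow> y \<in> D \<Longrightarrow> \<not> intertwines x y"
  shows "clique (Suc d) (Suc (Suc n)) A (insert (Suc n) G)"
  unfolding clique_def
proof (intro conjI ballI impI)
  show "insert (Suc n) G \<subseteq> {1..Suc (Suc n)}" using G by auto
  fix W assume W: "W \<in> sep (Suc d) (Suc (Suc n))" "set W \<subseteq> insert (Suc n) G"
  have "last W \<in> insert (Suc n) G" using W(2) last_in_set[OF sep_ne[OF W(1)]] by blast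
  then have lW: "last W \<le> Suc n" using G by auto
  have W': "W \<in> sep (Suc d) (Suc n)" using W(1) lW by (rule sep_change_bound)
  have Wc: "W \<in> contraction n A" by (rule cliqueD[OF cl W' W(2)])
  show "W \<in> A"
  proof (cases "last W = Suc n")
    case False
    then show ?thesis using lW Wc contraction_low by simp
  next
    case True
    obtain w a where wa: "W = w @ [a]" "w \<in> sep d (Suc n)" "a \<le> Suc n" "last w + 2 \<le> a"
      using W' by (rule sep_Suc_cases)
    have a: "a = Suc n" using True wa(1) by simp
    have w: "w \<in> sep d n" using wa(2) by (rule sep_change_bound) (use wa a in simp)
    have "set w \<subseteq> G" using W(2) wa(1) sep_subset[OF w] by auto
    then have "w @ [Suc n] \<in> A"
      using snoc_lower_mem[OF w] Wc wa a above[OF w] by simp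
    then show ?thesis using wa(1) a by simp
  qed
qed

lemma clique_add_upper:
  assumes cl: "clique (Suc d) (Suc n) (contraction n A) (insert (Suc n) G)" and G: "G \<subseteq> {1..n}"
    and below: "\<And>x y. x \<in> sep d n \<Longrightarrow> set x \<subseteq> G \<Longrightarrow> y \<in> D \<Longrightarrow> \<not> intertwines y x"
  shows "clique (Suc d) (Suc (Suc n)) A (insert (Suc (Suc n)) G)"
  unfolding clique_def
proof (intro conjI ballI impI)
  show "insert (Suc (Suc n)) G \<subseteq> {1..Suc (Suc n)}" using G by auto
  fix W assume W: "W \<in> sep (Suc d) (Suc (Suc n))" "set W \<subseteq> insert (Suc (Suc n)) G"
  obtain w a where wa: "W = w @ [a]" "w \<in> sep d (Suc (Suc n))" "a \<le> Suc (Suc n)" "last w + 2 \<le> a"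
    using W(1) by (rule sep_Suc_cases)
  have w: "w \<in> sep d n" using wa(2) by (rule sep_change_bound) (use wa in simp)
  have wG: "set w \<subseteq> G" using W(2) wa(1) sep_subset[OF w] by auto
  show "W \<in> A"
  proof (cases "a = Suc (Suc n)")
    case False
    then have aG: "a \<in> G" "a \<le> n" using W(2) wa(1) G by auto
    then have "W \<in> sep (Suc d) (Suc n)" using W(1) wa(1) by (intro sep_change_bound[OF W(1)]) simp
    then have "W \<in> contraction n A" by (rule cliqueD[OF cl]) (use wa(1) wG aG in auto)
    then show ?thesis using contraction_low wa(1) aG by simp
  next
    case True
    have "last w = n \<or> w @ [Suc n] \<in> contraction n A"
    proof (cases "last w = n")
      case False
      then have "last w < n" using sep_last[OF w] by simp
      then have "w @ [Suc n] \<in> sep (Suc d) (Suc n)" unfolding sep_snoc using sep_mono[OF w] by simp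
      then have "w @ [Suc n] \<in> contraction n A" by (rule cliqueD[OF cl]) (use wG in auto)
      then show ?thesis by simp
    qed simp
    then have "w @ [Suc (Suc n)] \<in> A" using snoc_upper_mem[OF w] below[OF w wG] by blast
    then show ?thesis using wa(1) True by simp
  qed
qed

text \<open>
  A clique that lies on the link is extended inside the link and then joined to the whole edge.
\<close>

lemma extend_through_edge:
  assumes ext: "extendable d n D" and H: "clique d n D H" and z: "z \<in> sep d n" "set z \<subseteq> H"
  shows "\<exists>X Y. interlaced X Y \<and> length Y = Suc d \<and> set X \<subseteq> insert (Suc (Suc n)) H \<and>
    H \<union> {Suc n, Suc (Suc n)} \<subseteq> set X \<union> set Y \<and> clique (Suc d) (Suc (Suc n)) A (set X \<union> set Y)"
proof -
  obtain X Y where XY: "interlaced X Y" "length Y = d" "set X \<subseteq> H" "H \<subseteq> set X \<union> set Y"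
    "clique d n D (set X \<union> set Y)" by (rule extendableE[OF ext H z])
  have X: "X \<in> sep d n" by (rule interlaced_sep[OF XY(1,2)]) (use XY(3) clique_bound[OF H] in blast)
  have "last X < Suc n" using sep_last[OF X] by simp
  then have "interlaced (X @ [Suc (Suc n)]) (Y @ [Suc n])" by (rule interlaced_append[OF XY(1)]) simp
  moreover have "set (X @ [Suc (Suc n)]) \<union> set (Y @ [Suc n]) = (set X \<union> set Y) \<union> {Suc n, Suc (Suc n)}" by auto
  moreover note link_clique_join[OF XY(5)]
  ultimately show ?thesis using XY(2-4)
    by (intro exI[of _ "X @ [Suc (Suc n)]"] exI[of _ "Y @ [Suc n]"]) auto
qed

text \<open>
  A clique \<open>E\<close> is renamed to a clique of the contraction and extended there; the cell obtained is lifted to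
  the side of the link on which it lies. That side fits \<open>E\<close>, except that a clique which contains \<open>n + 2\<close> and otherwise
  lies on the link has to be extended inside the link.
\<close>

lemma extendable_step:
  assumes extC: "extendable (Suc d) (Suc n) (contraction n A)" and extD: "extendable d n D" and cov: "covering d n D"
  shows "extendable (Suc d) (Suc (Suc n)) A"
  unfolding extendable_def
proof (intro allI impI)
  fix E Z assume E: "clique (Suc d) (Suc (Suc n)) A E" and Z: "Z \<in> sep (Suc d) (Suc (Suc n))" "set Z \<subseteq> E"
  let ?goal = "\<exists>X Y. interlaced X Y \<and> length Y = Suc d \<and> set X \<subseteq> E \<and> E \<subseteq> set X \<union> set Y \<and>
      clique (Suc d) (Suc (Suc n)) A (set X \<union> set Y)"
  define H where "H = E \<inter> {1..n}"
  have E_sub: "E \<subseteq> H \<union> {Suc n, Suc (Suc n)}" using clique_bound[OF E] by (auto simp: H_def le_Suc_eq)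
  obtain z a where za: "Z = z @ [a]" "z \<in> sep d (Suc (Suc n))" "a \<le> Suc (Suc n)" "last z + 2 \<le> a"
    using Z(1) by (rule sep_Suc_cases)
  have z: "z \<in> sep d n" using za(2) by (rule sep_change_bound) (use za in simp)
  have zH: "set z \<subseteq> H" using Z(2) za(1) sep_subset[OF z] by (auto simp: H_def)
  have through_edge: ?goal if top: "Suc (Suc n) \<in> E" and cl: "clique d n D H"
  proof -
    obtain X Y where "interlaced X Y" "length Y = Suc d" "set X \<subseteq> insert (Suc (Suc n)) H"
      "H \<union> {Suc n, Suc (Suc n)} \<subseteq> set X \<union> set Y" "clique (Suc d) (Suc (Suc n)) A (set X \<union> set Y)"
      using extend_through_edge[OF extD cl z zH] by blast
    moreover have "insert (Suc (Suc n)) H \<subseteq> E" using top by (auto simp: H_def)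
    ultimately show ?thesis using E_sub by blast
  qed
  have above_or_below: "(\<forall>x y. x \<in> sep d n \<longrightarrow> set x \<subseteq> G \<longrightarrow> y \<in> D \<longrightarrow> \<not> intertwines x y) \<or>
      (\<forall>x y. x \<in> sep d n \<longrightarrow> set x \<subseteq> G \<longrightarrow> y \<in> D \<longrightarrow> \<not> intertwines y x)"
    if "G \<subseteq> {1..n}" "clique (Suc d) (Suc n) (contraction n A) (insert (Suc n) G)" for G
    using not_both_sides[OF cov that] by blast
  show ?goal
  proof (cases "Suc (Suc n) \<in> E")
    case notop: False
    have EC: "clique (Suc d) (Suc n) (contraction n A) E" by (rule clique_contraction[OF E notop])
    have "a \<in> E" using Z(2) za(1) by simp
    then have "a \<le> Suc n" using clique_bound[OF EC] by auto
    then have Z': "Z \<in> sep (Suc d) (Suc n)" using za(1) by (intro sep_change_bound[OF Z(1)]) simp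
    obtain X Y where XY: "interlaced X Y" "length Y = Suc d" "set X \<subseteq> E" "E \<subseteq> set X \<union> set Y"
      "clique (Suc d) (Suc n) (contraction n A) (set X \<union> set Y)" by (rule extendableE[OF extC EC Z' Z(2)])
    have X: "X \<in> sep (Suc d) (Suc n)"
      by (rule interlaced_sep[OF XY(1,2)]) (use XY(3) clique_bound[OF EC] in blast)
    have "clique (Suc d) (Suc (Suc n)) A (set X \<union> set Y)"
    proof (cases "Suc n \<in> E")
      case False
      have "last X \<in> E" using XY(3) last_in_set[OF sep_ne[OF X]] by blast
      then have "last X \<le> n" using False clique_bound[OF EC] by (metis atLeastAtMost_iff le_Suc_eq subsetD)
      then have bound: "t \<le> n" if "t \<in> set X \<union> set Y" for t
        using that sep_le_last[OF X] interlaced_less_last[OF XY(1) X] by fastforce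
      show ?thesis
        unfolding clique_def
      proof (intro conjI ballI impI)
        show "set X \<union> set Y \<subseteq> {1..Suc (Suc n)}" using clique_bound[OF XY(5)] by auto
        fix W assume W: "W \<in> sep (Suc d) (Suc (Suc n))" "set W \<subseteq> set X \<union> set Y"
        have lW: "last W \<le> n" using W(2) last_in_set[OF sep_ne[OF W(1)]] bound by blast
        then have "W \<in> sep (Suc d) (Suc n)" by (intro sep_change_bound[OF W(1)]) simp
        then have "W \<in> contraction n A" by (rule cliqueD[OF XY(5) _ W(2)])
        then show "W \<in> A" using lW by (rule contraction_low)
      qed
    next
      case True
      then have "Suc n \<in> set X \<union> set Y" using XY(4) by blast
      then obtain x where x: "X = x @ [Suc n]" "x \<in> sep d n" "last x < n" "intertwines x Y"
        "set x \<union> set Y \<subseteq> {1..n}" "set X \<union> set Y = insert (Suc n) (set x \<union> set Y)"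
        using interlaced_top_label[OF XY(1,2) clique_bound[OF XY(5)]] by blast
      have cl: "clique (Suc d) (Suc n) (contraction n A) (insert (Suc n) (set x \<union> set Y))" using XY(5) x(6) by simp
      from above_or_below[OF x(5) cl] show ?thesis
      proof
        assume "\<forall>xa y. xa \<in> sep d n \<longrightarrow> set xa \<subseteq> set x \<union> set Y \<longrightarrow> y \<in> D \<longrightarrow> \<not> intertwines xa y"
        then have "clique (Suc d) (Suc (Suc n)) A (insert (Suc n) (set x \<union> set Y))"
          by (intro clique_add_lower[OF cl x(5)]) blast
        then show ?thesis using x(6) by simp
      next
        \<comment> \<open>The even vertices of the cell lie in \<open>E\<close>, hence on the link, and its odd vertices lie above them.\<close>
        assume below: "\<forall>xa y. xa \<in> sep d n \<longrightarrow> set xa \<subseteq> set x \<union> set Y \<longrightarrow> y \<in> D \<longrightarrow> \<not> intertwines y xa"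
        have XA: "x @ [Suc n] \<in> A"
          using cliqueD[OF E sep_mono[OF X]] XY(3) x(1) by simp
        have "x \<in> D" using above_link[OF x(2) XA] below x(2) by (intro mem_link[OF x(2)]) blast
        moreover have "Y \<in> sep d n" by (rule intertwines_sep(2)[OF x(4) sep_length[OF x(2)]]) (use x(5) in blast)
        ultimately have "\<not> intertwines x Y" using below by blast
        then show ?thesis using x(4) by contradiction
      qed
    qed
    then show ?thesis using XY by blast
  next
    case top: True
    show ?thesis
    proof (cases "clique d n D H")
      case True
      then show ?thesis by (rule through_edge[OF top])
    next
      case False
      then obtain x0 where x0: "x0 \<in> sep d n" "set x0 \<subseteq> H" "x0 \<notin> D" by (auto simp: clique_def H_def)
      have upper: "x @ [Suc (Suc n)] \<in> A" if "x \<in> sep d n" "set x \<subseteq> H" for x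
      proof (rule cliqueD[OF E])
        show "x @ [Suc (Suc n)] \<in> sep (Suc d) (Suc (Suc n))"
          unfolding sep_snoc using sep_mono[OF that(1)] sep_last[OF that(1)] by simp
        show "set (x @ [Suc (Suc n)]) \<subseteq> E" using that(2) top by (auto simp: H_def)
      qed
      have "last x0 \<noteq> n" "x0 @ [Suc n] \<notin> A" using x0 upper by (auto simp: edge_link_def)
      then have lx0: "last x0 < n" using sep_last[OF x0(1)] by simp
      \<comment> \<open>\<open>x0\<close> is a part of \<open>E\<close> that passes below the link, which decides the side of the cell.\<close>
      have notin: "Suc n \<notin> E"
      proof
        assume "Suc n \<in> E"
        have "x0 @ [Suc n] \<in> A"
        proof (rule cliqueD[OF E])
          show "x0 @ [Suc n] \<in> sep (Suc d) (Suc (Suc n))" unfolding sep_snoc using sep_mono[OF x0(1)] lx0 by simp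
          show "set (x0 @ [Suc n]) \<subseteq> E" using x0(2) \<open>Suc n \<in> E\<close> by (auto simp: H_def)
        qed
        then show False using \<open>x0 @ [Suc n] \<notin> A\<close> by contradiction
      qed
      have E_eq: "E = insert (Suc (Suc n)) H" using E_sub top notin by (auto simp: H_def)
      have EC: "clique (Suc d) (Suc n) (contraction n A) (insert (Suc n) H)"
        unfolding clique_def
      proof (intro conjI ballI impI)
        show "insert (Suc n) H \<subseteq> {1..Suc n}" by (auto simp: H_def)
        fix W assume W: "W \<in> sep (Suc d) (Suc n)" "set W \<subseteq> insert (Suc n) H"
        obtain w b where wb: "W = w @ [b]" "w \<in> sep d (Suc n)" "b \<le> Suc n" "last w + 2 \<le> b"
          using W(1) by (rule sep_Suc_cases)
        have w: "w \<in> sep d n" using wb(2) by (rule sep_change_bound) (use wb in simp)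
        have wH: "set w \<subseteq> H" using W(2) wb(1) sep_subset[OF w] by auto
        show "W \<in> contraction n A"
        proof (cases "b = Suc n")
          case True
          then show ?thesis using upper[OF w wH] wb by (auto simp: contraction_def)
        next
          case False
          then have "set W \<subseteq> E" using W(2) wb(1) E_eq wH by auto
          then have "W \<in> A" by (rule cliqueD[OF E sep_mono[OF W(1)], rotated]) simp
          then show ?thesis using wb by (simp add: contraction_def)
        qed
      qed
      have "x0 @ [Suc n] \<in> sep (Suc d) (Suc n)" unfolding sep_snoc using sep_mono[OF x0(1)] lx0 by simp
      moreover have "set (x0 @ [Suc n]) \<subseteq> insert (Suc n) H" using x0(2) by auto
      ultimately obtain X Y where XY: "interlaced X Y" "length Y = Suc d" "set X \<subseteq> insert (Suc n) H"
        "insert (Suc n) H \<subseteq> set X \<union> set Y" "clique (Suc d) (Suc n) (contraction n A) (set X \<union> set Y)"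
        by (rule extendableE[OF extC EC])
      have "Suc n \<in> set X \<union> set Y" using XY(4) by blast
      then obtain x where x: "X = x @ [Suc n]" "x \<in> sep d n" "last x < n" "intertwines x Y"
        "set x \<union> set Y \<subseteq> {1..n}" "set X \<union> set Y = insert (Suc n) (set x \<union> set Y)"
        using interlaced_top_label[OF XY(1,2) clique_bound[OF XY(5)]] by blast
      have cl: "clique (Suc d) (Suc n) (contraction n A) (insert (Suc n) (set x \<union> set Y))" using XY(5) x(6) by simp
      have HG: "H \<subseteq> set x \<union> set Y"
      proof
        fix t assume t: "t \<in> H"
        then have "t \<in> set X \<union> set Y" "t \<noteq> Suc n" using XY(4) by (auto simp: H_def)
        then show "t \<in> set x \<union> set Y" using x(6) by blast
      qed
      have x0G: "set x0 \<subseteq> set x \<union> set Y" using x0(2) HG by blast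
      have "\<exists>y\<in>D. intertwines x0 y"
        using mem_link[OF x0(1)] below_link[OF x0(1) upper[OF x0(1,2)]] x0(3) by blast
      then have "\<forall>w y. w \<in> sep d n \<longrightarrow> set w \<subseteq> set x \<union> set Y \<longrightarrow> y \<in> D \<longrightarrow> \<not> intertwines y w"
        using above_or_below[OF x(5) cl] x0(1) x0G by blast
      then have clu: "clique (Suc d) (Suc (Suc n)) A (insert (Suc (Suc n)) (set x \<union> set Y))"
        by (intro clique_add_upper[OF cl x(5)]) blast
      have "last Y < Suc (Suc n)"
      proof -
        have "last Y \<in> set Y" using XY(2) by (intro last_in_set) auto
        then have "last Y \<le> n" using x(5) by auto
        then show ?thesis by simp
      qed
      then have "interlaced (x @ [Suc (Suc n)]) Y"
        unfolding interlaced_snoc[OF sep_length[OF x(2)] XY(2)] using x(4) by simp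
      moreover have "set (x @ [Suc (Suc n)]) \<subseteq> E"
        using XY(3) x(1) sep_subset[OF x(2)] E_eq by auto
      moreover have "E \<subseteq> set (x @ [Suc (Suc n)]) \<union> set Y" using E_eq HG by auto
      moreover have "set (x @ [Suc (Suc n)]) \<union> set Y = insert (Suc (Suc n)) (set x \<union> set Y)" by auto
      ultimately show ?thesis using XY(2) clu by (intro exI[of _ "x @ [Suc (Suc n)]"] exI[of _ Y]) simp
    qed
  qed
qed

end

lemma maximum_family_extendable:
  assumes "maximum_family d m A"
  shows "extendable d m A"
  using assms
proof (induction m arbitrary: d A rule: less_induct)
  case (less m)
  have A: "A \<subseteq> sep d m" "non_intertwining A" using less.prems by (auto simp: maximum_family_def)
  show ?case
  proof (cases d)
    case 0
    show ?thesis
      unfolding extendable_def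
    proof (intro allI impI)
      fix E Z assume E: "clique d m A E" and Z: "Z \<in> sep d m" "set Z \<subseteq> E"
      obtain b where b: "Z = [b]" "b \<in> {1..m}" using Z(1) unfolding 0 by (rule sep_zeroE)
      have ZA: "Z \<in> A" by (rule cliqueD[OF E Z])
      have eb: "e = b" if e: "e \<in> E" for e
      proof -
        have "e \<in> {1..m}" using e clique_bound[OF E] by blast
        then have "[e] \<in> sep d m" unfolding 0 by (simp add: separated_tuples_def)
        then have "[e] \<in> A" by (rule cliqueD[OF E]) (use e in simp)
        then have "\<not> intertwines [e] [b]" "\<not> intertwines [b] [e]"
          using non_intertwiningD[OF A(2)] ZA b(1) by blast+
        then have "\<not> e < b" "\<not> b < e" by (simp_all add: intertwines_def)
        then show ?thesis by simp
      qed
      have "E \<subseteq> set Z" unfolding b(1) using eb by (intro subsetI) simp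
      then have eq: "set Z \<union> set [] = E" using Z(2) by simp
      show "\<exists>X Y. interlaced X Y \<and> length Y = d \<and> set X \<subseteq> E \<and> E \<subseteq> set X \<union> set Y \<and> clique d m A (set X \<union> set Y)"
      proof (intro exI conjI)
        show "interlaced Z []" unfolding b(1) by (simp add: interlaced_def)
        show "clique d m A (set Z \<union> set [])" unfolding eq by (rule E)
        show "E \<subseteq> set Z \<union> set []" unfolding eq by simp
      qed (use Z(2) 0 in simp_all)
    qed
  next
    case (Suc e)
    show ?thesis
    proof (cases "m \<le> 2 * d")
      case True
      then have "sep d m = {}" by (rule sep_empty)
      then show ?thesis by (simp add: extendable_def)
    next
      case False
      define n where "n = m - 2"
      have n: "m = Suc (Suc n)" "2 * e < n" using False Suc by (auto simp: n_def)
      have max: "maximum_family (Suc e) (Suc (Suc n)) A" using less.prems n Suc by simp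
      note C = maximum_family_contract[OF max n(2)]
      have extC: "extendable (Suc e) (Suc n) (contraction n A)" by (rule less.IH[OF _ C(1)]) (simp add: n)
      have extD: "extendable e n (edge_link e n A)" by (rule less.IH[OF _ C(2)]) (simp add: n)
      have "extendable (Suc e) (Suc (Suc n)) A"
        by (rule extendable_step[OF max n(2) extC extD covering_of_extendable[OF C(2) extD]])
      then show ?thesis using n Suc by simp
    qed
  qed
qed

definition cells :: "nat \<Rightarrow> nat \<Rightarrow> nat list set \<Rightarrow> nat set set" where
  "cells d m A = {B. card B = 2 * d + 1 \<and> clique d m A B}"

lemma cells_bound: "B \<in> cells d m A \<Longrightarrow> B \<subseteq> {1..m} \<and> card B = 2 * d + 1"
  using clique_bound[of d m A B] by (simp add: cells_def)

text \<open>
  If all weights are positive, the point can be moved down. So the clique that carries it contains a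
  separated tuple and extends to a cell.
\<close>

lemma cell_cover:
  assumes A: "maximum_family d m A" and m: "2 * d + 1 \<le> m" and w: "w \<in> weights {1..m}" "\<forall>t\<in>{1..m}. 0 < w t"
  shows "\<exists>B v. card B = 2 * d + 1 \<and> clique d m A B \<and> v \<in> weights B \<and> (\<forall>k\<le>2 * d. bmoment m k v = bmoment m k w)"
proof -
  have ext: "extendable d m A" by (rule maximum_family_extendable[OF A])
  obtain E v where E: "clique d m A E" "v \<in> weights E" "\<forall>k\<le>2 * d. bmoment m k v = bmoment m k w"
    using covering_of_extendable[OF A ext] w(1) unfolding covering_def by blast
  define X where "X = map (\<lambda>i. Suc (2 * i)) [0..<Suc d]"
  define Y where "Y = map (\<lambda>i. Suc (2 * i + 1)) [0..<d]"
  have XY: "interlaced X Y" "length Y = d"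
    unfolding X_def Y_def using interlaced_chain[of d Suc] by simp_all
  have sub: "set X \<union> set Y \<subseteq> {1..m}" using m by (auto simp: X_def Y_def)
  have pos: "\<forall>t\<in>set X. 0 < w t" using w(2) sub by blast
  obtain w' where w': "w' \<in> weights {1..m}" "\<forall>k<2 * d. bmoment m k w' = bmoment m k w"
    "bmoment m (2 * d) w' < bmoment m (2 * d) w"
    using lower_along_interlaced[OF w(1) order.refl XY sub order.refl pos zero_less_one] by blast
  have "\<exists>Z W. interlaced Z W \<and> length W = d \<and> set Z \<subseteq> E \<and> set W \<subseteq> {1..m}"
    by (rule interlaced_sign_changes[where m = m, OF w'(1) E(2)]) (use w' E(3) in simp_all)
  then obtain Z W where Z: "interlaced Z W" "length W = d" "set Z \<subseteq> E" by blast
  have Zs: "Z \<in> sep d m" by (rule interlaced_sep[OF Z(1,2)]) (use Z(3) clique_bound[OF E(1)] in blast)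
  obtain P Q where PQ: "interlaced P Q" "length Q = d" "set P \<subseteq> E" "E \<subseteq> set P \<union> set Q"
    "clique d m A (set P \<union> set Q)" by (rule extendableE[OF ext E(1) Zs Z(3)])
  have "v \<in> weights (set P \<union> set Q)" using E(2) weights_mono[OF PQ(4)] by blast
  then show ?thesis using PQ(2,5) card_interlaced[OF PQ(1)] E(3)
    by (intro exI[of _ "set P \<union> set Q"] exI[of _ v]) simp
qed

section \<open>Points of the cyclic polytope as weights\<close>

definition pmoment :: "nat \<Rightarrow> nat \<Rightarrow> (nat \<Rightarrow> real) \<Rightarrow> real" where
  "pmoment m k c = (\<Sum>t=1..m. c t * real t ^ k)"

lemma times_choose: "t * (t choose j) = Suc j * (t choose Suc j) + j * (t choose j)"
proof (cases "j \<le> t")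
  case True
  then show ?thesis using binomial_absorb_comp[of t j] by (metis Suc_times_binomial_add add.commute add_mult_distrib binomial_absorption le_add_diff_inverse mult.commute)
qed (simp add: binomial_eq_0)

text \<open>
  The recursion \<open>t * (t choose j) = (j + 1) * (t choose (j + 1)) + j * (t choose j)\<close> keeps the leading
  coefficient a factorial.
\<close>

lemma power_as_binomials:
  "\<exists>a::nat \<Rightarrow> real. (\<forall>t::nat. real t ^ k = (\<Sum>j\<le>k. a j * real (t choose j))) \<and> a k = fact k"
proof (induction k)
  case 0
  show ?case by (intro exI[of _ "\<lambda>_. 1"]) simp
next
  case (Suc k)
  then obtain a where a: "\<And>t::nat. real t ^ k = (\<Sum>j\<le>k. a j * real (t choose j))" "a k = fact k" by blast
  define b where "b j = (if j \<le> k then real j * a j else 0) + (case j of 0 \<Rightarrow> 0 | Suc i \<Rightarrow> real (Suc i) * a i)" for j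
  have "real t ^ Suc k = (\<Sum>j\<le>Suc k. b j * real (t choose j))" for t
  proof -
    have step: "real t * real (t choose j) = real (Suc j) * real (t choose Suc j) + real j * real (t choose j)" for j
      using times_choose[of t j] by (metis of_nat_add of_nat_mult)
    have "real t ^ Suc k = (\<Sum>j\<le>k. a j * (real t * real (t choose j)))"
      by (simp add: a(1) sum_distrib_left mult.left_commute)
    also have "\<dots> = (\<Sum>j\<le>k. real j * a j * real (t choose j)) + (\<Sum>j\<le>k. real (Suc j) * a j * real (t choose Suc j))"
      unfolding step by (simp add: algebra_simps sum.distrib)
    also have "(\<Sum>j\<le>k. real j * a j * real (t choose j)) = (\<Sum>j\<le>Suc k. (if j \<le> k then real j * a j else 0) * real (t choose j))"
      by simp
    also have "(\<Sum>j\<le>k. real (Suc j) * a j * real (t choose Suc j)) =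
        (\<Sum>j\<le>Suc k. (case j of 0 \<Rightarrow> 0 | Suc i \<Rightarrow> real (Suc i) * a i) * real (t choose j))"
      unfolding sum.atMost_Suc_shift by simp
    finally show ?thesis unfolding b_def distrib_right sum.distrib .
  qed
  moreover have "b (Suc k) = fact (Suc k)" using a(2) by (simp add: b_def)
  ultimately show ?case by blast
qed

lemma pmoment_expansion:
  "\<exists>a::nat \<Rightarrow> real. \<forall>c. pmoment m k c = fact k * bmoment m k c + (\<Sum>j<k. a j * bmoment m j c)"
proof -
  obtain a where a: "\<And>t::nat. real t ^ k = (\<Sum>j\<le>k. a j * real (t choose j))" "a k = fact k"
    using power_as_binomials by blast
  have "pmoment m k c = (\<Sum>j\<le>k. a j * bmoment m j c)" for c
  proof -
    have "pmoment m k c = (\<Sum>t=1..m. \<Sum>j\<le>k. a j * (c t * real (t choose j)))"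
      unfolding pmoment_def a(1) sum_distrib_left by (simp add: mult.left_commute)
    also have "\<dots> = (\<Sum>j\<le>k. \<Sum>t=1..m. a j * (c t * real (t choose j)))" by (rule sum.swap)
    finally show ?thesis by (simp add: bmoment_def sum_distrib_left)
  qed
  then have "pmoment m k c = fact k * bmoment m k c + (\<Sum>j<k. a j * bmoment m j c)" for c
    using a(2) by (simp add: lessThan_Suc_atMost[symmetric])
  then show ?thesis by blast
qed

lemma pmoment_leading:
  assumes "\<And>j. j < k \<Longrightarrow> bmoment m j c = 0"
  shows "pmoment m k c = fact k * bmoment m k c"
proof -
  obtain a where "pmoment m k c = fact k * bmoment m k c + (\<Sum>j<k. a j * bmoment m j c)"
    using pmoment_expansion by blast
  then show ?thesis using assms by simp
qed

lemma pmoments_vanish_iff: "(\<forall>k<r. pmoment m k c = 0) \<longleftrightarrow> (\<forall>k<r. bmoment m k c = 0)"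
proof (induction r)
  case (Suc r)
  show ?case
    unfolding All_less_Suc Suc.IH using pmoment_leading[of r m c] by auto
qed simp

definition mpoint :: "nat \<Rightarrow> (nat \<Rightarrow> real) \<Rightarrow> real ^ 'n::{finite,linorder}" where
  "mpoint m w = (\<Sum>t=1..m. w t *\<^sub>R moment_point t)"

lemma mpoint_component: "mpoint m w $ i = pmoment m (card {..i}) w"
  by (simp add: mpoint_def pmoment_def moment_point_def)

lemma mpoint_diff: "mpoint m (\<lambda>t. a t - b t) = mpoint m a - mpoint m b"
  by (simp add: mpoint_def algebra_simps sum_subtractf)

lemma mpoint_convex: "mpoint m (\<lambda>t. (1 - s) * a t + s * b t) = (1 - s) *\<^sub>R mpoint m a + s *\<^sub>R mpoint m b"
  by (simp add: mpoint_def scaleR_left_distrib sum.distrib scaleR_sum_right)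

lemma card_atMost_less: "i < j \<Longrightarrow> card {..i} < card {..j::'n::{finite,linorder}}"
  by (rule psubset_card_mono) auto

lemma card_atMost_inj: "inj (\<lambda>i::'n::{finite,linorder}. card {..i})"
  by (rule linorder_injI) (use card_atMost_less in fastforce)

text \<open>
  The coordinates are numbered by \<open>1, ..., CARD('n)\<close> without repetition.
\<close>

lemma card_atMost_range: "range (\<lambda>i::'n::{finite,linorder}. card {..i}) = {1..CARD('n::{finite,linorder})}"
proof (rule card_subset_eq)
  show "range (\<lambda>i::'n. card {..i}) \<subseteq> {1..CARD('n)}"
  proof (rule image_subsetI)
    fix i :: 'n
    have "i \<in> {..i}" by simp
    then have "card {..i} > 0" by (metis card_gt_0_iff empty_iff finite)
    then show "card {..i} \<in> {1..CARD('n)}" using card_mono[of UNIV "{..i}"] by simp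
  qed
  show "card (range (\<lambda>i::'n. card {..i})) = card {1..CARD('n)}"
    using card_image[OF card_atMost_inj] by simp
qed simp

lemma card_atMost_top: "card {..i::'n::{finite,linorder}} = CARD('n::{finite,linorder}) \<longleftrightarrow> i = Max UNIV"
proof -
  have "{..Max (UNIV::'n set)} = UNIV" by auto
  then have "card {..Max (UNIV::'n set)} = CARD('n)" by simp
  then show ?thesis using card_atMost_inj by (metis injD)
qed

text \<open>
  The coordinates of a point are the power moments of its weights. Power moments and binomial moments
  vanish together, and the first one that does not vanish differs by a factorial.
\<close>

lemma mpoint_shift_iff:
  assumes dim: "CARD('n::{finite,linorder}) = 2 * d" "d \<ge> 1" and mass: "bmoment m 0 w = bmoment m 0 v"
  shows "(mpoint m w :: real ^ 'n::{finite,linorder}) = mpoint m v - s *\<^sub>R axis (Max UNIV) 1 \<longleftrightarrow>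
    (\<forall>k<2 * d. bmoment m k w = bmoment m k v) \<and> fact (2 * d) * (bmoment m (2 * d) v - bmoment m (2 * d) w) = s"
proof -
  define c where "c = (\<lambda>t. v t - w t)"
  have c: "bmoment m k c = bmoment m k v - bmoment m k w" for k by (simp add: c_def bmoment_diff)
  have c0: "pmoment m 0 c = 0" using mass c[of 0] by (simp add: pmoment_def bmoment_def)
  have "(mpoint m w :: (real, 'n) vec) = mpoint m v - s *\<^sub>R axis (Max UNIV) 1 \<longleftrightarrow>
      (mpoint m c :: (real, 'n) vec) = s *\<^sub>R axis (Max UNIV) 1"
    unfolding c_def mpoint_diff by (auto simp: algebra_simps)
  also have "\<dots> \<longleftrightarrow> (\<forall>i::'n. pmoment m (card {..i}) c = (if card {..i} = 2 * d then s else 0))"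
  proof -
    have "(s *\<^sub>R axis (Max UNIV) 1 :: (real, 'n) vec) $ i = (if card {..i} = 2 * d then s else 0)" for i
      using card_atMost_top[of i] dim(1) by (cases "i = Max UNIV") (simp_all add: axis_def)
    then show ?thesis by (simp only: vec_eq_iff mpoint_component)
  qed
  also have "\<dots> \<longleftrightarrow> (\<forall>k\<in>range (\<lambda>i::'n. card {..i}). pmoment m k c = (if k = 2 * d then s else 0))" by blast
  also have "\<dots> \<longleftrightarrow> (\<forall>k\<in>{1..2 * d}. pmoment m k c = (if k = 2 * d then s else 0))"
    unfolding card_atMost_range dim ..
  also have "\<dots> \<longleftrightarrow> (\<forall>k<2 * d. pmoment m k c = 0) \<and> pmoment m (2 * d) c = s"
  proof -
    have split: "{1..2 * d} = insert (2 * d) {1..<2 * d}" using dim(2) by auto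
    have "(\<forall>k\<in>{1..<2 * d}. pmoment m k c = (if k = 2 * d then s else 0)) \<longleftrightarrow> (\<forall>k\<in>{1..<2 * d}. pmoment m k c = 0)"
      by (intro ball_cong) auto
    also have "\<dots> \<longleftrightarrow> (\<forall>k<2 * d. pmoment m k c = 0)"
    proof (intro iffI ballI allI impI)
      fix k assume "\<forall>k\<in>{1..<2 * d}. pmoment m k c = 0" "k < 2 * d"
      then show "pmoment m k c = 0" using c0 by (cases "k = 0") simp_all
    qed simp
    finally have rest: "(\<forall>k\<in>{1..<2 * d}. pmoment m k c = (if k = 2 * d then s else 0)) \<longleftrightarrow>
        (\<forall>k<2 * d. pmoment m k c = 0)" .
    have top: "pmoment m (2 * d) c = (if 2 * d = 2 * d then s else 0) \<longleftrightarrow> pmoment m (2 * d) c = s" by simp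
    show ?thesis unfolding split ball_simps rest top by (rule conj_commute)
  qed
  also have "\<dots> \<longleftrightarrow> (\<forall>k<2 * d. bmoment m k c = 0) \<and> fact (2 * d) * bmoment m (2 * d) c = s"
    unfolding pmoments_vanish_iff by (rule conj_cong[OF refl]) (simp add: pmoment_leading)
  finally have "(mpoint m w :: (real, 'n) vec) = mpoint m v - s *\<^sub>R axis (Max UNIV) 1 \<longleftrightarrow>
      (\<forall>k<2 * d. bmoment m k c = 0) \<and> fact (2 * d) * bmoment m (2 * d) c = s" .
  moreover have "bmoment m k c = 0 \<longleftrightarrow> bmoment m k w = bmoment m k v" for k unfolding c by linarith
  ultimately show ?thesis unfolding c by simp
qed

lemma mpoint_eq_iff:
  assumes "CARD('n::{finite,linorder}) = 2 * d" "d \<ge> 1" and "bmoment m 0 w = bmoment m 0 v"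
  shows "(mpoint m w :: real ^ 'n::{finite,linorder}) = mpoint m v \<longleftrightarrow> (\<forall>k\<le>2 * d. bmoment m k w = bmoment m k v)"
proof -
  have "(mpoint m w :: (real, 'n) vec) = mpoint m v \<longleftrightarrow>
      (\<forall>k<2 * d. bmoment m k w = bmoment m k v) \<and> bmoment m (2 * d) w = bmoment m (2 * d) v"
  proof -
    have top: "fact (2 * d) * (bmoment m (2 * d) v - bmoment m (2 * d) w) = 0 \<longleftrightarrow> bmoment m (2 * d) w = bmoment m (2 * d) v"
      unfolding mult_eq_0_iff right_minus_eq by (metis fact_nonzero)
    have zero: "mpoint m v - 0 *\<^sub>R axis (Max UNIV) 1 = (mpoint m v :: (real, 'n) vec)" by simp
    show ?thesis using mpoint_shift_iff[OF assms, of 0] unfolding top zero .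
  qed
  also have "\<dots> \<longleftrightarrow> (\<forall>k<Suc (2 * d). bmoment m k w = bmoment m k v)" unfolding All_less_Suc by blast
  finally show ?thesis unfolding less_Suc_eq_le .
qed

definition mhull :: "nat set \<Rightarrow> (real ^ 'n::{finite,linorder}) set" where
  "mhull E = convex hull (moment_point ` E)"

lemma moment_point_inj: "inj (moment_point :: nat \<Rightarrow> real ^ 'n::{finite,linorder})"
proof (rule injI)
  fix s t assume eq: "moment_point s = (moment_point t :: (real, 'n) vec)"
  have "1 \<in> range (\<lambda>i::'n. card {..i})" unfolding card_atMost_range by (simp add: Suc_le_eq)
  then obtain i :: 'n where "1 = card {..i}" by (rule rangeE)
  then have i: "card {..i} = 1" by (rule sym)
  have "moment_point s $ i = real s" "moment_point t $ i = real t" unfolding moment_point_def by (simp_all add: i)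
  then show "s = t" unfolding eq by simp
qed

lemma mhull_weights:
  assumes "E \<subseteq> {1..m}"
  shows "(mhull E :: (real ^ 'n::{finite,linorder}) set) = mpoint m ` {w \<in> weights E. bmoment m 0 w = 1}"
proof -
  let ?p = "moment_point :: nat \<Rightarrow> (real, 'n) vec"
  have fin: "finite E" using assms finite_subset by blast
  have inj: "inj_on ?p E" using moment_point_inj by (rule inj_on_subset) simp
  have restrict: "(\<Sum>t=1..m. w t *\<^sub>R f t) = (\<Sum>t\<in>E. w t *\<^sub>R f t)" if "w \<in> weights E" for w and f :: "nat \<Rightarrow> 'b::real_vector"
    by (rule sum.mono_neutral_right) (use assms weights_zero[OF that] in auto)
  show ?thesis
  proof (intro set_eqI iffI)
    fix x assume "x \<in> (mhull E :: ((real, 'n) vec) set)"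
    then obtain u where u: "\<forall>y\<in>?p ` E. 0 \<le> u y" "sum u (?p ` E) = 1" "(\<Sum>y\<in>?p ` E. u y *\<^sub>R y) = x"
      unfolding mhull_def convex_hull_finite[OF finite_imageI[OF fin]] by blast
    define w where "w t = (if t \<in> E then u (?p t) else 0)" for t
    have w: "w \<in> weights E" using u(1) by (auto simp: weights_def w_def)
    have "bmoment m 0 w = (\<Sum>t\<in>E. w t)" using restrict[OF w, of "\<lambda>_. 1::real"] by (simp add: bmoment_def)
    also have "\<dots> = sum u (?p ` E)" unfolding sum.reindex[OF inj] by (simp add: w_def)
    finally have "bmoment m 0 w = 1" using u(2) by simp
    moreover have "mpoint m w = x"
    proof -
      have "mpoint m w = (\<Sum>t\<in>E. w t *\<^sub>R ?p t)" unfolding mpoint_def by (rule restrict[OF w])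
      also have "\<dots> = (\<Sum>y\<in>?p ` E. u y *\<^sub>R y)" unfolding sum.reindex[OF inj] by (simp add: w_def)
      finally show ?thesis using u(3) by simp
    qed
    ultimately show "x \<in> mpoint m ` {w \<in> weights E. bmoment m 0 w = 1}" using w by blast
  next
    fix x :: "(real, 'n) vec" assume "x \<in> mpoint m ` {w \<in> weights E. bmoment m 0 w = 1}"
    then obtain w where w: "w \<in> weights E" "bmoment m 0 w = 1" "x = mpoint m w" by blast
    have "(\<Sum>t\<in>E. w t) = 1" using restrict[OF w(1), of "\<lambda>_. 1::real"] w(2) by (simp add: bmoment_def)
    moreover have "x = (\<Sum>t\<in>E. w t *\<^sub>R ?p t)" unfolding w(3) mpoint_def by (rule restrict[OF w(1)])
    moreover have "(\<Sum>t\<in>E. w t *\<^sub>R ?p t) \<in> convex hull (?p ` E)" if "(\<Sum>t\<in>E. w t) = 1"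
      by (rule convex_sum[OF fin convex_convex_hull that weights_nonneg[OF w(1)]]) (simp add: hull_inc)
    ultimately show "x \<in> mhull E" unfolding mhull_def by simp
  qed
qed

lemma mhullE:
  assumes "x \<in> (mhull E :: (real ^ 'n::{finite,linorder}) set)" "E \<subseteq> {1..m}"
  obtains w where "w \<in> weights E" "bmoment m 0 w = 1" "x = mpoint m w"
  using assms(1) unfolding mhull_weights[OF assms(2)] by blast

lemma mhullI:
  assumes "w \<in> weights E" "bmoment m 0 w = 1" "E \<subseteq> {1..m}"
  shows "mpoint m w \<in> (mhull E :: (real ^ 'n::{finite,linorder}) set)"
  unfolding mhull_weights[OF assms(3)] using assms(1,2) by blast

lemma mhull_mono: "E \<subseteq> F \<Longrightarrow> mhull E \<subseteq> mhull F"
  unfolding mhull_def by (intro hull_mono image_mono)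

lemma cyclic_polytope_mhull: "cyclic_polytope m = mhull {1..m}"
  by (simp add: cyclic_polytope_def mhull_def)

lemma tuple_simplex_mhull: "tuple_simplex X = mhull (set X)"
  by (simp add: tuple_simplex_def mhull_def)

section \<open>Simplices and faces\<close>

lemma moment_point_mem_mhull: "t \<in> E \<Longrightarrow> moment_point t \<in> mhull E"
  unfolding mhull_def by (intro hull_inc imageI)

lemma closed_mhull: "finite E \<Longrightarrow> closed (mhull E)"
  unfolding mhull_def by (intro compact_imp_closed finite_imp_compact_convex_hull finite_imageI)

text \<open>
  The sets \<open>P\<close> are the unions of \<open>d\<close> disjoint pairs of neighbouring labels, that is, the vertex sets of
  the lower facets by Gale's evenness condition. If \<open>m\<close> lies in \<open>E\<close>, the pair \<open>m - 1, m\<close> is split off: a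
  separated \<open>d\<close>-tuple in the remaining part could be prolonged by \<open>m\<close>.
\<close>

lemma unseparated_extends:
  assumes "E \<subseteq> {1..m}" "2 * d \<le> m" "\<And>X. X \<in> sep d m \<Longrightarrow> \<not> set X \<subseteq> E"
  shows "\<exists>P. E \<subseteq> P \<and> P \<subseteq> {1..m} \<and> card P = 2 * d \<and> (\<forall>X\<in>sep d m. \<not> set X \<subseteq> P)"
  using assms
proof (induction m arbitrary: d E rule: less_induct)
  case (less m)
  show ?case
  proof (cases "m = 2 * d")
    case True
    then have "sep d m = {}" by (intro sep_empty) simp
    then show ?thesis using less.prems(1) True by (intro exI[of _ "{1..m}"]) simp
  next
    case False
    then have m: "2 * d < m" using less.prems(2) by simp
    show ?thesis
    proof (cases "m \<in> E")
      case notin: False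
      have "\<exists>P. E \<subseteq> P \<and> P \<subseteq> {1..m - 1} \<and> card P = 2 * d \<and> (\<forall>X\<in>sep d (m - 1). \<not> set X \<subseteq> P)"
      proof (rule less.IH)
        show "E \<subseteq> {1..m - 1}"
        proof
          fix t assume "t \<in> E"
          then have "t \<in> {1..m}" "t \<noteq> m" using less.prems(1) notin by auto
          then show "t \<in> {1..m - 1}" unfolding atLeastAtMost_iff by arith
        qed
        show "\<not> set X \<subseteq> E" if "X \<in> sep d (m - 1)" for X
          by (rule less.prems(3)[OF sep_mono[OF that]]) simp
      qed (use m in simp_all)
      then obtain P where P: "E \<subseteq> P" "P \<subseteq> {1..m - 1}" "card P = 2 * d" "\<forall>X\<in>sep d (m - 1). \<not> set X \<subseteq> P" by blast
      have "\<not> set X \<subseteq> P" if X: "X \<in> sep d m" for X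
      proof
        assume sub: "set X \<subseteq> P"
        have "last X \<in> P" using sub last_in_set[OF sep_ne[OF X]] by blast
        then have "last X \<le> m - 1" using P(2) by auto
        with X have "X \<in> sep d (m - 1)" by (rule sep_change_bound)
        then show False using P(4) sub by blast
      qed
      moreover have "{1..m - 1} \<subseteq> {1..m}" by auto
      ultimately show ?thesis using P(1-3) by blast
    next
      case top: True
      show ?thesis
      proof (cases d)
        case 0
        have "[m] \<in> sep d m" using top less.prems(1) by (auto simp: 0 separated_tuples_def)
        then show ?thesis using less.prems(3)[of "[m]"] top by simp
      next
        case (Suc e)
        define n where "n = m - 2"
        have n: "m = Suc (Suc n)" "2 * e \<le> n" using m Suc by (simp_all add: n_def)
        have "\<exists>P. E \<inter> {1..n} \<subseteq> P \<and> P \<subseteq> {1..n} \<and> card P = 2 * e \<and> (\<forall>X\<in>sep e n. \<not> set X \<subseteq> P)"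
        proof (rule less.IH)
          fix x assume x: "x \<in> sep e n"
          show "\<not> set x \<subseteq> E \<inter> {1..n}"
          proof
            assume sub: "set x \<subseteq> E \<inter> {1..n}"
            have "x @ [m] \<in> sep d m"
              unfolding Suc sep_snoc using sep_mono[OF x, of m] sep_last[OF x] n by simp
            then show False using less.prems(3) sub top by (metis Int_subset_iff empty_set insert_subset empty_subsetI le_sup_iff list.simps(15) set_append)
          qed
        qed (use n in simp_all)
        then obtain P where P: "E \<inter> {1..n} \<subseteq> P" "P \<subseteq> {1..n}" "card P = 2 * e" "\<forall>X\<in>sep e n. \<not> set X \<subseteq> P" by blast
        define Q where "Q = P \<union> {Suc n, m}"
        have "card Q = card P + card {Suc n, m}"
          unfolding Q_def by (rule card_Un_disjoint) (use P(2) n finite_subset in auto)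
        then have "card Q = 2 * d" using P(3) n Suc by simp
        moreover have "E \<subseteq> Q"
        proof
          fix t assume t: "t \<in> E"
          then have "t \<in> {1..n} \<or> t = Suc n \<or> t = m" using less.prems(1) n by auto
          then show "t \<in> Q" using t P(1) by (auto simp: Q_def)
        qed
        moreover have "Q \<subseteq> {1..m}" using P(2) n by (auto simp: Q_def)
        moreover have "\<not> set X \<subseteq> Q" if X: "X \<in> sep d m" for X
        proof
          assume sub: "set X \<subseteq> Q"
          obtain x a where xa: "X = x @ [a]" "x \<in> sep e m" "a \<le> m" "last x + 2 \<le> a"
            using X unfolding Suc by (rule sep_Suc_cases)
          have x: "x \<in> sep e n" using xa(2) by (rule sep_change_bound) (use xa n in simp)
          have "set x \<subseteq> P"
          proof
            fix t assume t: "t \<in> set x"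
            then have "t \<in> Q" "t \<le> n" using sub xa(1) sep_subset[OF x] by auto
            then show "t \<in> P" using n by (simp add: Q_def)
          qed
          then show False using P(4) x by blast
        qed
        ultimately show ?thesis by blast
      qed
    qed
  qed
qed

definition barycenter_weight :: "nat set \<Rightarrow> nat \<Rightarrow> real" where
  "barycenter_weight E t = (if t \<in> E then 1 / real (card E) else 0)"

lemma barycenter_weight:
  assumes "E \<subseteq> {1..m}" "E \<noteq> {}"
  shows "barycenter_weight E \<in> weights E" "\<forall>t\<in>E. 0 < barycenter_weight E t" "bmoment m 0 (barycenter_weight E) = 1"
proof -
  have fin: "finite E" using assms(1) finite_subset by blast
  have card: "card E > 0" using fin assms(2) by (simp add: card_gt_0_iff)
  show "barycenter_weight E \<in> weights E" by (simp add: weights_def barycenter_weight_def)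
  show "\<forall>t\<in>E. 0 < barycenter_weight E t" using card by (simp add: barycenter_weight_def)
  have "bmoment m 0 (barycenter_weight E) = (\<Sum>t\<in>E. barycenter_weight E t)"
    unfolding bmoment_def by (rule sum.mono_neutral_cong_right) (use assms(1) in \<open>auto simp: barycenter_weight_def\<close>)
  also have "\<dots> = (\<Sum>t\<in>E. 1 / real (card E))" by (rule sum.cong) (simp_all add: barycenter_weight_def)
  also have "\<dots> = 1" using card by simp
  finally show "bmoment m 0 (barycenter_weight E) = 1" .
qed

context
  fixes d :: nat
  assumes dim: "CARD('n::{finite,linorder}) = 2 * d" and d1: "d \<ge> 1"
begin

lemma equal_points:
  assumes "(mpoint m w :: (real, 'n) vec) = mpoint m v" "bmoment m 0 w = bmoment m 0 v" "k \<le> 2 * d"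
  shows "bmoment m k w = bmoment m k v"
  using mpoint_eq_iff[OF dim d1 assms(2)] assms(1,3) by blast

text \<open>
  Another representation of \<open>p\<^sub>t\<close> would give intertwining tuples, one of them with \<open>t\<close> as its only
  label; but they have \<open>d + 1\<close> distinct entries, and \<open>d\<close> is positive.
\<close>

lemma mhull_vertex:
  assumes t: "t \<in> {1..m}" "E \<subseteq> {1..m}" "moment_point t \<in> (mhull E :: (real, 'n) vec set)"
  shows "t \<in> E"
proof -
  obtain w where w: "w \<in> weights E" "bmoment m 0 w = 1" "(moment_point t :: (real, 'n) vec) = mpoint m w"
    using t(3,2) by (rule mhullE)
  define \<delta> :: "nat \<Rightarrow> real" where "\<delta> = (\<lambda>s. if s = t then 1 else 0)"
  have \<delta>: "\<delta> \<in> weights {t}" "bmoment m 0 \<delta> = 1"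
    using t(1) by (simp_all add: \<delta>_def weights_def bmoment_def)
  have "mpoint m \<delta> = (\<Sum>s\<in>{1..m}. if s = t then moment_point s else (0 :: (real, 'n) vec))"
    unfolding mpoint_def \<delta>_def by (intro sum.cong) auto
  also have "\<dots> = moment_point t" using t(1) by simp
  finally have eq: "(mpoint m \<delta> :: (real, 'n) vec) = mpoint m w" using w(3) by simp
  have "\<delta> = w"
  proof (rule ccontr)
    assume ne: "\<delta> \<noteq> w"
    have sub: "{t} \<subseteq> {1..m}" using t(1) by simp
    have mom: "bmoment m k \<delta> = bmoment m k w" if "k \<le> 2 * d" for k
      by (rule equal_points[OF eq _ that]) (use w(2) \<delta>(2) in simp)
    obtain X Y where XY: "length X = Suc d" "intertwines X Y" "set X \<subseteq> {t} \<and> set Y \<subseteq> E \<or> set X \<subseteq> E \<and> set Y \<subseteq> {t}"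
      using intertwines_of_equal_moments[OF \<delta>(1) w(1) sub t(2) ne mom] by blast
    have no: False if "Z \<in> sep d m" "set Z \<subseteq> {t}" for Z
    proof -
      have "0 < length Z" "1 < length Z" using sep_length[OF that(1)] d1 by simp_all
      then have "Z ! 0 \<in> set Z" "Z ! 1 \<in> set Z" by (simp_all only: nth_mem)
      then have "Z ! 0 = t" "Z ! 1 = t" using that(2) by blast+
      then show False using sep_less[OF that(1), of 0 1] d1 by simp
    qed
    have "set X \<subseteq> {1..m}" "set Y \<subseteq> {1..m}" using XY(3) sub t(2) by blast+
    then have "X \<in> sep d m" "Y \<in> sep d m" using intertwines_sep[OF XY(2,1)] by blast+
    then show False using no XY(3) by blast
  qed
  then have "w t = \<delta> t" by simp
  then have "0 < w t" by (simp add: \<delta>_def)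
  then show ?thesis by (rule weights_pos_imp_mem[OF w(1)])
qed

lemma mhull_subset_iff:
  assumes "E \<subseteq> {1..m}" "F \<subseteq> {1..m}"
  shows "(mhull E :: (real, 'n) vec set) \<subseteq> mhull F \<longleftrightarrow> E \<subseteq> F"
proof
  assume sub: "(mhull E :: (real, 'n) vec set) \<subseteq> mhull F"
  show "E \<subseteq> F"
  proof
    fix t assume t: "t \<in> E"
    then have "t \<in> {1..m}" using assms(1) by blast
    moreover have "(moment_point t :: (real, 'n) vec) \<in> mhull F" using sub moment_point_mem_mhull[OF t] by blast
    ultimately show "t \<in> F" by (rule mhull_vertex[OF _ assms(2)])
  qed
qed (rule mhull_mono)

lemma mhull_eq_iff:
  assumes "E \<subseteq> {1..m}" "F \<subseteq> {1..m}"
  shows "(mhull E :: (real, 'n) vec set) = mhull F \<longleftrightarrow> E = F"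
  using mhull_subset_iff[OF assms] mhull_subset_iff[OF assms(2,1)] by blast

text \<open>
  An affine dependence has vanishing moments up to order \<open>2d\<close>, so it needs \<open>2d + 2\<close> labels.
\<close>

lemma moment_points_affine_independent:
  assumes B: "B \<subseteq> {1..m}" "card B \<le> 2 * d + 1"
  shows "\<not> affine_dependent (moment_point ` B :: (real, 'n) vec set)"
proof
  let ?p = "moment_point :: nat \<Rightarrow> (real, 'n) vec"
  assume dep: "affine_dependent (?p ` B)"
  have fin: "finite B" using B(1) finite_subset by blast
  have inj: "inj_on ?p B" using moment_point_inj by (rule inj_on_subset) simp
  obtain U where U: "sum U (?p ` B) = 0" "\<exists>v\<in>?p ` B. U v \<noteq> 0" "(\<Sum>v\<in>?p ` B. U v *\<^sub>R v) = 0"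
    using dep unfolding affine_dependent_explicit_finite[OF finite_imageI[OF fin]] by blast
  define c where "c t = (if t \<in> B then U (?p t) else 0)" for t
  have restrict: "(\<Sum>t=1..m. c t *\<^sub>R f t) = (\<Sum>t\<in>B. U (?p t) *\<^sub>R f t)" for f :: "nat \<Rightarrow> 'b::real_vector"
  proof -
    have "(\<Sum>t=1..m. c t *\<^sub>R f t) = (\<Sum>t\<in>B. c t *\<^sub>R f t)"
      by (rule sum.mono_neutral_right) (use B(1) in \<open>auto simp: c_def\<close>)
    then show ?thesis by (simp add: c_def)
  qed
  have "bmoment m 0 c = 0"
    using restrict[of "\<lambda>_. 1::real"] U(1) unfolding sum.reindex[OF inj] by (simp add: bmoment_def)
  moreover have z: "bmoment m k (\<lambda>_. 0) = 0" for k by (simp add: bmoment_def)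
  moreover have "(mpoint m c :: (real, 'n) vec) = mpoint m (\<lambda>_. 0)"
    using restrict[of ?p] U(3) unfolding sum.reindex[OF inj] by (simp add: mpoint_def)
  ultimately have mom: "bmoment m k c = 0" if "k \<le> 2 * d" for k
    using equal_points[of m c "\<lambda>_. 0" k] that by simp
  obtain t where t: "t \<in> B" "U (?p t) \<noteq> 0" using U(2) by blast
  then have ct: "t \<in> {1..m}" "c t \<noteq> 0" using B(1) by (auto simp: c_def)
  have "\<exists>f::nat \<Rightarrow> nat. \<exists>\<sigma>::real. (\<sigma> = 1 \<or> \<sigma> = -1) \<and> (\<forall>i\<le>2*d. f i < f (Suc i)) \<and>
           (\<forall>i\<le>Suc (2*d). f i \<in> {1..m} \<and> \<sigma> * (-1) ^ i * c (f i) > 0)"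
    by (rule sign_changes_nonzero[OF mom ct])
  then obtain f \<sigma> where f: "\<And>i. i \<le> 2 * d \<Longrightarrow> f i < f (Suc i)"
    "\<And>i. i \<le> Suc (2 * d) \<Longrightarrow> 0 < \<sigma> * (-1) ^ i * c (f i)" by blast
  have "inj_on f {..Suc (2 * d)}" by (rule strict_chain_inj) (use f(1) in simp)
  then have "card (f ` {..Suc (2 * d)}) = 2 * d + 2" by (simp add: card_image)
  moreover have "f ` {..Suc (2 * d)} \<subseteq> B"
  proof (rule image_subsetI)
    fix i assume "i \<in> {..Suc (2 * d)}"
    then have "c (f i) \<noteq> 0" using f(2)[of i] by auto
    then show "f i \<in> B" by (auto simp: c_def split: if_splits)
  qed
  ultimately have "2 * d + 2 \<le> card B" using card_mono[OF fin] by metis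
  then show False using B(2) by simp
qed

lemma card_moment_points: "card (moment_point ` B :: (real, 'n) vec set) = card B"
  using moment_point_inj inj_on_subset by (intro card_image) blast

lemma mhull_simplex:
  assumes "B \<subseteq> {1..m}" "card B = 2 * d + 1"
  shows "int CARD('n) simplex (mhull B :: (real, 'n) vec set)"
  unfolding simplex_def
proof (intro exI conjI)
  show "\<not> affine_dependent (moment_point ` B :: (real, 'n) vec set)"
    using assms by (intro moment_points_affine_independent) simp_all
  show "int (card (moment_point ` B :: (real, 'n) vec set)) = int CARD('n) + 1"
    unfolding card_moment_points assms(2) dim by simp
qed (rule mhull_def)

lemma face_of_mhull_iff:
  assumes "B \<subseteq> {1..m}" "card B \<le> 2 * d + 1"
  shows "(F :: (real, 'n) vec set) face_of mhull B \<longleftrightarrow> (\<exists>C\<subseteq>B. F = mhull C)"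
  unfolding mhull_def face_of_convex_hull_affine_independent[OF moment_points_affine_independent[OF assms]]
  by (auto simp: subset_image_iff)

lemma extreme_points_simplex:
  assumes "B \<subseteq> {1..m}" "card B \<le> 2 * d + 1"
  shows "{v. v extreme_point_of (mhull B :: (real, 'n) vec set)} = moment_point ` B"
  unfolding mhull_def extreme_point_of_convex_hull_affine_independent[OF moment_points_affine_independent[OF assms]]
  by simp

lemma extreme_points_cyclic_polytope:
  "{v. v extreme_point_of (cyclic_polytope m :: (real, 'n) vec set)} = moment_point ` {1..m}"
proof
  show "{v. v extreme_point_of (cyclic_polytope m :: (real, 'n) vec set)} \<subseteq> moment_point ` {1..m}"
    unfolding cyclic_polytope_def by (rule extreme_points_of_convex_hull)
  show "moment_point ` {1..m} \<subseteq> {v. v extreme_point_of (cyclic_polytope m :: (real, 'n) vec set)}"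
  proof (rule image_subsetI)
    fix t assume t: "t \<in> {1..m}"
    have "(moment_point t :: (real, 'n) vec) \<notin> mhull ({1..m} - {t})"
      using mhull_vertex[OF t, of "{1..m} - {t}"] by blast
    then have "moment_point t extreme_point_of (convex hull (insert (moment_point t :: (real, 'n) vec) (moment_point ` ({1..m} - {t}))))"
      unfolding mhull_def by (intro extreme_point_of_convex_hull_insert) simp_all
    moreover have "insert (moment_point t :: (real, 'n) vec) (moment_point ` ({1..m} - {t})) = moment_point ` {1..m}"
      using t by blast
    ultimately show "moment_point t \<in> {v. v extreme_point_of (cyclic_polytope m :: (real, 'n) vec set)}"
      by (simp add: cyclic_polytope_def)
  qed
qed

lemma simplex_on_vertices:
  assumes "int CARD('n) simplex T" "{v. v extreme_point_of T} \<subseteq> {v. v extreme_point_of (cyclic_polytope m :: (real, 'n) vec set)}"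
  shows "\<exists>B\<subseteq>{1..m}. card B = 2 * d + 1 \<and> T = mhull B"
proof -
  obtain C where C: "\<not> affine_dependent C" "int (card C) = int CARD('n) + 1" "T = convex hull C"
    using assms(1) unfolding simplex_def by blast
  have "C = {v. v extreme_point_of T}"
    unfolding C(3) extreme_point_of_convex_hull_affine_independent[OF C(1)] by simp
  then have "C \<subseteq> moment_point ` {1..m}" using assms(2) unfolding extreme_points_cyclic_polytope by blast
  then obtain B where B: "B \<subseteq> {1..m}" "C = moment_point ` B" by (rule subset_imageE)
  have "card B = 2 * d + 1" using C(2) unfolding B(2) card_moment_points dim by simp
  then show ?thesis using B C(3) by (auto simp: mhull_def)
qed

lemma clique_weights_unique:
  assumes ni: "non_intertwining A" and E: "clique d m A E" "w \<in> weights E" and F: "clique d m A F" "v \<in> weights F"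
    and eq: "(mpoint m w :: (real, 'n) vec) = mpoint m v" "bmoment m 0 w = bmoment m 0 v"
  shows "w = v"
proof (rule ccontr)
  assume ne: "w \<noteq> v"
  obtain X Y where XY: "length X = Suc d" "intertwines X Y" "set X \<subseteq> E \<and> set Y \<subseteq> F \<or> set X \<subseteq> F \<and> set Y \<subseteq> E"
    using intertwines_of_equal_moments[OF E(2) F(2) clique_bound[OF E(1)] clique_bound[OF F(1)] ne equal_points[OF eq]]
    by blast
  have "set X \<subseteq> {1..m}" "set Y \<subseteq> {1..m}" using XY(3) clique_bound[OF E(1)] clique_bound[OF F(1)] by blast+
  then have "X \<in> sep d m" "Y \<in> sep d m" using intertwines_sep[OF XY(2,1)] by blast+
  then have "X \<in> A" "Y \<in> A" using XY(3) cliqueD[OF E(1)] cliqueD[OF F(1)] by blast+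
  then show False using non_intertwiningD[OF ni _ _ XY(2)] by blast
qed

lemma mhull_Int_cliques:
  assumes ni: "non_intertwining A" and E: "clique d m A E" and F: "clique d m A F"
  shows "(mhull E :: (real, 'n) vec set) \<inter> mhull F = mhull (E \<inter> F)"
proof
  show "(mhull (E \<inter> F) :: (real, 'n) vec set) \<subseteq> mhull E \<inter> mhull F" by (simp add: mhull_mono)
  show "(mhull E :: (real, 'n) vec set) \<inter> mhull F \<subseteq> mhull (E \<inter> F)"
  proof
    fix x assume x: "x \<in> (mhull E :: (real, 'n) vec set) \<inter> mhull F"
    obtain w where w: "w \<in> weights E" "bmoment m 0 w = 1" "x = mpoint m w"
      using IntD1[OF x] clique_bound[OF E] by (rule mhullE)
    obtain v where v: "v \<in> weights F" "bmoment m 0 v = 1" "x = mpoint m v"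
      using IntD2[OF x] clique_bound[OF F] by (rule mhullE)
    have "w = v"
      by (rule clique_weights_unique[OF ni E w(1) F v(1)]) (use w v in simp_all)
    then have "w \<in> weights (E \<inter> F)" using w(1) v(1) by (auto simp: weights_def)
    then show "x \<in> mhull (E \<inter> F)" unfolding w(3) using w(2) clique_bound[OF E] by (intro mhullI) blast+
  qed
qed

section \<open>Lower facets\<close>

text \<open>
  The entries of \<open>X\<close> are the even vertices of an interlaced pair, so the barycenter of its simplex can be
  moved down.
\<close>

lemma separated_not_in_lower_facet:
  assumes X: "X \<in> sep d m" and F: "lower_facet_of F (cyclic_polytope m :: (real, 'n) vec set)"
  shows "\<not> tuple_simplex X \<subseteq> F"
proof
  assume sub: "tuple_simplex X \<subseteq> F"
  note len = sep_length[OF X] and Xm = sep_subset[OF X]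
  define Y where "Y = map Suc (butlast X)"
  have Y: "interlaced X Y" "length Y = d"
    using len sep_gap[OF X] by (auto simp: Y_def interlaced_def nth_butlast Suc_le_eq)
  have Ym: "set Y \<subseteq> {1..m}"
  proof
    fix t assume t: "t \<in> set Y"
    then have "t < last X" by (rule interlaced_less_last[OF Y(1) X])
    then show "t \<in> {1..m}" using t sep_last[OF X] by (auto simp: Y_def)
  qed
  define w where "w = barycenter_weight (set X)"
  have w: "w \<in> weights (set X)" "\<forall>t\<in>set X. 0 < w t" "bmoment m 0 w = 1"
    unfolding w_def using barycenter_weight[OF Xm] sep_ne[OF X] by simp_all
  obtain v where v: "v \<in> weights {1..m}" "\<forall>k<2 * d. bmoment m k v = bmoment m k w"
    "bmoment m (2 * d) v < bmoment m (2 * d) w"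
    using lower_along_interlaced[OF w(1) Xm Y _ order.refl w(2) zero_less_one] Xm Ym by blast
  have mass: "bmoment m 0 v = bmoment m 0 w" using v(2) d1 by simp
  define s where "s = fact (2 * d) * (bmoment m (2 * d) w - bmoment m (2 * d) v)"
  have s: "0 < s" unfolding s_def using v(3) by simp
  have "(mpoint m v :: (real, 'n) vec) = mpoint m w - s *\<^sub>R axis (Max UNIV) 1"
    unfolding mpoint_shift_iff[OF dim d1 mass] using v(2) s_def by blast
  moreover have "(mpoint m v :: (real, 'n) vec) \<in> cyclic_polytope m"
    unfolding cyclic_polytope_mhull using v(1) mass w(3) by (intro mhullI) simp_all
  moreover have "(mpoint m w :: (real, 'n) vec) \<in> F"
    using sub mhullI[OF w(1,3) Xm] unfolding tuple_simplex_mhull by blast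
  ultimately show False using F s unfolding lower_facet_of_def by force
qed

text \<open>
  A lower point would give a separated tuple among the labels that carry \<open>x\<close>.
\<close>

lemma unseparated_lower:
  assumes P: "P \<subseteq> {1..m}" "\<forall>X\<in>sep d m. \<not> set X \<subseteq> P" and x: "x \<in> mhull P" and s: "0 < s"
  shows "x - s *\<^sub>R axis (Max UNIV) 1 \<notin> (cyclic_polytope m :: (real, 'n) vec set)"
proof
  assume "x - s *\<^sub>R axis (Max UNIV) 1 \<in> (cyclic_polytope m :: (real, 'n) vec set)"
  then obtain v where v: "v \<in> weights {1..m}" "bmoment m 0 v = 1" "x - s *\<^sub>R axis (Max UNIV) 1 = (mpoint m v :: (real, 'n) vec)"
    unfolding cyclic_polytope_mhull by (rule mhullE[OF _ order.refl])
  obtain w where w: "w \<in> weights P" "bmoment m 0 w = 1" "x = mpoint m w" using x P(1) by (rule mhullE)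
  have mass: "bmoment m 0 v = bmoment m 0 w" using v(2) w(2) by simp
  have "(mpoint m v :: (real, 'n) vec) = mpoint m w - s *\<^sub>R axis (Max UNIV) 1" using v(3) w(3) by simp
  then have eq: "\<forall>k<2 * d. bmoment m k v = bmoment m k w"
    and top: "fact (2 * d) * (bmoment m (2 * d) w - bmoment m (2 * d) v) = s"
    unfolding mpoint_shift_iff[OF dim d1 mass] by blast+
  have "0 < fact (2 * d) * (bmoment m (2 * d) w - bmoment m (2 * d) v)" using top s by simp
  then have "bmoment m (2 * d) v < bmoment m (2 * d) w" by (simp add: zero_less_mult_iff)
  then obtain X Y where X: "interlaced X Y" "length Y = d" "set X \<subseteq> P"
    using interlaced_sign_changes[OF v(1) w(1)] eq by blast
  have "X \<in> sep d m" by (rule interlaced_sep[OF X(1,2)]) (use X(3) P(1) in blast)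
  then show False using P(2) X(3) by blast
qed

text \<open>
  Points over \<open>P\<close> have only one representation, since of two intertwining tuples one would be a separated
  tuple in \<open>P\<close>. So the ends of a segment through such a point have no weight outside \<open>P\<close>.
\<close>

lemma unseparated_face:
  assumes P: "P \<subseteq> {1..m}" "\<forall>X\<in>sep d m. \<not> set X \<subseteq> P"
  shows "(mhull P :: (real, 'n) vec set) face_of cyclic_polytope m"
proof -
  have unique: "u = w" if u: "u \<in> weights {1..m}" "bmoment m 0 u = 1" and w: "w \<in> weights P" "bmoment m 0 w = 1"
    and eq: "(mpoint m u :: (real, 'n) vec) = mpoint m w" for u w
  proof (rule ccontr)
    assume ne: "u \<noteq> w"
    have mass: "bmoment m 0 u = bmoment m 0 w" using u(2) w(2) by simp
    obtain X Y where XY: "length X = Suc d" "intertwines X Y"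
      "set X \<subseteq> {1..m} \<and> set Y \<subseteq> P \<or> set X \<subseteq> P \<and> set Y \<subseteq> {1..m}"
      using intertwines_of_equal_moments[OF u(1) w(1) order.refl P(1) ne equal_points[OF eq mass]] by blast
    have "set X \<subseteq> {1..m}" "set Y \<subseteq> {1..m}" using XY(3) P(1) by blast+
    then have "X \<in> sep d m" "Y \<in> sep d m" using intertwines_sep[OF XY(2,1)] by blast+
    then show False using XY(3) P(2) by blast
  qed
  show ?thesis
    unfolding face_of_def
  proof (intro conjI ballI impI)
    show "(mhull P :: (real, 'n) vec set) \<subseteq> cyclic_polytope m"
      unfolding cyclic_polytope_mhull by (rule mhull_mono[OF P(1)])
    show "convex (mhull P :: (real, 'n) vec set)" unfolding mhull_def by (rule convex_convex_hull)
    fix a b x :: "(real, 'n) vec"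
    assume ab: "a \<in> cyclic_polytope m" "b \<in> cyclic_polytope m" and x: "x \<in> mhull P" "x \<in> open_segment a b"
    obtain \<alpha> where \<alpha>: "\<alpha> \<in> weights {1..m}" "bmoment m 0 \<alpha> = 1" "a = mpoint m \<alpha>"
      using ab(1) unfolding cyclic_polytope_mhull by (rule mhullE[OF _ order.refl])
    obtain \<beta> where \<beta>: "\<beta> \<in> weights {1..m}" "bmoment m 0 \<beta> = 1" "b = mpoint m \<beta>"
      using ab(2) unfolding cyclic_polytope_mhull by (rule mhullE[OF _ order.refl])
    obtain w where w: "w \<in> weights P" "bmoment m 0 w = 1" "x = mpoint m w" using x(1) P(1) by (rule mhullE)
    obtain u where u: "0 < u" "u < 1" "x = (1 - u) *\<^sub>R a + u *\<^sub>R b" using x(2) by (auto simp: in_segment)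
    have "(\<lambda>t. (1 - u) * \<alpha> t + u * \<beta> t) = w"
    proof (rule unique)
      show "(\<lambda>t. (1 - u) * \<alpha> t + u * \<beta> t) \<in> weights {1..m}"
        by (rule weights_convex[OF \<alpha>(1) \<beta>(1)]) (use u in simp)
      show "bmoment m 0 (\<lambda>t. (1 - u) * \<alpha> t + u * \<beta> t) = 1" unfolding bmoment_convex \<alpha>(2) \<beta>(2) by simp
      show "(mpoint m (\<lambda>t. (1 - u) * \<alpha> t + u * \<beta> t) :: (real, 'n) vec) = mpoint m w"
        unfolding mpoint_convex using u(3) \<alpha>(3) \<beta>(3) w(3) by simp
    qed (use w in simp_all)
    then have sum: "(1 - u) * \<alpha> t + u * \<beta> t = w t" for t by metis
    have zero: "\<alpha> t = 0 \<and> \<beta> t = 0" if "t \<notin> P" for t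
    proof -
      have "0 \<le> (1 - u) * \<alpha> t" "0 \<le> u * \<beta> t"
        using u weights_nonneg[OF \<alpha>(1), of t] weights_nonneg[OF \<beta>(1), of t] by simp_all
      moreover have "(1 - u) * \<alpha> t + u * \<beta> t = 0" using sum weights_zero[OF w(1) that] by simp
      ultimately have "(1 - u) * \<alpha> t = 0" "u * \<beta> t = 0" by linarith+
      then show ?thesis using u by simp
    qed
    have "\<alpha> \<in> weights P" "\<beta> \<in> weights P"
      using zero weights_nonneg[OF \<alpha>(1)] weights_nonneg[OF \<beta>(1)] by (simp_all add: weights_def)
    then show "a \<in> mhull P" "b \<in> mhull P" unfolding \<alpha>(3) \<beta>(3) using \<alpha>(2) \<beta>(2) P(1) by (intro mhullI; simp)+
  qed
qed

lemma aff_dim_mhull: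
  assumes "B \<subseteq> {1..m}" "card B \<le> 2 * d + 1"
  shows "aff_dim (mhull B :: (real, 'n) vec set) = int (card B) - 1"
proof -
  have "int (card (moment_point ` B :: (real, 'n) vec set)) = aff_dim (moment_point ` B :: (real, 'n) vec set) + 1"
    by (rule aff_dim_affine_independent[OF moment_points_affine_independent[OF assms]])
  then show ?thesis unfolding mhull_def aff_dim_convex_hull card_moment_points by simp
qed

lemma aff_dim_cyclic_polytope:
  assumes m: "2 * d + 1 \<le> m"
  shows "aff_dim (cyclic_polytope m :: (real, 'n) vec set) = int (2 * d)"
proof (rule antisym)
  show "aff_dim (cyclic_polytope m :: (real, 'n) vec set) \<le> int (2 * d)"
    using aff_dim_le_DIM[of "cyclic_polytope m :: (real, 'n) vec set"] dim by simp
  have sub: "{1..2 * d + 1} \<subseteq> {1..m}" using m by simp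
  have "aff_dim (mhull {1..2 * d + 1} :: (real, 'n) vec set) \<le> aff_dim (cyclic_polytope m :: (real, 'n) vec set)"
    unfolding cyclic_polytope_mhull by (intro aff_dim_subset mhull_mono sub)
  moreover have "aff_dim (mhull {1..2 * d + 1} :: (real, 'n) vec set) = int (2 * d)"
    using aff_dim_mhull[OF sub] by simp
  ultimately show "int (2 * d) \<le> aff_dim (cyclic_polytope m :: (real, 'n) vec set)" by simp
qed

text \<open>
  \<open>X\<close> is the only increasing \<open>(d + 1)\<close>-tuple on its own labels, so these contain no separated tuple and
  extend to the \<open>2d\<close> vertices of a lower facet.
\<close>

lemma unseparated_in_lower_facet:
  assumes m: "2 * d + 1 \<le> m" and X: "X \<in> increasing_tuples d m" "X \<notin> sep d m"
  shows "\<exists>F :: (real, 'n) vec set. lower_facet_of F (cyclic_polytope m) \<and> tuple_simplex X \<subseteq> F"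
proof -
  have Xm: "set X \<subseteq> {1..m}" using X(1) by (simp add: increasing_tuples_def)
  have "\<not> set Z \<subseteq> set X" if "Z \<in> sep d m" for Z
    using increasing_set_inj[OF sep_increasing[OF that] X(1)] that X(2) by blast
  then obtain P where P: "set X \<subseteq> P" "P \<subseteq> {1..m}" "card P = 2 * d" "\<forall>Z\<in>sep d m. \<not> set Z \<subseteq> P"
    using unseparated_extends[OF Xm, of d] m by auto
  have "(mhull P :: (real, 'n) vec set) facet_of cyclic_polytope m"
    unfolding facet_of_def
  proof (intro conjI)
    show "(mhull P :: (real, 'n) vec set) face_of cyclic_polytope m" by (rule unseparated_face[OF P(2,4)])
    have ad: "aff_dim (mhull P :: (real, 'n) vec set) = int (2 * d) - 1"
      using aff_dim_mhull[OF P(2)] P(3) by simp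
    then show "aff_dim (mhull P :: (real, 'n) vec set) = aff_dim (cyclic_polytope m :: (real, 'n) vec set) - 1"
      using aff_dim_cyclic_polytope[OF m] by simp
    show "(mhull P :: (real, 'n) vec set) \<noteq> {}"
    proof
      assume "(mhull P :: (real, 'n) vec set) = {}"
      then show False using ad d1 by simp
    qed
  qed
  then have "lower_facet_of (mhull P :: (real, 'n) vec set) (cyclic_polytope m)"
    unfolding lower_facet_of_def using unseparated_lower[OF P(2,4)] by blast
  moreover have "(tuple_simplex X :: (real, 'n) vec set) \<subseteq> mhull P"
    unfolding tuple_simplex_mhull by (rule mhull_mono[OF P(1)])
  ultimately show ?thesis by blast
qed

section \<open>The triangulation of a maximum family\<close>

lemma e_simplices_mhull:
  assumes m: "2 * d + 1 \<le> m" and \<B>: "\<And>B. B \<in> \<B> \<Longrightarrow> B \<subseteq> {1..m} \<and> card B = 2 * d + 1"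
  shows "e_simplices d m (mhull ` \<B> :: (real, 'n) vec set set) = {X \<in> sep d m. \<exists>B\<in>\<B>. set X \<subseteq> B}"
proof -
  have face: "(\<exists>T\<in>mhull ` \<B>. (tuple_simplex X :: (real, 'n) vec set) face_of T) \<longleftrightarrow> (\<exists>B\<in>\<B>. set X \<subseteq> B)"
    if X: "X \<in> increasing_tuples d m" for X
  proof -
    have Xm: "set X \<subseteq> {1..m}" using X by (simp add: increasing_tuples_def)
    have "(tuple_simplex X :: (real, 'n) vec set) face_of mhull B \<longleftrightarrow> set X \<subseteq> B" if "B \<in> \<B>" for B
    proof -
      have B: "B \<subseteq> {1..m}" "card B \<le> 2 * d + 1" using \<B>[OF that] by simp_all
      have "(tuple_simplex X :: (real, 'n) vec set) face_of mhull B \<longleftrightarrow> (\<exists>C\<subseteq>B. (mhull (set X) :: (real, 'n) vec set) = mhull C)"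
        unfolding tuple_simplex_mhull by (rule face_of_mhull_iff[OF B])
      also have "\<dots> \<longleftrightarrow> set X \<subseteq> B"
        using mhull_eq_iff[OF Xm] B(1) by (metis order.trans)
      finally show ?thesis .
    qed
    then show ?thesis by blast
  qed
  have lower: "(\<exists>F :: (real, 'n) vec set. lower_facet_of F (cyclic_polytope m) \<and> tuple_simplex X \<subseteq> F) \<longleftrightarrow> X \<notin> sep d m"
    if X: "X \<in> increasing_tuples d m" for X
    using unseparated_in_lower_facet[OF m X] separated_not_in_lower_facet[of X m] by blast
  show ?thesis unfolding e_simplices_def using face lower sep_increasing by blast
qed

text \<open>
  Points with all weights positive lie in cells, these points are dense, and the union of the cells is
  closed.
\<close>

lemma Union_cells:
  assumes A: "maximum_family d m A" and m: "2 * d + 1 \<le> m"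
  shows "\<Union>(mhull ` cells d m A) = (cyclic_polytope m :: (real, 'n) vec set)"
proof
  show "\<Union>(mhull ` cells d m A) \<subseteq> (cyclic_polytope m :: (real, 'n) vec set)"
    unfolding cyclic_polytope_mhull by (intro UN_least mhull_mono) (use cells_bound in blast)
  show "(cyclic_polytope m :: (real, 'n) vec set) \<subseteq> \<Union>(mhull ` cells d m A)"
  proof
    fix x assume "x \<in> (cyclic_polytope m :: (real, 'n) vec set)"
    then obtain w where w: "w \<in> weights {1..m}" "bmoment m 0 w = 1" "x = mpoint m w"
      unfolding cyclic_polytope_mhull by (rule mhullE[OF _ order.refl])
    let ?b = "barycenter_weight {1..m}"
    have b: "?b \<in> weights {1..m}" "\<forall>t\<in>{1..m}. 0 < ?b t" "bmoment m 0 ?b = 1"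
      using barycenter_weight[of "{1..m}" m] m by simp_all
    define s where "s j = inverse (real (Suc j))" for j
    have s: "0 < s j" "s j \<le> 1" for j by (simp_all add: s_def inverse_le_1_iff)
    define y where "y j = (1 - s j) *\<^sub>R x + s j *\<^sub>R (mpoint m ?b :: (real, 'n) vec)" for j
    \<comment> \<open>A point with positive weight at every vertex does not lie on a lower facet, so it lies in a cell.\<close>
    have mem: "y j \<in> \<Union>(mhull ` cells d m A)" for j
    proof -
      define u where "u = (\<lambda>t. (1 - s j) * w t + s j * ?b t)"
      have u: "u \<in> weights {1..m}" unfolding u_def by (rule weights_convex[OF w(1) b(1)]) (use s[of j] in simp)
      have pos: "\<forall>t\<in>{1..m}. 0 < u t"
      proof
        fix t assume t: "t \<in> {1..m}"
        have "0 \<le> (1 - s j) * w t" using s(2)[of j] weights_nonneg[OF w(1)] by simp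
        moreover have "0 < s j * ?b t" using s(1)[of j] b(2) t by simp
        ultimately show "0 < u t" by (simp add: u_def)
      qed
      have mass: "bmoment m 0 u = 1" unfolding u_def bmoment_convex w(2) b(3) by simp
      obtain B v where B: "card B = 2 * d + 1" "clique d m A B" "v \<in> weights B" "\<forall>k\<le>2 * d. bmoment m k v = bmoment m k u"
        using cell_cover[OF A m u pos] by (elim exE conjE) (rule that; assumption)
      have mass_v: "bmoment m 0 v = bmoment m 0 u" using B(4) by simp
      then have "(mpoint m v :: (real, 'n) vec) = mpoint m u" unfolding mpoint_eq_iff[OF dim d1 mass_v] using B(4) by simp
      also have "\<dots> = y j" unfolding u_def mpoint_convex y_def w(3) ..
      finally have "y j = mpoint m v" by simp
      moreover have "(mpoint m v :: (real, 'n) vec) \<in> mhull B"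
        by (rule mhullI[OF B(3) _ clique_bound[OF B(2)]]) (use mass_v mass in simp)
      ultimately have y: "y j \<in> mhull B" by simp
      have "B \<in> cells d m A" using B(1,2) by (simp add: cells_def)
      then show ?thesis using y by (rule UN_I)
    qed
    have cl: "closed (\<Union>(mhull ` cells d m A) :: (real, 'n) vec set)"
    proof (rule closed_UN)
      have "cells d m A \<subseteq> Pow {1..m}" using cells_bound by blast
      then show "finite (cells d m A)" by (rule finite_subset) simp
      show "\<forall>B\<in>cells d m A. closed (mhull B :: (real, 'n) vec set)"
      proof
        fix B assume "B \<in> cells d m A"
        then have "B \<subseteq> {1..m}" using cells_bound by blast
        then have "finite B" by (rule finite_subset) simp
        then show "closed (mhull B :: (real, 'n) vec set)" by (rule closed_mhull)
      qed
    qed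
    have lim: "y \<longlonglongrightarrow> x"
    proof -
      have s0: "s \<longlonglongrightarrow> 0" unfolding s_def[abs_def] by (rule LIMSEQ_inverse_real_of_nat)
      have "(\<lambda>j. (1 - s j) *\<^sub>R x + s j *\<^sub>R (mpoint m ?b :: (real, 'n) vec)) \<longlonglongrightarrow>
          (1 - 0) *\<^sub>R x + 0 *\<^sub>R mpoint m ?b"
        by (rule tendsto_add[OF tendsto_scaleR[OF tendsto_diff[OF tendsto_const s0] tendsto_const] tendsto_scaleR[OF s0 tendsto_const]])
      then show ?thesis unfolding y_def[abs_def] by simp
    qed
    show "x \<in> \<Union>(mhull ` cells d m A)" by (rule closed_sequentially[OF cl mem lim])
  qed
qed

lemma cells_triangulation:
  assumes A: "maximum_family d m A" and m: "2 * d + 1 \<le> m"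
  shows "triangulation_of_cyclic_polytope m (mhull ` cells d m A :: (real, 'n) vec set set)"
proof -
  have ni: "non_intertwining A" using A by (simp add: maximum_family_def)
  have "cells d m A \<subseteq> Pow {1..m}" using cells_bound by blast
  then have fin: "finite (cells d m A)" by (rule finite_subset) simp
  have sim: "int CARD('n) simplex (mhull B :: (real, 'n) vec set)" if "B \<in> cells d m A" for B
    by (rule mhull_simplex[OF conjunct1[OF cells_bound[OF that]] conjunct2[OF cells_bound[OF that]]])
  have face: "(mhull B :: (real, 'n) vec set) \<inter> mhull B' face_of mhull B"
    if B: "B \<in> cells d m A" and B': "B' \<in> cells d m A" for B B'
  proof -
    have cl: "clique d m A B" "clique d m A B'" using B B' by (simp_all add: cells_def)
    have bd: "B \<subseteq> {1..m}" "card B \<le> 2 * d + 1" using cells_bound[OF B] by simp_all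
    show ?thesis
      unfolding mhull_Int_cliques[OF ni cl] face_of_mhull_iff[OF bd] by blast
  qed
  have ext: "{v. v extreme_point_of (mhull B :: (real, 'n) vec set)} \<subseteq> {v. v extreme_point_of cyclic_polytope m}"
    if B: "B \<in> cells d m A" for B
  proof -
    have bd: "B \<subseteq> {1..m}" "card B \<le> 2 * d + 1" using cells_bound[OF B] by simp_all
    show ?thesis
      unfolding extreme_points_simplex[OF bd] extreme_points_cyclic_polytope
      using bd(1) by blast
  qed
  show ?thesis
    unfolding triangulation_of_cyclic_polytope_def triangulation_def
  proof (intro conjI allI impI ballI)
    show "finite (mhull ` cells d m A :: (real, 'n) vec set set)" using fin by simp
    show "\<Union>(mhull ` cells d m A) = (cyclic_polytope m :: (real, 'n) vec set)" by (rule Union_cells[OF A m])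
  next
    fix T :: "(real, 'n) vec set" assume "T \<in> mhull ` cells d m A"
    then obtain B where B: "B \<in> cells d m A" "T = mhull B" by blast
    show "int CARD('n) simplex T" unfolding B(2) by (rule sim[OF B(1)])
    then show "\<exists>n. n simplex T" by blast
    show "{v. v extreme_point_of T} \<subseteq> {v. v extreme_point_of cyclic_polytope m}"
      unfolding B(2) by (rule ext[OF B(1)])
  next
    fix T T' :: "(real, 'n) vec set" assume "T \<in> mhull ` cells d m A \<and> T' \<in> mhull ` cells d m A"
    then show "T \<inter> T' face_of T" using face by blast
  qed
qed

lemma e_simplices_cells:
  assumes A: "maximum_family d m A" and m: "2 * d + 1 \<le> m"
  shows "e_simplices d m (mhull ` cells d m A :: (real, 'n) vec set set) = A"
proof -
  have "{X \<in> sep d m. \<exists>B\<in>cells d m A. set X \<subseteq> B} = A"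
  proof (intro set_eqI iffI)
    fix X assume "X \<in> {X \<in> sep d m. \<exists>B\<in>cells d m A. set X \<subseteq> B}"
    then show "X \<in> A" by (auto simp: cells_def dest: cliqueD)
  next
    fix X assume XA: "X \<in> A"
    then have X: "X \<in> sep d m" using A by (auto simp: maximum_family_def)
    have "clique d m A (set X)" by (rule clique_of_member[OF XA X])
    then obtain P Q where PQ: "interlaced P Q" "length Q = d" "set P \<subseteq> set X" "set X \<subseteq> set P \<union> set Q"
      "clique d m A (set P \<union> set Q)"
      using X order.refl by (rule extendableE[OF maximum_family_extendable[OF A]])
    have "set P \<union> set Q \<in> cells d m A" using PQ(2,5) card_interlaced[OF PQ(1)] by (simp add: cells_def)
    then show "X \<in> {X \<in> sep d m. \<exists>B\<in>cells d m A. set X \<subseteq> B}" using X PQ(4) by blast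
  qed
  then show ?thesis using e_simplices_mhull[OF m cells_bound] by simp
qed

text \<open>
  The separated faces of a simplex of \<open>S\<close> are in \<open>e(S)\<close>, so its vertices form a cell; and no cell is left
  out, as its barycenter lies in a simplex of \<open>S\<close> and has only one representation.
\<close>

lemma triangulation_determined:
  assumes A: "maximum_family d m A" and m: "2 * d + 1 \<le> m"
    and S: "triangulation_of_cyclic_polytope m (S :: (real, 'n) vec set set)" "A = e_simplices d m S"
  shows "S = mhull ` cells d m A"
proof -
  have ni: "non_intertwining A" using A by (simp add: maximum_family_def)
  define \<B> where "\<B> = {B. B \<subseteq> {1..m} \<and> card B = 2 * d + 1 \<and> mhull B \<in> S}"
  have \<B>: "B \<subseteq> {1..m} \<and> card B = 2 * d + 1" if "B \<in> \<B>" for B using that by (simp add: \<B>_def)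
  have S_eq: "S = mhull ` \<B>"
  proof
    show "S \<subseteq> mhull ` \<B>"
    proof
      fix T assume T: "T \<in> S"
      then have "int CARD('n) simplex T" "{v. v extreme_point_of T} \<subseteq> {v. v extreme_point_of cyclic_polytope m}"
        using S(1) unfolding triangulation_of_cyclic_polytope_def by blast+
      then obtain B where "B \<subseteq> {1..m}" "card B = 2 * d + 1" "T = mhull B"
        using simplex_on_vertices by blast
      then show "T \<in> mhull ` \<B>" using T by (auto simp: \<B>_def)
    qed
  qed (auto simp: \<B>_def)
  have A_eq: "A = {X \<in> sep d m. \<exists>B\<in>\<B>. set X \<subseteq> B}"
    using S(2) e_simplices_mhull[OF m \<B>] unfolding S_eq by simp
  have sub: "\<B> \<subseteq> cells d m A"
  proof
    fix B assume B: "B \<in> \<B>"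
    then have "clique d m A B" unfolding clique_def using \<B>[OF B] A_eq by blast
    then show "B \<in> cells d m A" using \<B>[OF B] by (simp add: cells_def)
  qed
  \<comment> \<open>The barycenter of a further cell would lie in a simplex of \<open>S\<close> as well.\<close>
  have "cells d m A \<subseteq> \<B>"
  proof
    fix B assume B: "B \<in> cells d m A"
    have bd: "B \<subseteq> {1..m}" "card B = 2 * d + 1" using cells_bound[OF B] by simp_all
    then have "B \<noteq> {}" by auto
    note w = barycenter_weight[OF bd(1) this]
    have "(mpoint m (barycenter_weight B) :: (real, 'n) vec) \<in> cyclic_polytope m"
      using mhullI[OF w(1,3) bd(1)] mhull_mono[OF bd(1)] unfolding cyclic_polytope_mhull by blast
    then obtain B' where B': "B' \<in> \<B>" "(mpoint m (barycenter_weight B) :: (real, 'n) vec) \<in> mhull B'"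
      using S(1) S_eq unfolding triangulation_of_cyclic_polytope_def by blast
    obtain v where v: "v \<in> weights B'" "bmoment m 0 v = 1" "(mpoint m (barycenter_weight B) :: (real, 'n) vec) = mpoint m v"
      using B'(2) conjunct1[OF \<B>[OF B'(1)]] by (rule mhullE)
    have cl: "clique d m A B" "clique d m A B'" using B B'(1) sub by (auto simp: cells_def)
    have "barycenter_weight B = v"
      by (rule clique_weights_unique[OF ni cl(1) w(1) cl(2) v(1) v(3)]) (use w(3) v(2) in simp)
    then have "B \<subseteq> B'" using w(2) weights_pos_imp_mem[OF v(1)] by blast
    moreover have "finite B'" "card B' = card B" using \<B>[OF B'(1)] bd(2) finite_subset by auto
    ultimately have "B = B'" by (intro card_subset_eq) simp_all
    then show "B \<in> \<B>" using B'(1) by simp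
  qed
  then show ?thesis using S_eq sub by blast
qed

end

theorem theorem2p4:
  fixes d m :: nat and A :: "nat list set"
  assumes "d \<ge> 1" and "m \<ge> 2 * d + 1"
    and "CARD('n::{finite,linorder}) = 2 * d"
    and "A \<subseteq> separated_tuples d m"
    and "card A = (m - d - 1) choose d"
    and "non_intertwining A"
  shows "\<exists>!S :: (real ^ 'n::{finite,linorder}) set set.
           triangulation_of_cyclic_polytope m S \<and> A = e_simplices d m S"
proof -
  have A: "maximum_family d m A" using assms(4-6) by (simp add: maximum_family_def)
  show ?thesis
  proof (rule ex1I)
    show "triangulation_of_cyclic_polytope m (mhull ` cells d m A :: (real, 'n) vec set set) \<and>
        A = e_simplices d m (mhull ` cells d m A :: (real, 'n) vec set set)"
      using cells_triangulation[OF assms(3,1) A assms(2)] e_simplices_cells[OF assms(3,1) A assms(2)] by simp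
  next
    fix S :: "(real, 'n) vec set set"
    assume "triangulation_of_cyclic_polytope m S \<and> A = e_simplices d m S"
    then show "S = mhull ` cells d m A"
      using triangulation_determined[OF assms(3,1) A assms(2)] by blast
  qed
qed

end
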